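(* Let $(\mathcal{M},\tau)$ be a II$_1$-factor and let $x_1,\ldots ,x_m$ and $y_1,\ldots ,y_n$ be self-adjoint elements of $\mathcal{M}$ such that $y_1,\ldots ,y_n\in\{x_1,\ldots ,x_m\}''$ and $\chi (x_1,\ldots,x_m)>-\infty$. If $x_i=P_i(y_1,\ldots ,y_n)$ for all $1\leq i\leq m$, where $P_1,\ldots,P_m$ are noncommutative power series in $n$ indeterminates with complex coefficients having a common radius of convergence $R> b=\max\{\|y_1\|,\ldots ,\|y_n\|\}$, then $n\geq m$.
   Context: Radius of convergence: for a noncommutative power series $P(Y_1,\ldots,Y_n)=\sum_{k=0}^{\infty}\sum_{1\leq i_1,\ldots ,i_k\leq n} a_{i_1\ldots i_k} Y_{i_1}\cdots Y_{i_k}$ with complex coefficients, $R>0$ is called a radius of convergence of $P$ if $\sum_{k=0}^{\infty}\sum_{1\leq i_1,\ldots ,i_k\leq n}|a_{i_1\ldots i_k}| R^k<\infty$. Free entropy (Voiculescu): $\tau$ is the normalized faithful normal trace of $\mathcal{M}$. Let $\mathcal{M}_k^{sa}$ be the real vector space of $k\times k$ self-adjoint complex matrices, $\tau_k$ the normalized trace, with Euclidean norm $\|A\|_e=\sqrt{k}\,\tau_k(A^2)^{1/2}$ and the corresponding Lebesgue measure. For self-adjoint $x_1,\ldots,x_m\in\mathcal{M}$, $R,\epsilon>0$ and $q,k\in\mathbb{N}$, let $\Gamma_R(x_1,\ldots,x_m;q,k,\epsilon)$ be the set of $(A_1,\ldots,A_m)\in(\mathcal{M}_k^{sa})^m$ with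 $\|A_j\|\le R$ for all $j$ and $|\tau(x_{i_1}\cdots x_{i_s})-\tau_k(A_{i_1}\cdots A_{i_s})|<\epsilon$ for all $1\le s\le q$ and $i_1,\ldots,i_s\in\{1,\ldots,m\}$. Then $$\chi(x_1,\ldots,x_m)=\sup_{R>0}\ \inf_{q\in\mathbb{N},\,\epsilon>0}\ \limsup_{k\to\infty}\Big(\frac1{k^2}\log \mathrm{vol}_{mk^2}\,\Gamma_R(x_1,\ldots,x_m;q,k,\epsilon)+\frac m2\log k\Big),$$ with $\log 0=-\infty$. *)

theory Defs
  imports "HOL-Analysis.Analysis" "Jordan_Normal_Form.Matrix"
begin

hide_const (open) Finite_Cartesian_Product.vec Finite_Cartesian_Product.row
  Finite_Cartesian_Product.mat

section \<open>Complex Hilbert spaces and bounded operators\<close>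

text \<open>A complex Hilbert space is carried by its underlying real Hilbert space, so that the library
  norm is the Hilbert norm (the real inner product is the real part of the complex one) and the
  norm of the library type of bounded linear maps is the operator norm. The complex inner product
  is linear in the first argument.\<close>

class complex_hilbert_space = banach + real_inner +
  fixes scaleC :: "complex \<Rightarrow> 'a \<Rightarrow> 'a" (infixr \<open>*\<^sub>C\<close> 75)
    and cinner :: "'a \<Rightarrow> 'a \<Rightarrow> complex"
  assumes scaleC_add_right: "c *\<^sub>C (x + y) = c *\<^sub>C x + c *\<^sub>C y"
    and scaleC_add_left: "(c + d) *\<^sub>C x = c *\<^sub>C x + d *\<^sub>C x"
    and scaleC_scaleC: "c *\<^sub>C d *\<^sub>C x = (c * d) *\<^sub>C x"
    and scaleC_of_real: "complex_of_real r *\<^sub>C x = r *\<^sub>R x"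
    and cinner_commute: "cinner x y = cnj (cinner y x)"
    and cinner_add_left: "cinner (x + y) z = cinner x z + cinner y z"
    and cinner_scaleC_left: "cinner (c *\<^sub>C x) y = c * cinner x y"
    and Re_cinner: "Re (cinner x y) = inner x y"

lemma cinner_self: "cinner x x = complex_of_real ((norm x)\<^sup>2)"
  for x :: "'h::complex_hilbert_space"
proof (rule complex_eqI)
  show "Re (cinner x x) = Re (complex_of_real ((norm x)\<^sup>2))"
    by (simp add: Re_cinner power2_norm_eq_inner)
  have "Im (cinner x x) = - Im (cinner x x)"
    using arg_cong[OF cinner_commute[of x x], of Im] by simp
  then show "Im (cinner x x) = Im (complex_of_real ((norm x)\<^sup>2))" by simp
qed

lemma norm_scaleC: "norm (c *\<^sub>C x) = cmod c * norm x"
  for x :: "'h::complex_hilbert_space"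
proof -
  have "complex_of_real ((norm (c *\<^sub>C x))\<^sup>2) = c * cinner x (c *\<^sub>C x)"
    by (simp only: cinner_scaleC_left flip: cinner_self)
  also have "cinner x (c *\<^sub>C x) = cnj c * cinner x x"
    by (subst cinner_commute) (metis cinner_scaleC_left complex_cnj_mult cinner_commute)
  also have "c * (cnj c * cinner x x) = complex_of_real ((cmod c * norm x)\<^sup>2)"
    by (simp add: cinner_self power_mult_distrib complex_norm_square mult.assoc
        flip: of_real_power)
  finally have "(norm (c *\<^sub>C x))\<^sup>2 = (cmod c * norm x)\<^sup>2"
    using of_real_eq_iff by blast
  then show ?thesis by simp
qed

lemma bounded_linear_scaleC: "bounded_linear (\<lambda>x::'h::complex_hilbert_space. c *\<^sub>C x)"
proof (rule bounded_linear_intro[where K = "cmod c"])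
  fix r and x :: 'h
  show "c *\<^sub>C r *\<^sub>R x = r *\<^sub>R c *\<^sub>C x"
    by (simp add: scaleC_scaleC mult.commute flip: scaleC_of_real)
qed (simp_all add: scaleC_add_right norm_scaleC mult.commute)

type_synonym 'h op = "'h \<Rightarrow>\<^sub>L 'h"

lift_definition op_scaleC :: "complex \<Rightarrow> 'h op \<Rightarrow> 'h::complex_hilbert_space op"
    (infixr \<open>*\<^sub>O\<close> 75)
  is "\<lambda>c T x. c *\<^sub>C T x"
  by (rule bounded_linear_compose[OF bounded_linear_scaleC])

definition bounded_ops :: "'h::complex_hilbert_space op set" where
  "bounded_ops = {T. \<forall>c x. blinfun_apply T (c *\<^sub>C x) = c *\<^sub>C T x}"

definition is_adjoint :: "'h::complex_hilbert_space op \<Rightarrow> 'h op \<Rightarrow> bool" where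
  "is_adjoint T S \<longleftrightarrow> (\<forall>x y. cinner (T x) y = cinner x (S y))"

definition self_adjoint :: "'h::complex_hilbert_space op \<Rightarrow> bool" where
  "self_adjoint T \<longleftrightarrow> is_adjoint T T"

definition is_projection :: "'h::complex_hilbert_space op \<Rightarrow> bool" where
  "is_projection p \<longleftrightarrow> self_adjoint p \<and> p o\<^sub>L p = p"

definition op_word :: "(nat \<Rightarrow> 'h op) \<Rightarrow> nat list \<Rightarrow> 'h::complex_hilbert_space op" where
  "op_word x w = foldr (\<lambda>i T. x i o\<^sub>L T) w id_blinfun"

section \<open>Von Neumann algebras, II$_1$ factors and traces\<close>

definition commutant :: "'h::complex_hilbert_space op set \<Rightarrow> 'h op set" where
  "commutant X = {T \<in> bounded_ops. \<forall>S\<in>X. T o\<^sub>L S = S o\<^sub>L T}"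

definition von_neumann_algebra :: "'h::complex_hilbert_space op set \<Rightarrow> bool" where
  "von_neumann_algebra M \<longleftrightarrow>
     M \<subseteq> bounded_ops \<and>
     (\<forall>T\<in>M. \<exists>S\<in>M. is_adjoint T S) \<and>
     commutant (commutant M) = M"

definition factor :: "'h::complex_hilbert_space op set \<Rightarrow> bool" where
  "factor M \<longleftrightarrow>
     von_neumann_algebra M \<and> (id_blinfun :: 'h op) \<noteq> 0 \<and>
     M \<inter> commutant M = range (\<lambda>c. c *\<^sub>O id_blinfun)"

text \<open>The Murray--von Neumann type: the identity is a finite projection (every isometry in
  \<open>M\<close> is unitary), and there is no minimal projection.\<close>

definition type_II1_factor :: "'h::complex_hilbert_space op set \<Rightarrow> bool" where
  "type_II1_factor M \<longleftrightarrow>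
     factor M \<and>
     (\<forall>v\<in>M. \<forall>u\<in>M. is_adjoint v u \<and> u o\<^sub>L v = id_blinfun \<longrightarrow> v o\<^sub>L u = id_blinfun) \<and>
     (\<forall>p\<in>M. is_projection p \<and> p \<noteq> 0 \<longrightarrow>
        (\<exists>q\<in>M. is_projection q \<and> q \<noteq> 0 \<and> q \<noteq> p \<and> p o\<^sub>L q = q))"

text \<open>The ultraweak (\<open>\<sigma>\<close>-weak) topology is the initial topology for the functionals
  \<open>T \<mapsto> \<Sum>\<^sub>k \<langle>T \<xi>\<^sub>k, \<eta>\<^sub>k\<rangle>\<close> with square-summable \<open>\<xi>\<close>, \<open>\<eta>\<close>.\<close>

definition ultraweak_topology :: "'h::complex_hilbert_space op topology" where
  "ultraweak_topology = topology_generated_by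
     {{T. (\<Sum>k. cinner (blinfun_apply T (\<xi> k)) (\<eta> k)) \<in> U} | \<xi> \<eta> U.
        summable (\<lambda>k::nat. (norm (\<xi> k))\<^sup>2) \<and> summable (\<lambda>k. (norm (\<eta> k))\<^sup>2) \<and> open U}"

text \<open>Only the values of \<open>\<tau>\<close> on \<open>M\<close> matter. Normality is ultraweak continuity on \<open>M\<close>.\<close>

definition normalized_faithful_normal_trace ::
    "'h::complex_hilbert_space op set \<Rightarrow> ('h op \<Rightarrow> complex) \<Rightarrow> bool" where
  "normalized_faithful_normal_trace M \<tau> \<longleftrightarrow>
     (\<forall>S\<in>M. \<forall>T\<in>M. \<tau> (S + T) = \<tau> S + \<tau> T) \<and>
     (\<forall>c. \<forall>T\<in>M. \<tau> (c *\<^sub>O T) = c * \<tau> T) \<and>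
     \<tau> id_blinfun = 1 \<and>
     (\<forall>T\<in>M. \<forall>S\<in>M. is_adjoint T S \<longrightarrow> \<tau> (S o\<^sub>L T) \<in> \<real>\<^sub>\<ge>\<^sub>0) \<and>
     (\<forall>S\<in>M. \<forall>T\<in>M. \<tau> (S o\<^sub>L T) = \<tau> (T o\<^sub>L S)) \<and>
     (\<forall>T\<in>M. \<forall>S\<in>M. is_adjoint T S \<and> \<tau> (S o\<^sub>L T) = 0 \<longrightarrow> T = 0) \<and>
     continuous_map (subtopology ultraweak_topology M) euclidean \<tau>"

section \<open>Noncommutative power series\<close>

text \<open>A power series in \<open>n\<close> indeterminates is its family of coefficients, indexed by the words over
  \<open>{..<n}\<close>; values at other lists are irrelevant.\<close>

definition words :: "nat \<Rightarrow> nat \<Rightarrow> nat list set" where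
  "words n k = {w. length w = k \<and> set w \<subseteq> {..<n}}"

definition radius_of_convergence :: "nat \<Rightarrow> (nat list \<Rightarrow> complex) \<Rightarrow> real \<Rightarrow> bool" where
  "radius_of_convergence n a R \<longleftrightarrow>
     R > 0 \<and> summable (\<lambda>k. \<Sum>w\<in>words n k. cmod (a w) * R ^ k)"

definition nc_power_series_eval ::
    "nat \<Rightarrow> (nat list \<Rightarrow> complex) \<Rightarrow> (nat \<Rightarrow> 'h op) \<Rightarrow> 'h::complex_hilbert_space op" where
  "nc_power_series_eval n a y = (\<Sum>k. \<Sum>w\<in>words n k. a w *\<^sub>O op_word y w)"

section \<open>Self-adjoint matrices and their Lebesgue measure\<close>

definition sa_mats :: "nat \<Rightarrow> complex mat set" where
  "sa_mats k = {A \<in> carrier_mat k k. \<forall>i<k. \<forall>j<k. A $$ (j, i) = cnj (A $$ (i, j))}"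

definition normalized_mat_trace :: "nat \<Rightarrow> complex mat \<Rightarrow> complex" where
  "normalized_mat_trace k A = (\<Sum>i<k. A $$ (i, i)) / of_nat k"

definition mat_euclidean_norm :: "nat \<Rightarrow> complex mat \<Rightarrow> real" where
  "mat_euclidean_norm k A = sqrt (real k) * sqrt (Re (normalized_mat_trace k (A * A)))"

definition vec_l2_norm :: "complex Matrix.vec \<Rightarrow> real" where
  "vec_l2_norm v = L2_set (\<lambda>i. cmod (vec_index v i)) {..<dim_vec v}"

definition mat_opnorm :: "complex mat \<Rightarrow> real" where
  "mat_opnorm A =
     (SUP v\<in>{v \<in> carrier_vec (dim_col A). vec_l2_norm v \<le> 1}. vec_l2_norm (A *\<^sub>v v))"

definition mat_word :: "nat \<Rightarrow> (nat \<Rightarrow> complex mat) \<Rightarrow> nat list \<Rightarrow> complex mat" where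
  "mat_word k A w = foldr (\<lambda>i B. A i * B) w (1\<^sub>m k)"

text \<open>Real coordinates on the self-adjoint matrices with respect to the basis
  \<open>E\<^sub>i\<^sub>i\<close>, \<open>(E\<^sub>i\<^sub>j + E\<^sub>j\<^sub>i)/\<surd>2\<close>, \<open>\<i>(E\<^sub>i\<^sub>j - E\<^sub>j\<^sub>i)/\<surd>2\<close> for \<open>i < j\<close>, which is orthonormal for
  \<open>mat_euclidean_norm\<close>; the last two have coordinates \<open>t (i, j)\<close> and \<open>t (j, i)\<close>.\<close>

definition sa_mat_of_coords :: "nat \<Rightarrow> (nat \<times> nat \<Rightarrow> real) \<Rightarrow> complex mat" where
  "sa_mat_of_coords k t = mat k k (\<lambda>(i, j).
     if i = j then complex_of_real (t (i, i))
     else if i < j then Complex (t (i, j) / sqrt 2) (t (j, i) / sqrt 2)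
     else Complex (t (j, i) / sqrt 2) (- t (i, j) / sqrt 2))"

lemma sa_mat_of_coords_in_sa_mats: "sa_mat_of_coords k t \<in> sa_mats k"
  by (auto simp: sa_mats_def sa_mat_of_coords_def complex_eq_iff)

lemma mat_euclidean_norm_sa_mat_of_coords:
  "mat_euclidean_norm k (sa_mat_of_coords k t) = L2_set t ({..<k} \<times> {..<k})"
proof (cases "k = 0")
  case True
  then show ?thesis by (simp add: mat_euclidean_norm_def)
next
  case False
  define A where "A = sa_mat_of_coords k t"
  have dim: "A \<in> carrier_mat k k"
    by (simp add: A_def sa_mat_of_coords_def)
  have pt: "A $$ (i, j) * A $$ (j, i) + A $$ (j, i) * A $$ (i, j)
      = complex_of_real ((t (i, j))\<^sup>2 + (t (j, i))\<^sup>2)" if "i < k" "j < k" for i j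
    using that
    by (cases i j rule: linorder_cases)
       (auto simp: A_def sa_mat_of_coords_def complex_eq_iff power2_eq_square field_simps)
  have "(\<Sum>i<k. (A * A) $$ (i, i)) = (\<Sum>i<k. \<Sum>j<k. A $$ (i, j) * A $$ (j, i))"
    using dim by (auto simp: scalar_prod_def lessThan_atLeast0 intro!: sum.cong)
  moreover have "2 * (\<Sum>i<k. \<Sum>j<k. A $$ (i, j) * A $$ (j, i))
      = 2 * complex_of_real (\<Sum>i<k. \<Sum>j<k. (t (i, j))^2)"
  proof -
    have "2 * (\<Sum>i<k. \<Sum>j<k. A $$ (i, j) * A $$ (j, i))
        = (\<Sum>i<k. \<Sum>j<k. A $$ (i, j) * A $$ (j, i) + A $$ (j, i) * A $$ (i, j))"
      by (simp only: sum_distrib_left) (intro sum.cong refl, simp)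
    also have "\<dots> = (\<Sum>i<k. \<Sum>j<k. complex_of_real ((t (i, j))^2 + (t (j, i))^2))"
      by (intro sum.cong refl pt) auto
    also have "\<dots> = complex_of_real ((\<Sum>i<k. \<Sum>j<k. (t (i, j))^2) + (\<Sum>i<k. \<Sum>j<k. (t (j, i))^2))"
      by (simp add: sum.distrib)
    also have "(\<Sum>i<k. \<Sum>j<k. (t (j, i))^2) = (\<Sum>i<k. \<Sum>j<k. (t (i, j))^2)"
      by (rule sum.swap)
    finally show ?thesis by simp
  qed
  ultimately have "(\<Sum>i<k. (A * A) $$ (i, i)) = complex_of_real (\<Sum>i<k. \<Sum>j<k. (t (i, j))^2)"
    by simp
  then have "normalized_mat_trace k (A * A)
      = complex_of_real ((\<Sum>i<k. \<Sum>j<k. (t (i, j))^2) / real k)"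
    by (simp add: normalized_mat_trace_def)
  then show ?thesis
    using False
    by (simp add: mat_euclidean_norm_def L2_set_def sum.cartesian_product
        flip: A_def real_sqrt_mult)
qed

lemma bij_betw_sa_mat_of_coords:
  "bij_betw (sa_mat_of_coords k) ({..<k} \<times> {..<k} \<rightarrow>\<^sub>E UNIV) (sa_mats k)"
proof (rule bij_betw_byWitness)
  define g where "g A = (\<lambda>(i, j)\<in>{..<k} \<times> {..<k}.
     if i = j then Re (A $$ (i, i)) else if i < j then sqrt 2 * Re (A $$ (i, j))
     else sqrt 2 * Im (A $$ (j, i)))" for A :: "complex mat"
  show "\<forall>t\<in>{..<k} \<times> {..<k} \<rightarrow>\<^sub>E UNIV. g (sa_mat_of_coords k t) = t"
    by (auto simp: g_def sa_mat_of_coords_def fun_eq_iff PiE_def extensional_def)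
  have dims: "dim_row A = k \<and> dim_col A = k" if "A \<in> sa_mats k" for A
    using that by (auto simp only: sa_mats_def mem_Collect_eq carrier_matD)
  show "\<forall>A\<in>sa_mats k. sa_mat_of_coords k (g A) = A"
  proof (intro ballI eq_matI)
    fix A i j assume A: "A \<in> sa_mats k" and "i < dim_row A" "j < dim_col A"
    then have ij: "i < k" "j < k" using dims by auto
    have eq: "A $$ (j, i) = cnj (A $$ (i, j))" "A $$ (i, i) = cnj (A $$ (i, i))"
      using A ij unfolding sa_mats_def by blast+
    have herm: "Re (A $$ (j, i)) = Re (A $$ (i, j))" "Im (A $$ (j, i)) = - Im (A $$ (i, j))"
        "Im (A $$ (i, i)) = 0"
      using arg_cong[OF eq(1), of Re] arg_cong[OF eq(1), of Im] arg_cong[OF eq(2), of Im]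
      by simp_all
    show "sa_mat_of_coords k (g A) $$ (i, j) = A $$ (i, j)"
      using ij herm by (cases i j rule: linorder_cases)
        (auto simp: g_def sa_mat_of_coords_def complex_eq_iff)
  qed (simp_all add: dims sa_mat_of_coords_def)
  show "sa_mat_of_coords k ` ({..<k} \<times> {..<k} \<rightarrow>\<^sub>E UNIV) \<subseteq> sa_mats k"
    using sa_mat_of_coords_in_sa_mats by blast
  show "g ` sa_mats k \<subseteq> {..<k} \<times> {..<k} \<rightarrow>\<^sub>E UNIV"
    by (auto simp: g_def PiE_def extensional_def)
qed

text \<open>Lebesgue measure of a set of \<open>m\<close>-tuples of self-adjoint \<open>k \<times> k\<close> matrices, transported
  through the isometric coordinates.\<close>

definition sa_tuple_volume :: "nat \<Rightarrow> nat \<Rightarrow> (nat \<Rightarrow> complex mat) set \<Rightarrow> ennreal" where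
  "sa_tuple_volume m k G =
     (let \<mu> = (\<Pi>\<^sub>M p\<in>{..<m} \<times> {..<k} \<times> {..<k}. (lborel :: real measure))
      in emeasure \<mu> {t \<in> space \<mu>. (\<lambda>l\<in>{..<m}. sa_mat_of_coords k (\<lambda>p. t (l, p))) \<in> G})"

section \<open>Free entropy\<close>

definition microstates ::
    "('h op \<Rightarrow> complex) \<Rightarrow> nat \<Rightarrow> (nat \<Rightarrow> 'h::complex_hilbert_space op) \<Rightarrow>
     real \<Rightarrow> nat \<Rightarrow> nat \<Rightarrow> real \<Rightarrow> (nat \<Rightarrow> complex mat) set" where
  "microstates \<tau> m x R q k \<epsilon> =
     {A \<in> {..<m} \<rightarrow>\<^sub>E sa_mats k.
        (\<forall>j<m. mat_opnorm (A j) \<le> R) \<and>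
        (\<forall>s w. 1 \<le> s \<and> s \<le> q \<and> w \<in> words m s \<longrightarrow>
           cmod (\<tau> (op_word x w) - normalized_mat_trace k (mat_word k A w)) < \<epsilon>)}"

definition ln_ennreal :: "ennreal \<Rightarrow> ereal" where
  "ln_ennreal v = (if v = 0 then -\<infinity> else if v = \<infinity> then \<infinity> else ereal (ln (enn2real v)))"

definition free_entropy ::
    "('h op \<Rightarrow> complex) \<Rightarrow> nat \<Rightarrow> (nat \<Rightarrow> 'h::complex_hilbert_space op) \<Rightarrow> ereal" where
  "free_entropy \<tau> m x =
     (SUP R\<in>{0<..}. INF (q, \<epsilon>)\<in>UNIV \<times> {0<..}.
        limsup (\<lambda>k. ereal (1 / (real k)\<^sup>2) *
                     ln_ennreal (sa_tuple_volume m k (microstates \<tau> m x R q k \<epsilon>))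
                   + ereal (real m / 2 * ln (real k))))"

end

theory Submission
  imports Defs "HOL-Probability.Distributions"
begin

text \<open>Let \<open>A\<close> be a microstate of \<open>x\<close> in \<open>k \<times> k\<close> matrices. By von Neumann's and Kaplansky's density
  theorems each \<open>y\<^sub>j\<close> is close in 2-norm to \<open>Z\<^sub>j(x)\<close> for a noncommutative polynomial \<open>Z\<^sub>j\<close> whose values
  at all microstates are self-adjoint of norm at most some \<open>\<rho> < R\<close>. Put \<open>B\<^sub>j = Z\<^sub>j(A)\<close>. Comparison of
  moments gives \<open>\<parallel>A\<^sub>i - P\<^sub>i(B)\<parallel>\<^sub>2 \<le> \<delta>\<close>, and the \<open>P\<^sub>i\<close> are Lipschitz in 2-norm on tuples of norm at most
  \<open>\<rho>\<close>, with a constant independent of \<open>k\<close> and \<open>\<delta>\<close>. Hence a cover of the possible \<open>B\<close>, a bounded set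
  of real dimension \<open>n k\<^sup>2\<close>, by \<open>(C/\<delta>)\<close> to the power \<open>n k\<^sup>2\<close> cells of diameter \<open>\<delta>\<close> yields a cover of the
  microstates by as many 2-norm balls of radius of order \<open>\<delta>\<close>, each of volume at most
  \<open>C \<delta> / \<surd>k\<close> to the power \<open>m k\<^sup>2\<close>. So \<open>\<chi>(x) \<le> C + (m - n) ln \<delta>\<close> for all small \<open>\<delta>\<close>, which is absurd
  if \<open>m > n\<close>.\<close>

section \<open>Adjoints\<close>

text \<open>The entropy hypothesis concerns microstates of x alone, so a substitute for y_j has to
  be a function of the microstate A, and in fact a polynomial: only finitely many moments are
  compared, and the same expression must make sense in M and on matrices. Von Neumann's theorem
  gives polynomials without norm control, whereas the Lipschitz estimate for P_i needs one bound
  \<rho> < R at all microstates; hence Kaplansky's cut-off is itself carried out by a polynomial.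
  The order of choices matters: \<rho> fixes the Lipschitz constant L; then \<delta> is given and
  determines the truncation N and the Z_j; only then come q and \<epsilon>. Neither L nor the
  counting constants depend on \<delta>, on k or on the norm bound R0 of the microstates, so
  \<delta> can be sent to 0 afterwards. M and the matrices are two instances of the locale
  \<open>tracial_algebra\<close>, so every 2-norm estimate holds on both sides with the same
  constant. Self-adjointness of the B_j is essential for the count: it leaves k^2 real coordinates
  for each of them instead of 2 k^2.\<close>

lemma cinner_add_right: "cinner x (y + z) = cinner x y + cinner x z"
  for x :: "'h::complex_hilbert_space"
  by (metis cinner_add_left cinner_commute complex_cnj_add)

lemma cinner_scaleC_right: "cinner x (c *\<^sub>C y) = cnj c * cinner x y"
  for x :: "'h::complex_hilbert_space"
  by (metis cinner_commute cinner_scaleC_left complex_cnj_mult)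

lemma scaleC_zero_right: "c *\<^sub>C (0::'h::complex_hilbert_space) = 0"
  using linear_0[OF bounded_linear.linear[OF bounded_linear_scaleC]] .

lemma cinner_zero_left: "cinner (0::'h::complex_hilbert_space) x = 0"
  using cinner_add_left[of 0 0 x] by simp

lemma cinner_zero_right: "cinner x (0::'h::complex_hilbert_space) = 0"
  using cinner_add_right[of x 0 0] by simp

lemma scaleC_one: "1 *\<^sub>C (x::'h::complex_hilbert_space) = x"
  using scaleC_of_real[of 1 x] by simp

text \<open>The real Cauchy-Schwarz inequality bounds only the real part. Multiplying x by the phase
  u makes the complex inner product equal to its modulus, hence real.\<close>

lemma cmod_cinner_le: "cmod (cinner x y) \<le> norm x * norm y"
  for x :: "'h::complex_hilbert_space"
proof (cases "cinner x y = 0")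
  case False
  define u where "u = cnj (sgn (cinner x y))"
  have u: "cmod u = 1" using False by (simp add: u_def norm_sgn)
  have "u * cinner x y = cinner x y * cnj (cinner x y) / of_real (cmod (cinner x y))"
    by (simp add: u_def sgn_eq)
  also have "\<dots> = of_real (cmod (cinner x y))"
    using False by (simp add: power2_eq_square flip: complex_norm_square)
  finally have "u * cinner x y = of_real (cmod (cinner x y))" .
  then have "cmod (cinner x y) = Re (cinner (u *\<^sub>C x) y)"
    by (simp add: cinner_scaleC_left)
  also have "\<dots> \<le> norm (u *\<^sub>C x) * norm y"
    unfolding Re_cinner by (rule norm_cauchy_schwarz)
  finally show ?thesis by (simp add: norm_scaleC u)
qed auto

section \<open>Square-summable sequences\<close>

text \<open>With this instance \<open>complex l2\<close> is a Hilbert space; matrices of every size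
  will act on it.\<close>

instantiation complex :: complex_hilbert_space
begin
definition "scaleC_complex (c::complex) (x::complex) = c * x"
definition "cinner_complex (x::complex) (y::complex) = x * cnj y"
instance
  by standard (auto simp: scaleC_complex_def cinner_complex_def algebra_simps complex_eq_iff inner_complex_def)
end

text \<open>The direct sum of countably many copies of a Hilbert space. Square-summable families are
  the data of the ultraweak topology; here such a family becomes a single vector.\<close>

typedef (overloaded) 'a l2 = "{f :: nat \<Rightarrow> 'a::complex_hilbert_space. summable (\<lambda>k. (norm (f k))\<^sup>2)}"
  by (rule exI[of _ "\<lambda>_. 0"]) auto

setup_lifting type_definition_l2

lemma square_summable_add:
  fixes f g :: "nat \<Rightarrow> 'a::real_normed_vector"
  assumes "summable (\<lambda>k. (norm (f k))\<^sup>2)" "summable (\<lambda>k. (norm (g k))\<^sup>2)"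
  shows "summable (\<lambda>k. (norm (f k + g k))\<^sup>2)"
proof (rule summable_comparison_test')
  show "summable (\<lambda>k. 2 * (norm (f k))\<^sup>2 + 2 * (norm (g k))\<^sup>2)"
    using assms by (intro summable_add summable_mult)
  fix k :: nat
  have "(norm (f k + g k))\<^sup>2 \<le> (norm (f k) + norm (g k))\<^sup>2"
    by (intro power_mono norm_triangle_ineq) auto
  also have "\<dots> \<le> 2 * (norm (f k))\<^sup>2 + 2 * (norm (g k))\<^sup>2"
    using sum_squares_bound[of "norm (f k)" "norm (g k)"] by (simp add: power2_sum)
  finally show "norm ((norm (f k + g k))\<^sup>2) \<le> 2 * (norm (f k))\<^sup>2 + 2 * (norm (g k))\<^sup>2"
    by simp
qed

lemma square_summable_bounded:
  fixes f :: "nat \<Rightarrow> 'a::real_normed_vector" and g :: "nat \<Rightarrow> 'b::real_normed_vector"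
  assumes "summable (\<lambda>k. (norm (f k))\<^sup>2)" and "\<And>k. norm (g k) \<le> C * norm (f k)"
  shows "summable (\<lambda>k. (norm (g k))\<^sup>2)"
proof (rule summable_comparison_test')
  show "summable (\<lambda>k. C\<^sup>2 * (norm (f k))\<^sup>2)" using assms(1) by (rule summable_mult)
  fix k
  show "norm ((norm (g k))\<^sup>2) \<le> C\<^sup>2 * (norm (f k))\<^sup>2"
    using power_mono[OF assms(2)[of k], of 2] by (simp add: power_mult_distrib)
qed

lemma summable_cinner:
  fixes f g :: "nat \<Rightarrow> 'a::complex_hilbert_space"
  assumes "summable (\<lambda>k. (norm (f k))\<^sup>2)" "summable (\<lambda>k. (norm (g k))\<^sup>2)"
  shows "summable (\<lambda>k. cinner (f k) (g k))"
proof (rule summable_comparison_test')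
  show "summable (\<lambda>k. (norm (f k))\<^sup>2 + (norm (g k))\<^sup>2)" using assms by (rule summable_add)
  fix k
  have "2 * (norm (f k) * norm (g k)) \<le> (norm (f k))\<^sup>2 + (norm (g k))\<^sup>2"
    using sum_squares_bound[of "norm (f k)" "norm (g k)"] by simp
  moreover have "0 \<le> norm (f k) * norm (g k)" by simp
  ultimately show "norm (cinner (f k) (g k)) \<le> (norm (f k))\<^sup>2 + (norm (g k))\<^sup>2"
    using cmod_cinner_le[of "f k" "g k"] by linarith
qed

instantiation l2 :: (complex_hilbert_space) "{zero, plus, minus, uminus, scaleR}"
begin
lift_definition zero_l2 :: "'a l2" is "\<lambda>_. 0" by simp
lift_definition plus_l2 :: "'a l2 \<Rightarrow> 'a l2 \<Rightarrow> 'a l2" is "\<lambda>f g k. f k + g k"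
  by (rule square_summable_add)
lift_definition minus_l2 :: "'a l2 \<Rightarrow> 'a l2 \<Rightarrow> 'a l2" is "\<lambda>f g k. f k - g k"
proof -
  fix f g :: "nat \<Rightarrow> 'a"
  assume "summable (\<lambda>k. (norm (f k))\<^sup>2)" "summable (\<lambda>k. (norm (g k))\<^sup>2)"
  then show "summable (\<lambda>k. (norm (f k - g k))\<^sup>2)"
    using square_summable_add[of f "\<lambda>k. - g k"] by simp
qed
lift_definition uminus_l2 :: "'a l2 \<Rightarrow> 'a l2" is "\<lambda>f k. - f k" by simp
lift_definition scaleR_l2 :: "real \<Rightarrow> 'a l2 \<Rightarrow> 'a l2" is "\<lambda>c f k. c *\<^sub>R f k"
  by (simp add: power_mult_distrib summable_mult)
instance ..
end

instance l2 :: (complex_hilbert_space) real_vector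
  by standard (transfer; auto simp: algebra_simps)+

instantiation l2 :: (complex_hilbert_space) real_inner
begin
lift_definition inner_l2 :: "'a l2 \<Rightarrow> 'a l2 \<Rightarrow> real" is "\<lambda>f g. \<Sum>k. inner (f k) (g k)" .
definition "norm_l2 (f :: 'a l2) = sqrt (inner f f)"
definition "dist_l2 (f :: 'a l2) g = norm (f - g)"
definition "sgn_l2 (f :: 'a l2) = f /\<^sub>R norm f"
definition "uniformity_l2 = (INF e\<in>{0<..}. principal {(x, y :: 'a l2). dist x y < e})"
definition "open_l2 U = (\<forall>x\<in>U. \<forall>\<^sub>F (x', y) in uniformity. x' = x \<longrightarrow> (y :: 'a l2) \<in> U)"

instance
proof
  fix x y z :: "'a l2" and r :: real and U :: "'a l2 set"
  have summ: "summable (\<lambda>k. inner (f k) (g k))"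
    if "summable (\<lambda>k. (norm (f k))\<^sup>2)" "summable (\<lambda>k. (norm (g k))\<^sup>2)" for f g :: "nat \<Rightarrow> 'a"
    using summable_Re[OF summable_cinner[OF that]] by (simp add: Re_cinner)
  show "inner x y = inner y x" by transfer (simp add: inner_commute)
  show "inner (x + y) z = inner x z + inner y z"
    by transfer (simp add: inner_add_left suminf_add summ)
  show "inner (r *\<^sub>R x) y = r * inner x y"
    by transfer (simp add: suminf_mult summ)
  show "0 \<le> inner x x" by transfer (simp add: suminf_nonneg summ)
  show "inner x x = 0 \<longleftrightarrow> x = 0"
    by transfer (auto simp: suminf_eq_zero_iff summ)
qed (simp_all only: norm_l2_def dist_l2_def sgn_l2_def uniformity_l2_def open_l2_def)
end

lift_definition l2_nth :: "'a::complex_hilbert_space l2 \<Rightarrow> nat \<Rightarrow> 'a" is "\<lambda>f. f" .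

lemma l2_eqI: "(\<And>k. l2_nth f k = l2_nth g k) \<Longrightarrow> f = g"
  by transfer auto

lemma l2_nth_simps [simp]:
  "l2_nth 0 k = 0"
  "l2_nth (f + g) k = l2_nth f k + l2_nth g k"
  "l2_nth (f - g) k = l2_nth f k - l2_nth g k"
  "l2_nth (- f) k = - l2_nth f k"
  "l2_nth (r *\<^sub>R f) k = r *\<^sub>R l2_nth f k"
  by (transfer; simp)+

lemma l2_norm_sums: "(\<lambda>k. (norm (l2_nth f k))\<^sup>2) sums (norm f)\<^sup>2"
  unfolding norm_l2_def power2_eq_square[of "sqrt _"]
  by (simp, transfer) (simp add: power2_norm_eq_inner sums_iff)

lemma l2_norm_le_sum:
  assumes "0 \<le> C" "\<And>N. (\<Sum>k<N. (norm (l2_nth f k))\<^sup>2) \<le> C\<^sup>2"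
  shows "norm f \<le> C"
proof -
  have "(norm f)\<^sup>2 \<le> C\<^sup>2"
    using l2_norm_sums[of f] assms(2) unfolding sums_def by (intro LIMSEQ_le_const2) auto
  then show ?thesis using assms(1) by (rule power2_le_imp_le)
qed

lemma l2_sum_le_norm: "finite K \<Longrightarrow> (\<Sum>k\<in>K. (norm (l2_nth f k))\<^sup>2) \<le> (norm f)\<^sup>2"
  using sum_le_suminf[OF sums_summable[OF l2_norm_sums], of K f]
  by (simp add: sums_unique[OF l2_norm_sums, symmetric])

lemma l2_nth_le_norm: "norm (l2_nth f k) \<le> norm f"
  using l2_sum_le_norm[of "{k}" f] by (simp add: power2_le_iff_abs_le)

lemma bounded_linear_l2_nth: "bounded_linear (\<lambda>f. l2_nth f k)"
  by (rule bounded_linear_intro[of _ 1]) (auto simp: l2_nth_le_norm)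

instance l2 :: (complex_hilbert_space) banach
proof
  fix X :: "nat \<Rightarrow> 'a l2"
  assume X: "Cauchy X"
  have "Cauchy (\<lambda>n. l2_nth (X n) k)" for k
    using bounded_linear.Cauchy[OF bounded_linear_l2_nth X] .
  then obtain F where F: "\<And>k. (\<lambda>n. l2_nth (X n) k) \<longlonglongrightarrow> F k"
    unfolding Cauchy_convergent_iff convergent_def by metis
  \<comment> \<open>Stated for finite partial sums, uniformly in N: there the limit in n' can be
    taken coordinate by coordinate.\<close>
  have tail: "\<exists>M. \<forall>n\<ge>M. \<forall>N. (\<Sum>k<N. (norm (l2_nth (X n) k - F k))\<^sup>2) \<le> e\<^sup>2" if "e > 0" for e
  proof -
    obtain M where M: "\<And>n n'. n \<ge> M \<Longrightarrow> n' \<ge> M \<Longrightarrow> norm (X n - X n') < e"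
      using X \<open>e > 0\<close> unfolding Cauchy_iff by blast
    have "(\<Sum>k<N. (norm (l2_nth (X n) k - F k))\<^sup>2) \<le> e\<^sup>2" if "n \<ge> M" for n N
    proof (rule LIMSEQ_le_const2)
      show "(\<lambda>n'. \<Sum>k<N. (norm (l2_nth (X n) k - l2_nth (X n') k))\<^sup>2)
          \<longlonglongrightarrow> (\<Sum>k<N. (norm (l2_nth (X n) k - F k))\<^sup>2)"
        by (intro tendsto_intros F)
      have "(\<Sum>k<N. (norm (l2_nth (X n) k - l2_nth (X n') k))\<^sup>2) \<le> e\<^sup>2" if "n' \<ge> M" for n'
      proof -
        have "(\<Sum>k<N. (norm (l2_nth (X n) k - l2_nth (X n') k))\<^sup>2) \<le> (norm (X n - X n'))\<^sup>2"
          using l2_sum_le_norm[of "{..<N}" "X n - X n'"] by simp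
        also have "\<dots> \<le> e\<^sup>2"
          using M[OF \<open>n \<ge> M\<close> that] by (intro power_mono) auto
        finally show ?thesis .
      qed
      then show "\<exists>M. \<forall>n'\<ge>M. (\<Sum>k<N. (norm (l2_nth (X n) k - l2_nth (X n') k))\<^sup>2) \<le> e\<^sup>2" by blast
    qed
    then show ?thesis by blast
  qed
  obtain M where M: "\<And>N. (\<Sum>k<N. (norm (l2_nth (X M) k - F k))\<^sup>2) \<le> 1\<^sup>2"
    using tail[of 1] by auto
  have "summable (\<lambda>k. (norm (l2_nth (X M) k - F k))\<^sup>2)"
  proof (rule bounded_imp_summable)
    show "(\<Sum>k\<le>N. (norm (l2_nth (X M) k - F k))\<^sup>2) \<le> 1" for N
      using M[of "Suc N"] by (simp add: lessThan_Suc_atMost)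
  qed simp
  then have "summable (\<lambda>k. (norm (F k - l2_nth (X M) k))\<^sup>2)"
    by (subst norm_minus_commute)
  from square_summable_add[OF this sums_summable[OF l2_norm_sums[of "X M"]]]
  have sF: "summable (\<lambda>k. (norm (F k))\<^sup>2)" by simp
  define L where "L = Abs_l2 F"
  have L: "l2_nth L k = F k" for k
    unfolding L_def l2_nth.rep_eq using sF by (simp add: Abs_l2_inverse)
  have "X \<longlonglongrightarrow> L"
    unfolding LIMSEQ_iff
  proof (intro allI impI)
    fix r :: real assume "r > 0"
    then obtain M where M: "\<And>n N. n \<ge> M \<Longrightarrow> (\<Sum>k<N. (norm (l2_nth (X n) k - F k))\<^sup>2) \<le> (r/2)\<^sup>2"
      using tail[OF half_gt_zero[OF \<open>r > 0\<close>]] by metis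
    have "norm (X n - L) \<le> r/2" if "n \<ge> M" for n
      by (rule l2_norm_le_sum) (use \<open>r > 0\<close> M[OF that] in \<open>simp_all add: L\<close>)
    moreover have "r/2 < r" using \<open>r > 0\<close> by simp
    ultimately show "\<exists>no. \<forall>n\<ge>no. norm (X n - L) < r"
      using le_less_trans by metis
  qed
  then show "convergent X" unfolding convergent_def by blast
qed

instantiation l2 :: (complex_hilbert_space) complex_hilbert_space
begin
lift_definition scaleC_l2 :: "complex \<Rightarrow> 'a l2 \<Rightarrow> 'a l2" is "\<lambda>c f k. c *\<^sub>C f k"
  by (simp add: norm_scaleC power_mult_distrib summable_mult)
lift_definition cinner_l2 :: "'a l2 \<Rightarrow> 'a l2 \<Rightarrow> complex" is "\<lambda>f g. \<Sum>k. cinner (f k) (g k)" .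
instance
proof
  fix c d :: complex and r :: real and x y z :: "'a l2"
  have nth: "l2_nth (c *\<^sub>C f) k = c *\<^sub>C l2_nth f k" for c k and f :: "'a l2"
    by (simp add: l2_nth.rep_eq scaleC_l2.rep_eq)
  show "c *\<^sub>C (x + y) = c *\<^sub>C x + c *\<^sub>C y" by (rule l2_eqI) (simp add: nth scaleC_add_right)
  show "(c + d) *\<^sub>C x = c *\<^sub>C x + d *\<^sub>C x" by (rule l2_eqI) (simp add: nth scaleC_add_left)
  show "c *\<^sub>C d *\<^sub>C x = (c * d) *\<^sub>C x" by (rule l2_eqI) (simp add: nth scaleC_scaleC)
  show "complex_of_real r *\<^sub>C x = r *\<^sub>R x" by (rule l2_eqI) (simp add: nth scaleC_of_real)
  show "cinner x y = cnj (cinner y x)"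
  proof (transfer, goal_cases)
    case (1 f g)
    have "(\<lambda>k. cnj (cinner (g k) (f k))) sums cnj (\<Sum>k. cinner (g k) (f k))"
      unfolding sums_cnj by (rule summable_sums[OF summable_cinner[OF 1(2,1)]])
    then have "(\<lambda>k. cinner (f k) (g k)) sums cnj (\<Sum>k. cinner (g k) (f k))"
      by (simp flip: cinner_commute)
    then show ?case by (rule sums_unique[symmetric])
  qed
  show "cinner (x + y) z = cinner x z + cinner y z"
    by transfer (simp only: cinner_add_left suminf_add summable_cinner)
  show "cinner (c *\<^sub>C x) y = c * cinner x y"
    by transfer (simp only: cinner_scaleC_left suminf_mult summable_cinner)
  show "Re (cinner x y) = inner x y"
    by transfer (simp only: Re_suminf summable_cinner Re_cinner)
qed
end

lemma l2_nth_scaleC [simp]: "l2_nth (c *\<^sub>C f) k = c *\<^sub>C l2_nth f k"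
  by transfer simp

lemma cinner_l2_eq: "cinner f g = (\<Sum>k. cinner (l2_nth f k) (l2_nth g k))"
  by transfer simp

section \<open>Orthogonal projection\<close>

text \<open>A sequence in W minimising the distance to v is Cauchy by the parallelogram identity,
  since midpoints stay in W; minimality of its limit p forces orthogonality.\<close>

lemma exists_orthogonal_decomposition:
  fixes W :: "'v::{real_inner,complete_space} set"
  assumes "closed W" "subspace W"
  shows "\<exists>p\<in>W. \<forall>w\<in>W. inner (v - p) w = 0"
proof -
  have ne: "W \<noteq> {}" using assms(2) subspace_0 by blast
  define d where "d = infdist v W"
  have d: "d \<le> norm (v - w)" if "w \<in> W" for w
    using infdist_le[OF that, of v] by (simp add: d_def dist_norm)
  have d0: "d \<ge> 0" by (simp add: d_def infdist_nonneg)
  have "\<exists>w\<in>W. norm (v - w) < d + 1 / Suc n" for n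
  proof -
    have "infdist v W < d + 1 / Suc n" by (simp add: d_def)
    then have "(INF a\<in>W. dist v a) < d + 1 / Suc n" using ne by (simp add: infdist_def)
    moreover have "bdd_below (dist v ` W)" by (rule bdd_belowI[of _ 0]) auto
    ultimately show ?thesis
      using cINF_less_iff[of W "dist v"] ne by (simp add: dist_norm)
  qed
  then obtain w where w: "\<And>n. w n \<in> W" "\<And>n. norm (v - w n) < d + 1 / Suc n" by metis
  have lim: "(\<lambda>n. norm (v - w n)) \<longlonglongrightarrow> d"
  proof (rule tendsto_sandwich[of "\<lambda>_. d" _ _ "\<lambda>n. d + 1 / Suc n"])
    show "(\<lambda>n. d + 1 / Suc n) \<longlonglongrightarrow> d"
      using tendsto_add[OF tendsto_const[of d] LIMSEQ_inverse_real_of_nat] by (simp add: field_simps)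
  qed (use d[OF w(1)] w(2) in \<open>auto simp: less_imp_le\<close>)
  have par: "(norm (w i - w j))\<^sup>2 \<le> 2 * ((norm (v - w i))\<^sup>2 - d\<^sup>2) + 2 * ((norm (v - w j))\<^sup>2 - d\<^sup>2)" for i j
  proof -
    have "(1/2) *\<^sub>R (w i + w j) \<in> W" using w(1) assms(2) by (simp add: subspace_add subspace_scale)
    from d[OF this] d0 have "d\<^sup>2 \<le> (norm (v - (1/2) *\<^sub>R (w i + w j)))\<^sup>2" by (simp add: power_mono)
    also have "4 * (norm (v - (1/2) *\<^sub>R (w i + w j)))\<^sup>2 =
        2 * (norm (v - w i))\<^sup>2 + 2 * (norm (v - w j))\<^sup>2 - (norm (w i - w j))\<^sup>2"
      by (simp add: power2_norm_eq_inner inner_diff_left inner_diff_right inner_add_left inner_add_right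
          inner_commute[of "w i" v] inner_commute[of "w j" v] inner_commute[of "w j" "w i"] field_simps)
    finally show ?thesis by simp
  qed
  have "Cauchy w"
    unfolding Cauchy_iff
  proof (intro allI impI)
    fix e :: real assume "e > 0"
    have "(\<lambda>n. (norm (v - w n))\<^sup>2 - d\<^sup>2) \<longlonglongrightarrow> d\<^sup>2 - d\<^sup>2" by (intro tendsto_intros lim)
    then have "\<forall>\<^sub>F n in sequentially. (norm (v - w n))\<^sup>2 - d\<^sup>2 < e\<^sup>2 / 4"
      using \<open>e > 0\<close> by (intro order_tendstoD(2)[of _ "d\<^sup>2 - d\<^sup>2"]) auto
    then obtain M where M: "\<And>n. n \<ge> M \<Longrightarrow> (norm (v - w n))\<^sup>2 - d\<^sup>2 < e\<^sup>2 / 4"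
      by (auto simp: eventually_sequentially)
    have "norm (w i - w j) < e" if "i \<ge> M" "j \<ge> M" for i j
    proof -
      have "(norm (w i - w j))\<^sup>2 < e\<^sup>2" using par[of i j] M[OF that(1)] M[OF that(2)] by argo
      then show ?thesis using \<open>e > 0\<close> by (simp add: power2_less_imp_less)
    qed
    then show "\<exists>M. \<forall>m\<ge>M. \<forall>n\<ge>M. norm (w m - w n) < e" by blast
  qed
  then obtain p where p: "w \<longlonglongrightarrow> p" unfolding Cauchy_convergent_iff convergent_def by blast
  have pW: "p \<in> W" using closed_sequentially[OF assms(1) _ p] w(1) by blast
  have "(\<lambda>n. norm (v - w n)) \<longlonglongrightarrow> norm (v - p)" by (intro tendsto_intros p)
  then have pd: "norm (v - p) = d" using lim LIMSEQ_unique by blast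
  have "inner (v - p) u = 0" if u: "u \<in> W" for u
  proof (cases "u = 0")
    case False
    \<comment> \<open>The minimiser of the quadratic polynomial norm (v - p - t u)^2 in t.\<close>
    define t where "t = inner (v - p) u / (norm u)\<^sup>2"
    have "p + t *\<^sub>R u \<in> W" using pW u assms(2) by (simp add: subspace_add subspace_scale)
    from d[OF this] d0 have "d\<^sup>2 \<le> (norm (v - (p + t *\<^sub>R u)))\<^sup>2" by (simp add: power_mono)
    also have "\<dots> = (norm (v - p))\<^sup>2 - 2 * t * inner (v - p) u + t\<^sup>2 * (norm u)\<^sup>2"
      by (simp add: power2_norm_eq_inner inner_diff_left inner_diff_right inner_add_left inner_add_right
          inner_commute[of p v] inner_commute[of u v] inner_commute[of u p] power2_eq_square[of t] algebra_simps)
    also have "\<dots> = d\<^sup>2 - (inner (v - p) u)\<^sup>2 / (norm u)\<^sup>2"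
      using False by (simp add: pd t_def power2_eq_square field_simps)
    finally have "(inner (v - p) u)\<^sup>2 / (norm u)\<^sup>2 \<le> 0" by simp
    then show ?thesis using False by (simp add: divide_le_0_iff)
  qed auto
  then show ?thesis using pW by blast
qed

lemma orthogonal_projection_exists:
  fixes W :: "'v::{real_inner,complete_space} set"
  assumes "closed W" "subspace W"
  shows "\<exists>p :: 'v \<Rightarrow>\<^sub>L 'v. (\<forall>v. p v \<in> W) \<and> (\<forall>v. \<forall>w\<in>W. inner (v - p v) w = 0)"
proof -
  obtain p where p: "\<And>v. p v \<in> W" "\<And>v w. w \<in> W \<Longrightarrow> inner (v - p v) w = 0"
    using exists_orthogonal_decomposition[OF assms] by metis
  \<comment> \<open>Additivity and homogeneity of p follow from uniqueness of the orthogonal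
    decomposition, by exhibiting the expected value as a candidate.\<close>
  have uniq: "p v = q" if "q \<in> W" "\<And>w. w \<in> W \<Longrightarrow> inner (v - q) w = 0" for v q
  proof -
    have W: "p v - q \<in> W" using p(1) that(1) assms(2) by (simp add: subspace_diff)
    have "inner (p v - q) (p v - q) = inner (v - q) (p v - q) - inner (v - p v) (p v - q)"
      by (simp add: inner_diff_left algebra_simps)
    also have "\<dots> = 0" using that(2)[OF W] p(2)[OF W] by simp
    finally show ?thesis by simp
  qed
  have "bounded_linear p"
  proof (rule bounded_linear_intro[where K = 1])
    fix x y and r
    show "p (x + y) = p x + p y"
    proof (rule uniq)
      show "p x + p y \<in> W" using p(1) assms(2) by (simp add: subspace_add)
      show "inner (x + y - (p x + p y)) w = 0" if "w \<in> W" for w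
        using p(2)[OF that, of x] p(2)[OF that, of y] by (simp add: inner_diff_left inner_add_left)
    qed
    show "p (r *\<^sub>R x) = r *\<^sub>R p x"
    proof (rule uniq)
      show "r *\<^sub>R p x \<in> W" using p(1) assms(2) by (simp add: subspace_scale)
      show "inner (r *\<^sub>R x - r *\<^sub>R p x) w = 0" if "w \<in> W" for w
        using p(2)[OF that, of x] by (simp add: inner_diff_left)
    qed
    have "(norm x)\<^sup>2 = (norm (p x))\<^sup>2 + (norm (x - p x))\<^sup>2"
      using p(2)[OF p(1), of x x]
      by (simp add: power2_norm_eq_inner inner_diff_left inner_diff_right inner_commute[of "p x" x])
    then have "(norm (p x))\<^sup>2 \<le> (norm x)\<^sup>2" by simp
    then show "norm (p x) \<le> norm x * 1" using power2_le_imp_le by fastforce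
  qed
  then show ?thesis
    using p by (intro exI[of _ "Blinfun p"]) (auto simp: bounded_linear_Blinfun_apply)
qed

section \<open>Noncommutative polynomials in operators\<close>

lemma op_scaleC_apply [simp]: "blinfun_apply (c *\<^sub>O T) v = c *\<^sub>C blinfun_apply T v"
  by transfer simp

lemma scaleC_diff_right: "c *\<^sub>C (x - y) = c *\<^sub>C x - c *\<^sub>C y" for x :: "'h::complex_hilbert_space"
  using linear_diff[OF bounded_linear.linear[OF bounded_linear_scaleC]] .

lemma scaleC_zero_left: "0 *\<^sub>C x = 0" for x :: "'h::complex_hilbert_space"
  using scaleC_of_real[of 0 x] by simp

lemma bounded_opsD: "T \<in> bounded_ops \<Longrightarrow> blinfun_apply T (c *\<^sub>C v) = c *\<^sub>C blinfun_apply T v"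
  by (simp add: bounded_ops_def)

lemma is_adjointD: "is_adjoint T S \<Longrightarrow> cinner (blinfun_apply T u) v = cinner u (blinfun_apply S v)"
  by (simp add: is_adjoint_def)

lemma is_adjoint_sym: "is_adjoint T S \<Longrightarrow> is_adjoint S T"
  unfolding is_adjoint_def by (subst (1 2) cinner_commute) simp

lemma cinner_diff_left: "cinner (x - y) z = cinner x z - cinner y z" for x :: "'h::complex_hilbert_space"
  using cinner_add_left[of "x - y" y z] by simp

lemma cinner_diff_right: "cinner z (x - y) = cinner z x - cinner z y" for x :: "'h::complex_hilbert_space"
  using cinner_add_right[of z "x - y" y] by simp

lemma cinner_ext:
  fixes u v :: "'h::complex_hilbert_space"
  assumes "\<And>w. cinner u w = cinner v w"
  shows "u = v"
proof -
  have "cinner (u - v) (u - v) = 0" by (simp only: cinner_diff_left assms) simp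
  then show ?thesis by (simp add: cinner_self)
qed

text \<open>The type \<open>'h op\<close> contains all bounded real-linear maps. An adjoint for the
  complex inner product forces complex linearity, because the scalar can be pulled out of the first
  argument on either side.\<close>

lemma adjointable_in_bounded_ops:
  assumes "is_adjoint T S"
  shows "T \<in> bounded_ops"
proof -
  have "blinfun_apply T (c *\<^sub>C x) = c *\<^sub>C blinfun_apply T x" for c x
    by (rule cinner_ext) (simp only: is_adjointD[OF assms] cinner_scaleC_left)
  then show ?thesis by (simp add: bounded_ops_def)
qed

lemma is_adjoint_unique:
  assumes "is_adjoint T S" "is_adjoint T S'"
  shows "S = S'"
proof (rule blinfun_eqI, rule cinner_ext)
  fix x w
  show "cinner (blinfun_apply S x) w = cinner (blinfun_apply S' x) w"
    by (simp only: is_adjointD[OF is_adjoint_sym[OF assms(1)]] is_adjointD[OF is_adjoint_sym[OF assms(2)]])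
qed

lemma norm_adjoint_le:
  assumes "is_adjoint T S" shows "norm S \<le> norm T"
proof (rule norm_blinfun_bound)
  fix v
  have "(norm (blinfun_apply S v))\<^sup>2 = Re (cinner (blinfun_apply T (blinfun_apply S v)) v)"
    by (simp add: is_adjointD[OF assms] cinner_self)
  also have "\<dots> \<le> norm (blinfun_apply T (blinfun_apply S v)) * norm v"
    by (rule order_trans[OF complex_Re_le_cmod cmod_cinner_le])
  also have "\<dots> \<le> norm T * norm (blinfun_apply S v) * norm v"
    by (intro mult_right_mono norm_blinfun) auto
  finally have "norm (blinfun_apply S v) * norm (blinfun_apply S v) \<le> (norm T * norm v) * norm (blinfun_apply S v)"
    by (simp add: power2_eq_square algebra_simps)
  then show "norm (blinfun_apply S v) \<le> norm T * norm v"
    using mult_right_le_imp_le[of "norm (blinfun_apply S v)" "norm (blinfun_apply S v)" "norm T * norm v"]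
    by (cases "blinfun_apply S v = 0") auto
qed simp

lemma is_adjoint_add: "is_adjoint T S \<Longrightarrow> is_adjoint T' S' \<Longrightarrow> is_adjoint (T + T') (S + S')"
  by (simp add: is_adjoint_def blinfun.add_left cinner_add_left cinner_add_right)

lemma is_adjoint_diff: "is_adjoint T S \<Longrightarrow> is_adjoint T' S' \<Longrightarrow> is_adjoint (T - T') (S - S')"
  by (simp add: is_adjoint_def blinfun.diff_left cinner_diff_left cinner_diff_right)

lemma is_adjoint_scaleC: "is_adjoint T S \<Longrightarrow> is_adjoint (c *\<^sub>O T) (cnj c *\<^sub>O S)"
  by (simp add: is_adjoint_def cinner_scaleC_left cinner_scaleC_right)

lemma is_adjoint_compose: "is_adjoint T S \<Longrightarrow> is_adjoint T' S' \<Longrightarrow> is_adjoint (T o\<^sub>L T') (S' o\<^sub>L S)"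
  by (simp add: is_adjoint_def)

lemma is_adjoint_id: "is_adjoint id_blinfun id_blinfun"
  by (simp add: is_adjoint_def)

lemma is_adjoint_0: "is_adjoint 0 0"
  by (simp add: is_adjoint_def cinner_zero_left cinner_zero_right)

lemma op_scaleR: "r *\<^sub>R T = complex_of_real r *\<^sub>O T"
  by (rule blinfun_eqI) (simp add: scaleC_of_real blinfun.scaleR_left)

lemma norm_op_scaleC: "norm (c *\<^sub>O T) = cmod c * norm T"
proof -
  have le: "norm (c *\<^sub>O T) \<le> cmod c * norm T" for c and T :: "'a op"
  proof (rule norm_blinfun_bound)
    fix x
    have "cmod c * norm (blinfun_apply T x) \<le> cmod c * (norm T * norm x)"
      by (intro mult_left_mono norm_blinfun) auto
    then show "norm (blinfun_apply (c *\<^sub>O T) x) \<le> cmod c * norm T * norm x"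
      by (simp add: norm_scaleC mult.assoc)
  qed auto
  show ?thesis
  proof (cases "c = 0")
    case True
    then show ?thesis using le[of c T] by simp
  next
    case False
    have "inverse c *\<^sub>O (c *\<^sub>O T) = T"
      by (rule blinfun_eqI) (use False in \<open>simp add: scaleC_scaleC scaleC_one\<close>)
    then have "norm T \<le> inverse (cmod c) * norm (c *\<^sub>O T)"
      using le[of "inverse c" "c *\<^sub>O T"] by (simp add: norm_inverse)
    then have "cmod c * norm T \<le> norm (c *\<^sub>O T)"
      using False by (simp add: field_simps)
    then show ?thesis using le[of c T] by linarith
  qed
qed

lemma blinfun_compose_scaleC_left: "(c *\<^sub>O T) o\<^sub>L S = c *\<^sub>O (T o\<^sub>L S)"
  by (rule blinfun_eqI) simp

lemma blinfun_compose_scaleC_right: "T \<in> bounded_ops \<Longrightarrow> T o\<^sub>L (c *\<^sub>O S) = c *\<^sub>O (T o\<^sub>L S)"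
  by (rule blinfun_eqI) (simp add: bounded_opsD)

lemma op_scaleC_add: "c *\<^sub>O (T + S) = c *\<^sub>O T + c *\<^sub>O S"
  by (rule blinfun_eqI) (simp add: blinfun.add_left scaleC_add_right)

lemma op_scaleC_scaleC: "c *\<^sub>O d *\<^sub>O T = (c * d) *\<^sub>O T"
  by (rule blinfun_eqI) (simp add: scaleC_scaleC)

lemma op_scaleC_zero: "c *\<^sub>O 0 = 0"
  by (rule blinfun_eqI) (simp add: scaleC_zero_right)

lemma op_scaleC_one: "1 *\<^sub>O T = T"
  by (rule blinfun_eqI) (simp add: scaleC_one)

lemma op_scaleC_minus_one: "(-1) *\<^sub>O T = - T"
  using op_scaleR[of "-1" T] by simp

lemmas compose_simps =
  bounded_bilinear.add_left[OF bounded_bilinear_blinfun_compose]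
  bounded_bilinear.add_right[OF bounded_bilinear_blinfun_compose]
  bounded_bilinear.diff_left[OF bounded_bilinear_blinfun_compose]
  bounded_bilinear.diff_right[OF bounded_bilinear_blinfun_compose]
  bounded_bilinear.minus_left[OF bounded_bilinear_blinfun_compose]
  bounded_bilinear.minus_right[OF bounded_bilinear_blinfun_compose]
  bounded_bilinear.scaleR_left[OF bounded_bilinear_blinfun_compose]
  bounded_bilinear.scaleR_right[OF bounded_bilinear_blinfun_compose]
  bounded_bilinear.zero_left[OF bounded_bilinear_blinfun_compose]
  bounded_bilinear.zero_right[OF bounded_bilinear_blinfun_compose]

lemma compose_id [simp]: "T o\<^sub>L id_blinfun = T" "id_blinfun o\<^sub>L T = T"
  by (rule blinfun_eqI, simp)+

lemma op_word_simps [simp]: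
  "op_word x [] = id_blinfun"
  "op_word x (i # w) = x i o\<^sub>L op_word x w"
  by (simp_all add: op_word_def)

lemma blinfun_compose_assoc: "(T o\<^sub>L S) o\<^sub>L U = T o\<^sub>L (S o\<^sub>L U)"
  by (rule blinfun_eqI) simp

lemma op_word_append: "op_word x (u @ v) = op_word x u o\<^sub>L op_word x v"
  by (induction u) (simp_all add: blinfun_compose_assoc)

text \<open>Polynomials are kept as syntax because the same one is evaluated in M and at matrices on
  another space. Repeated words are allowed: only evaluations and coefficient sums are ever
  used.\<close>

type_synonym ncpoly = "(complex \<times> nat list) list"

definition nc_eval :: "ncpoly \<Rightarrow> (nat \<Rightarrow> 'h op) \<Rightarrow> 'h::complex_hilbert_space op" where
  "nc_eval p x = (\<Sum>(c, w)\<leftarrow>p. c *\<^sub>O op_word x w)"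

definition nc_vars :: "nat \<Rightarrow> ncpoly \<Rightarrow> bool" where
  "nc_vars m p \<longleftrightarrow> (\<forall>(c, w)\<in>set p. set w \<subseteq> {..<m})"

definition nc_scale :: "complex \<Rightarrow> ncpoly \<Rightarrow> ncpoly" where
  "nc_scale c p = map (\<lambda>(d, w). (c * d, w)) p"

definition nc_mult :: "ncpoly \<Rightarrow> ncpoly \<Rightarrow> ncpoly" where
  "nc_mult p q = concat (map (\<lambda>(c, u). map (\<lambda>(d, v). (c * d, u @ v)) q) p)"

definition nc_star :: "ncpoly \<Rightarrow> ncpoly" where
  "nc_star p = map (\<lambda>(c, w). (cnj c, rev w)) p"

lemma nc_eval_simps [simp]:
  "nc_eval [] x = 0"
  "nc_eval ((c, w) # p) x = c *\<^sub>O op_word x w + nc_eval p x"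
  "nc_eval (p @ q) x = nc_eval p x + nc_eval q x"
  by (simp_all add: nc_eval_def)

lemma nc_vars_simps [simp]:
  "nc_vars m []"
  "nc_vars m ((c, w) # p) \<longleftrightarrow> set w \<subseteq> {..<m} \<and> nc_vars m p"
  "nc_vars m (p @ q) \<longleftrightarrow> nc_vars m p \<and> nc_vars m q"
  by (auto simp: nc_vars_def)

lemma nc_vars_scale [simp]: "nc_vars m (nc_scale c p) = nc_vars m p"
  by (auto simp: nc_vars_def nc_scale_def)

lemma nc_vars_mult: "nc_vars m p \<Longrightarrow> nc_vars m q \<Longrightarrow> nc_vars m (nc_mult p q)"
  by (fastforce simp: nc_vars_def nc_mult_def)

lemma nc_vars_star [simp]: "nc_vars m (nc_star p) = nc_vars m p"
  by (induction p) (auto simp: nc_vars_def nc_star_def)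

lemma nc_eval_scale: "nc_eval (nc_scale c p) x = c *\<^sub>O nc_eval p x"
  by (induction p) (auto simp: nc_scale_def op_scaleC_add op_scaleC_scaleC op_scaleC_zero)

lemma op_word_bounded_ops:
  "(\<And>i. i < m \<Longrightarrow> x i \<in> bounded_ops) \<Longrightarrow> set w \<subseteq> {..<m} \<Longrightarrow> op_word x w \<in> bounded_ops"
  by (induction w) (auto simp: bounded_ops_def)

lemma nc_eval_mult:
  assumes "\<And>i. i < m \<Longrightarrow> x i \<in> bounded_ops" "nc_vars m p"
  shows "nc_eval (nc_mult p q) x = nc_eval p x o\<^sub>L nc_eval q x"
  using assms(2)
proof (induction p)
  case Nil
  then show ?case by (simp add: nc_mult_def compose_simps)
next
  case (Cons a p)
  obtain c u where a: "a = (c, u)" by (cases a)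
  have u: "op_word x u \<in> bounded_ops"
    using Cons.prems a by (intro op_word_bounded_ops[of m] assms(1)) auto
  have "nc_eval (map (\<lambda>(d, v). (c * d, u @ v)) q) x = (c *\<^sub>O op_word x u) o\<^sub>L nc_eval q x"
    by (induction q)
       (auto simp: compose_simps op_word_append op_scaleC_scaleC blinfun_compose_scaleC_left
         blinfun_compose_scaleC_right[OF u] op_scaleC_add)
  moreover have "nc_mult (a # p) q = map (\<lambda>(d, v). (c * d, u @ v)) q @ nc_mult p q"
    by (simp add: nc_mult_def a)
  ultimately show ?case using Cons a by (simp add: compose_simps)
qed

lemma is_adjoint_op_word:
  "(\<And>i. i < m \<Longrightarrow> self_adjoint (x i)) \<Longrightarrow> set w \<subseteq> {..<m} \<Longrightarrow> is_adjoint (op_word x w) (op_word x (rev w))"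
proof (induction w)
  case (Cons i w)
  then have "is_adjoint (x i) (x i)" by (simp add: self_adjoint_def)
  with Cons show ?case by (simp add: op_word_append is_adjoint_compose)
qed (simp add: is_adjoint_id)

lemma is_adjoint_nc_eval:
  assumes "\<And>i. i < m \<Longrightarrow> self_adjoint (x i)" "nc_vars m p"
  shows "is_adjoint (nc_eval p x) (nc_eval (nc_star p) x)"
  using assms(2)
proof (induction p)
  case Nil
  show ?case by (simp add: is_adjoint_0 nc_star_def)
next
  case (Cons a p)
  obtain c u where a: "a = (c, u)" by (cases a)
  have "is_adjoint (op_word x u) (op_word x (rev u))"
    using Cons.prems a by (intro is_adjoint_op_word[of m] assms(1)) auto
  with Cons a show ?case
    by (auto simp: nc_star_def intro!: is_adjoint_add is_adjoint_scaleC)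
qed

lemma self_adjoint_bounded_ops: "self_adjoint T \<Longrightarrow> T \<in> bounded_ops"
  by (auto simp: self_adjoint_def adjointable_in_bounded_ops)

lemma subspace_closure:
  fixes S :: "'v::real_normed_vector set"
  assumes "subspace S" shows "subspace (closure S)"
proof (rule subspaceI)
  show "0 \<in> closure S" using subspace_0[OF assms] closure_subset by blast
  fix x y assume "x \<in> closure S" "y \<in> closure S"
  then obtain f g where "\<And>n. f n \<in> S" "f \<longlonglongrightarrow> x" "\<And>n. g n \<in> S" "g \<longlonglongrightarrow> y"
    unfolding closure_sequential by blast
  then have "\<And>n. f n + g n \<in> S" "(\<lambda>n. f n + g n) \<longlonglongrightarrow> x + y"
    using assms by (auto intro: subspace_add tendsto_add)
  then show "x + y \<in> closure S" unfolding closure_sequential by (intro exI[of _ "\<lambda>n. f n + g n"]) simp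
next
  fix c :: real and x assume "x \<in> closure S"
  then obtain f where "\<And>n. f n \<in> S" "f \<longlonglongrightarrow> x"
    unfolding closure_sequential by blast
  then have "\<And>n. c *\<^sub>R f n \<in> S" "(\<lambda>n. c *\<^sub>R f n) \<longlonglongrightarrow> c *\<^sub>R x"
    using assms by (auto intro: subspace_scale tendsto_scaleR)
  then show "c *\<^sub>R x \<in> closure S" unfolding closure_sequential by (intro exI[of _ "\<lambda>n. c *\<^sub>R f n"]) simp
qed

section \<open>Density of an algebra in its double commutant\<close>

text \<open>The diagonal amplification of T, acting by T in each copy.\<close>

definition l2_map :: "'h op \<Rightarrow> 'h::complex_hilbert_space l2 \<Rightarrow> 'h l2" where
  "l2_map T f = Abs_l2 (\<lambda>k. blinfun_apply T (l2_nth f k))"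

definition l2_single :: "nat \<Rightarrow> 'h \<Rightarrow> 'h::complex_hilbert_space l2" where
  "l2_single l v = Abs_l2 (\<lambda>k. if k = l then v else 0)"

lemma l2_nth_Abs: "summable (\<lambda>k. (norm (f k))\<^sup>2) \<Longrightarrow> l2_nth (Abs_l2 f) k = f k"
  unfolding l2_nth.rep_eq by (simp add: Abs_l2_inverse)

lemma l2_nth_map [simp]: "l2_nth (l2_map T f) k = blinfun_apply T (l2_nth f k)"
  unfolding l2_map_def
  by (intro l2_nth_Abs square_summable_bounded[OF sums_summable[OF l2_norm_sums[of f]], of _ "norm T"] norm_blinfun)

lemma l2_nth_single [simp]: "l2_nth (l2_single l v) k = (if k = l then v else 0)"
  unfolding l2_single_def
  by (intro l2_nth_Abs summable_finite[of "{l}"]) auto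

lemma norm_l2_map_le: "norm (l2_map T f) \<le> norm T * norm f"
proof (rule l2_norm_le_sum)
  fix N
  have "(\<Sum>k<N. (norm (l2_nth (l2_map T f) k))\<^sup>2) \<le> (\<Sum>k<N. (norm T)\<^sup>2 * (norm (l2_nth f k))\<^sup>2)"
    unfolding power_mult_distrib[symmetric] by (intro sum_mono power_mono) (auto simp: norm_blinfun)
  also have "\<dots> \<le> (norm T)\<^sup>2 * (norm f)\<^sup>2"
    unfolding sum_distrib_left[symmetric] by (intro mult_left_mono l2_sum_le_norm) auto
  finally show "(\<Sum>k<N. (norm (l2_nth (l2_map T f) k))\<^sup>2) \<le> (norm T * norm f)\<^sup>2"
    by (simp add: power_mult_distrib)
qed simp

lemma bounded_linear_l2_map: "bounded_linear (l2_map T)"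
  by (rule bounded_linear_intro[of _ "norm T"])
     (auto intro!: l2_eqI simp: blinfun.add_right blinfun.scaleR_right norm_l2_map_le mult.commute[of _ "norm T"])

lemma norm_l2_single: "norm (l2_single l v) = norm v"
proof -
  have "(\<lambda>k. (norm (l2_nth (l2_single l v) k))\<^sup>2) sums (\<Sum>k\<in>{l}. (norm (l2_nth (l2_single l v) k))\<^sup>2)"
    by (rule sums_finite) auto
  from sums_unique2[OF this l2_norm_sums] show ?thesis by simp
qed

lemma bounded_linear_l2_single: "bounded_linear (l2_single l)"
  by (rule bounded_linear_intro[of _ 1]) (auto intro!: l2_eqI simp: norm_l2_single)

lemma l2_single_sums: "(\<lambda>l. l2_single l (l2_nth f l)) sums f"
proof -
  define s where "s N = (\<Sum>l<N. l2_single l (l2_nth f l))" for N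
  have nth: "l2_nth (s N) k = (if k < N then l2_nth f k else 0)" for N k
  proof -
    have "l2_nth (s N) k = (\<Sum>l<N. l2_nth (l2_single l (l2_nth f l)) k)"
      unfolding s_def by (rule linear_sum[OF bounded_linear.linear[OF bounded_linear_l2_nth]])
    then show ?thesis by simp
  qed
  have eq: "(norm (f - s N))\<^sup>2 = (norm f)\<^sup>2 - (\<Sum>k<N. (norm (l2_nth f k))\<^sup>2)" for N
  proof -
    have "(\<lambda>k. (norm (l2_nth f k))\<^sup>2 - (if k \<in> {..<N} then (norm (l2_nth f k))\<^sup>2 else 0))
        sums ((norm f)\<^sup>2 - (\<Sum>k<N. (norm (l2_nth f k))\<^sup>2))"
      by (intro sums_diff l2_norm_sums sums_If_finite_set) auto
    moreover have "(\<lambda>k. (norm (l2_nth f k))\<^sup>2 - (if k \<in> {..<N} then (norm (l2_nth f k))\<^sup>2 else 0))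
        = (\<lambda>k. (norm (l2_nth (f - s N) k))\<^sup>2)"
      by (auto simp: nth)
    ultimately show ?thesis using sums_unique2[OF l2_norm_sums] by metis
  qed
  have "(\<lambda>N. (norm f)\<^sup>2 - (\<Sum>k<N. (norm (l2_nth f k))\<^sup>2)) \<longlonglongrightarrow> (norm f)\<^sup>2 - (norm f)\<^sup>2"
    using l2_norm_sums[of f] unfolding sums_def by (intro tendsto_intros)
  then have "(\<lambda>N. sqrt ((norm (f - s N))\<^sup>2)) \<longlonglongrightarrow> sqrt 0"
    unfolding eq[symmetric] by (intro tendsto_real_sqrt) simp
  then have "(\<lambda>N. norm (s N - f)) \<longlonglongrightarrow> 0" by (simp add: norm_minus_commute)
  then show ?thesis
    unfolding sums_def s_def[symmetric] LIM_zero_iff[symmetric, of s] by (rule tendsto_norm_zero_cancel)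
qed

lemma inner_l2_eq: "inner f g = (\<Sum>k. inner (l2_nth f k) (l2_nth g k))"
  by transfer simp

lemma inner_l2_map_adjoint:
  "is_adjoint T S \<Longrightarrow> inner (l2_map T f) g = inner f (l2_map S g)"
  by (simp add: inner_l2_eq is_adjointD flip: Re_cinner)

text \<open>B is the adjoint of A, so W and its orthogonal complement are both invariant under A;
  therefore A (p v) has the property that characterises p (A v). Only the real inner product enters,
  so multiplication by a complex scalar is also covered.\<close>

lemma projection_commutes:
  fixes p A B :: "'v::real_inner \<Rightarrow> 'v"
  assumes p: "\<And>v. p v \<in> W" "\<And>v w. w \<in> W \<Longrightarrow> inner (v - p v) w = 0" and "subspace W"
    and A: "\<And>w. w \<in> W \<Longrightarrow> A w \<in> W" "\<And>u v. A (u - v) = A u - A v"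
    and B: "\<And>w. w \<in> W \<Longrightarrow> B w \<in> W" "\<And>u v. inner (A u) v = inner u (B v)"
  shows "p (A v) = A (p v)"
proof -
  define u where "u = p (A v) - A (p v)"
  have u: "u \<in> W" unfolding u_def using p(1) A(1) \<open>subspace W\<close> by (simp add: subspace_diff)
  have "inner (A v - A (p v)) u = inner (v - p v) (B u)" by (simp flip: A(2) add: B(2))
  also have "\<dots> = 0" using B(1) p(2) u by blast
  finally have "inner u u = 0"
    using p(2)[OF u, of "A v"] unfolding u_def[THEN arg_cong[of _ _ "\<lambda>x. inner x u"]]
    by (simp add: inner_diff_left)
  then show ?thesis by (simp add: u_def)
qed

text \<open>Von Neumann's argument in the amplification. The projection P onto the closed orbit of
  \<zeta> commutes with all amplified x_i, so its blocks lie in the commutant. Hence h commutes with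
  the blocks, P commutes with the amplification of h, and h \<zeta> stays in the closed orbit. A
  single amplified vector suffices to make this approximation ultrastrong.\<close>

lemma double_commutant_dense:
  fixes x :: "nat \<Rightarrow> 'h::complex_hilbert_space op" and \<zeta> :: "'h l2"
  assumes sa: "\<And>i. i < m \<Longrightarrow> self_adjoint (x i)"
    and h: "h \<in> commutant (commutant (x ` {..<m}))" and "e > 0"
  shows "\<exists>p. nc_vars m p \<and> norm (l2_map (nc_eval p x - h) \<zeta>) < e"
proof -
  define W0 where "W0 = {l2_map (nc_eval p x) \<zeta> | p. nc_vars m p}"
  define W where "W = closure W0"
  have bo: "x i \<in> bounded_ops" if "i < m" for i using sa[OF that] by (rule self_adjoint_bounded_ops)
  have W0_add: "u + v \<in> W0" if uv: "u \<in> W0" "v \<in> W0" for u v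
  proof -
    obtain p q where "nc_vars m p" "nc_vars m q" "u = l2_map (nc_eval p x) \<zeta>" "v = l2_map (nc_eval q x) \<zeta>"
      using uv unfolding W0_def by blast
    then have "nc_vars m (p @ q)" "u + v = l2_map (nc_eval (p @ q) x) \<zeta>"
      by (auto intro!: l2_eqI simp: blinfun.add_left)
    then show ?thesis unfolding W0_def by blast
  qed
  have W0_scaleC: "c *\<^sub>C u \<in> W0" if u: "u \<in> W0" for c u
  proof -
    obtain p where "nc_vars m p" "u = l2_map (nc_eval p x) \<zeta>"
      using u unfolding W0_def by blast
    then have "nc_vars m (nc_scale c p)" "c *\<^sub>C u = l2_map (nc_eval (nc_scale c p) x) \<zeta>"
      by (auto intro!: l2_eqI simp: nc_eval_scale)
    then show ?thesis unfolding W0_def by blast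
  qed
  have W0_x: "l2_map (x i) u \<in> W0" if u: "u \<in> W0" "i < m" for i u
  proof -
    obtain p where p: "nc_vars m p" "u = l2_map (nc_eval p x) \<zeta>"
      using u unfolding W0_def by blast
    have v: "nc_vars m [(1, [i])]" using u by simp
    have "nc_vars m (nc_mult [(1, [i])] p)" by (rule nc_vars_mult[OF v p(1)])
    moreover have "l2_map (x i) u = l2_map (nc_eval (nc_mult [(1, [i])] p) x) \<zeta>"
      using p by (auto intro!: l2_eqI simp: nc_eval_mult[OF bo v] scaleC_one)
    ultimately show ?thesis unfolding W0_def by blast
  qed
  have "l2_map (nc_eval [] x) \<zeta> \<in> W0" unfolding W0_def by (intro CollectI exI[of _ "[]"]) simp
  moreover have "l2_map (nc_eval [] x) \<zeta> = 0" by (rule l2_eqI) simp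
  ultimately have "subspace W0"
    unfolding subspace_def using W0_add W0_scaleC by (auto simp flip: scaleC_of_real)
  then have W: "closed W" "subspace W"
    using closed_closure[of W0] unfolding W_def by (simp_all add: subspace_closure)
  have inv: "A w \<in> W" if "bounded_linear A" "\<And>u. u \<in> W0 \<Longrightarrow> A u \<in> W0" "w \<in> W" for A w
  proof -
    have "A ` closure W0 \<subseteq> closure W0"
      using that closure_subset by (intro image_closure_subset linear_continuous_on) auto
    then show ?thesis using that(3) by (auto simp: W_def)
  qed
  obtain P :: "'h l2 \<Rightarrow>\<^sub>L 'h l2"
    where P: "\<And>v. P v \<in> W" "\<And>v w. w \<in> W \<Longrightarrow> inner (v - P v) w = 0"
    using orthogonal_projection_exists[OF W] by blast
  \<comment> \<open>P was built from the real inner product; its complex linearity comes from the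
    scalar c, whose adjoint is \<open>cnj c\<close>.\<close>
  have P_scaleC: "P (c *\<^sub>C v) = c *\<^sub>C P v" for c v
  proof (rule projection_commutes[OF P W(2), where B = "\<lambda>v. cnj c *\<^sub>C v"])
    fix u v :: "'h l2" and w assume "w \<in> W"
    then show "c *\<^sub>C w \<in> W" "cnj c *\<^sub>C w \<in> W" by (auto intro: inv bounded_linear_scaleC W0_scaleC)
  qed (simp_all add: scaleC_diff_right cinner_scaleC_left cinner_scaleC_right flip: Re_cinner)
  have P_x: "P (l2_map (x i) v) = l2_map (x i) (P v)" if "i < m" for i v
    by (rule projection_commutes[OF P W(2), where B = "l2_map (x i)"])
       (use that sa[OF that] in \<open>auto intro: inv bounded_linear_l2_map W0_x inner_l2_map_adjoint
         simp: linear_diff[OF bounded_linear.linear[OF bounded_linear_l2_map]] self_adjoint_def\<close>)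
  \<comment> \<open>The block of P from copy l to copy k.\<close>
  define E where "E k l = Blinfun (\<lambda>v. l2_nth (P (l2_single l v)) k)" for k l
  have E: "blinfun_apply (E k l) v = l2_nth (P (l2_single l v)) k" for k l v
  proof -
    have "bounded_linear (\<lambda>v. l2_nth (blinfun_apply P (l2_single l v)) k)"
      by (rule bounded_linear_compose[OF bounded_linear_l2_nth
            bounded_linear_compose[OF blinfun.bounded_linear_right bounded_linear_l2_single]])
    then show ?thesis unfolding E_def by (simp add: bounded_linear_Blinfun_apply)
  qed
  have sc: "l2_single l (c *\<^sub>C v) = c *\<^sub>C l2_single l v" for l c and v :: 'h
    by (rule l2_eqI) (simp add: scaleC_zero_right)
  have sm: "l2_single l (blinfun_apply T v) = l2_map T (l2_single l v)" for l T and v :: 'h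
    by (rule l2_eqI) (simp add: blinfun.zero_right)
  have "E k l \<in> commutant (x ` {..<m})" for k l
    unfolding commutant_def bounded_ops_def
    by (auto intro!: blinfun_eqI simp: E sc P_scaleC sm P_x)
  then have comm: "h o\<^sub>L E k l = E k l o\<^sub>L h" for k l
    using h unfolding commutant_def by blast
  have "l2_nth (P (l2_map h v)) k = l2_nth (l2_map h (P v)) k" for v k
  proof -
    \<comment> \<open>Commutation is known block by block. Both sides are expanded over the copies l
      as convergent series, to be compared term by term.\<close>
    have 1: "(\<lambda>l. l2_nth (P (l2_map h (l2_single l (l2_nth v l)))) k) sums l2_nth (P (l2_map h v)) k"
      by (intro bounded_linear.sums[OF bounded_linear_l2_nth] bounded_linear.sums[OF blinfun.bounded_linear_right]
          bounded_linear.sums[OF bounded_linear_l2_map] l2_single_sums)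
    have 2: "(\<lambda>l. l2_nth (l2_map h (P (l2_single l (l2_nth v l)))) k) sums l2_nth (l2_map h (P v)) k"
      by (intro bounded_linear.sums[OF bounded_linear_l2_nth] bounded_linear.sums[OF blinfun.bounded_linear_right]
          bounded_linear.sums[OF bounded_linear_l2_map] l2_single_sums)
    have "l2_nth (P (l2_map h (l2_single l (l2_nth v l)))) k = l2_nth (l2_map h (P (l2_single l (l2_nth v l)))) k" for l
      using arg_cong[OF comm[of k l], of "\<lambda>T. blinfun_apply T (l2_nth v l)"] by (simp add: E sm)
    with 1 2 show ?thesis using sums_unique2 by simp
  qed
  then have Ph: "P (l2_map h \<zeta>) = l2_map h (P \<zeta>)" by (intro l2_eqI)
  \<comment> \<open>The constant polynomial 1 shows that \<zeta> lies in its own orbit, so P fixes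
    \<zeta>.\<close>
  have "l2_map (nc_eval [(1, [])] x) \<zeta> \<in> W0" unfolding W0_def by (intro CollectI exI[of _ "[(1, [])]"]) simp
  moreover have "l2_map (nc_eval [(1, [])] x) \<zeta> = \<zeta>" by (rule l2_eqI) (simp add: scaleC_one)
  ultimately have "\<zeta> \<in> W" unfolding W_def using closure_subset by auto
  then have z: "\<zeta> - P \<zeta> \<in> W" using P(1) W(2) by (simp add: subspace_diff)
  have "P \<zeta> = \<zeta>" using P(2)[OF z, of \<zeta>] by simp
  then have "l2_map h \<zeta> \<in> W" using Ph P(1)[of "l2_map h \<zeta>"] by simp
  then obtain u where "u \<in> W0" "dist u (l2_map h \<zeta>) < e"
    using \<open>e > 0\<close> unfolding W_def closure_approachable by blast
  then obtain p where p: "nc_vars m p" "dist (l2_map (nc_eval p x) \<zeta>) (l2_map h \<zeta>) < e"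
    by (auto simp: W0_def)
  moreover have "l2_map (nc_eval p x - h) \<zeta> = l2_map (nc_eval p x) \<zeta> - l2_map h \<zeta>"
    by (rule l2_eqI) (simp add: blinfun.diff_left)
  ultimately show ?thesis by (auto simp: dist_norm)
qed

section \<open>The 2-norm of a tracial algebra\<close>

lemma quadratic_nonneg_imp_discriminant:
  fixes a b c :: real
  assumes "\<And>t. 0 \<le> a + 2 * t * b + t\<^sup>2 * c" "0 \<le> c"
  shows "b\<^sup>2 \<le> a * c"
proof (cases "c = 0")
  case True
  have "b = 0"
  proof (rule ccontr)
    assume "b \<noteq> 0"
    \<comment> \<open>With c = 0 the expression is affine in t, and this t gives it the value
      -1.\<close>
    then have "a + 2 * (- (a + 1) / (2 * b)) * b = -1" by (simp add: field_simps)
    then show False using assms(1)[of "- (a + 1) / (2 * b)"] True by simp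
  qed
  then show ?thesis using True by simp
next
  case False
  then have c: "c > 0" using assms(2) by simp
  have "0 \<le> a + 2 * (- b / c) * b + (- b / c)\<^sup>2 * c" by (rule assms(1))
  also have "\<dots> = a - b\<^sup>2 / c" using c by (simp add: power2_eq_square)
  finally show ?thesis using c by (simp add: field_simps)
qed

text \<open>The common frame for M and for matrices. The constant in \<open>trace_bounded\<close> is
  arbitrary, since continuity at 0 yields no better one; the bound \<open>n2_le_norm\<close> is
  recovered by the power trick below. The trace may vanish on nonzero positive elements, as it does
  for \<open>corner_algebra\<close>, so \<open>n2\<close> is only a seminorm.\<close>

locale tracial_algebra =
  fixes N :: "'h::complex_hilbert_space op set" and \<tau> :: "'h op \<Rightarrow> complex"
  assumes has_adjoint: "T \<in> N \<Longrightarrow> \<exists>S\<in>N. is_adjoint T S"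
    and id_in: "id_blinfun \<in> N"
    and add_in: "S \<in> N \<Longrightarrow> T \<in> N \<Longrightarrow> S + T \<in> N"
    and scaleC_in: "T \<in> N \<Longrightarrow> c *\<^sub>O T \<in> N"
    and compose_in: "S \<in> N \<Longrightarrow> T \<in> N \<Longrightarrow> S o\<^sub>L T \<in> N"
    and trace_add: "S \<in> N \<Longrightarrow> T \<in> N \<Longrightarrow> \<tau> (S + T) = \<tau> S + \<tau> T"
    and trace_scaleC: "T \<in> N \<Longrightarrow> \<tau> (c *\<^sub>O T) = c * \<tau> T"
    and trace_id: "\<tau> id_blinfun = 1"
    and trace_pos: "T \<in> N \<Longrightarrow> S \<in> N \<Longrightarrow> is_adjoint T S \<Longrightarrow> 0 \<le> Re (\<tau> (S o\<^sub>L T))"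
    and trace_comm: "S \<in> N \<Longrightarrow> T \<in> N \<Longrightarrow> \<tau> (S o\<^sub>L T) = \<tau> (T o\<^sub>L S)"
    and trace_bounded: "\<exists>C. \<forall>T\<in>N. cmod (\<tau> T) \<le> C * norm T"
begin

definition star :: "'h op \<Rightarrow> 'h op" where
  "star T = (THE S. is_adjoint T S)"

definition n2 :: "'h op \<Rightarrow> real" where
  "n2 T = sqrt (Re (\<tau> (star T o\<^sub>L T)))"

lemma star_eq: "is_adjoint T S \<Longrightarrow> star T = S"
  unfolding star_def using is_adjoint_unique by blast

lemma star: assumes "T \<in> N" shows star_in: "star T \<in> N" and is_adjoint_star: "is_adjoint T (star T)"
  using has_adjoint[OF assms] star_eq by auto

lemma in_bounded_ops: "T \<in> N \<Longrightarrow> T \<in> bounded_ops"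
  using adjointable_in_bounded_ops is_adjoint_star by blast

lemma minus_in: "T \<in> N \<Longrightarrow> - T \<in> N"
  using scaleC_in[of T "-1"] by (simp add: op_scaleC_minus_one)

lemma diff_in: "S \<in> N \<Longrightarrow> T \<in> N \<Longrightarrow> S - T \<in> N"
  using add_in[OF _ minus_in] by fastforce

lemma scaleR_in: "T \<in> N \<Longrightarrow> r *\<^sub>R T \<in> N"
  by (simp add: op_scaleR scaleC_in)

lemma zero_in: "0 \<in> N"
  using diff_in[OF id_in id_in] by simp

lemma sum_in: "(\<And>i. i \<in> I \<Longrightarrow> f i \<in> N) \<Longrightarrow> sum f I \<in> N"
  by (induction I rule: infinite_finite_induct) (auto simp: zero_in add_in)

lemma star_simps:
  "S \<in> N \<Longrightarrow> T \<in> N \<Longrightarrow> star (S + T) = star S + star T"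
  "S \<in> N \<Longrightarrow> T \<in> N \<Longrightarrow> star (S - T) = star S - star T"
  "T \<in> N \<Longrightarrow> star (c *\<^sub>O T) = cnj c *\<^sub>O star T"
  "S \<in> N \<Longrightarrow> T \<in> N \<Longrightarrow> star (S o\<^sub>L T) = star T o\<^sub>L star S"
  "T \<in> N \<Longrightarrow> star (star T) = T"
  by (intro star_eq is_adjoint_add is_adjoint_diff is_adjoint_scaleC is_adjoint_compose
      is_adjoint_star is_adjoint_sym[OF is_adjoint_star]; assumption)+

lemma norm_star_le: "T \<in> N \<Longrightarrow> norm (star T) \<le> norm T"
  using norm_adjoint_le is_adjoint_star by blast

lemma n2_nonneg: "T \<in> N \<Longrightarrow> 0 \<le> n2 T"
  unfolding n2_def using trace_pos is_adjoint_star star_in by auto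

lemma n2_sq: "T \<in> N \<Longrightarrow> (n2 T)\<^sup>2 = Re (\<tau> (star T o\<^sub>L T))"
  unfolding n2_def using trace_pos is_adjoint_star star_in by auto

text \<open>The polar form of \<open>n2\<close> squared. It is symmetrised by hand because the
  locale does not state that the trace of an adjoint is the conjugate of the trace.\<close>

definition ip :: "'h op \<Rightarrow> 'h op \<Rightarrow> real" where
  "ip S T = (Re (\<tau> (star S o\<^sub>L T)) + Re (\<tau> (star T o\<^sub>L S))) / 2"

lemma n2_add_scale:
  assumes "S \<in> N" "T \<in> N"
  shows "(n2 (S + complex_of_real t *\<^sub>O T))\<^sup>2 = (n2 S)\<^sup>2 + 2 * t * ip S T + t\<^sup>2 * (n2 T)\<^sup>2"
proof -
  let ?t = "complex_of_real t"
  have tT: "?t *\<^sub>O T \<in> N" and st: "star S \<in> N" "star T \<in> N"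
    using assms by (auto intro: scaleC_in star_in)
  have "star (S + ?t *\<^sub>O T) = star S + ?t *\<^sub>O star T"
    by (simp only: star_simps(1)[OF assms(1) tT] star_simps(3)[OF assms(2)] complex_cnj_complex_of_real)
  then have "star (S + ?t *\<^sub>O T) o\<^sub>L (S + ?t *\<^sub>O T) =
      ((star S o\<^sub>L S) + ?t *\<^sub>O (star S o\<^sub>L T)) + (?t *\<^sub>O (star T o\<^sub>L S) + (?t * ?t) *\<^sub>O (star T o\<^sub>L T))"
    by (auto intro!: blinfun_eqI simp: blinfun.add_left blinfun.add_right bounded_opsD[OF in_bounded_ops] st
        scaleC_add_right scaleC_scaleC)
  then have "\<tau> (star (S + ?t *\<^sub>O T) o\<^sub>L (S + ?t *\<^sub>O T)) =
      (\<tau> (star S o\<^sub>L S) + ?t * \<tau> (star S o\<^sub>L T)) + (?t * \<tau> (star T o\<^sub>L S) + (?t * ?t) * \<tau> (star T o\<^sub>L T))"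
    using assms st by (simp only: trace_add trace_scaleC scaleC_in compose_in add_in)
  then show ?thesis
    using assms tT by (simp add: n2_sq add_in ip_def power2_eq_square[of t] distrib_left)
qed

lemma ip_le:
  assumes "S \<in> N" "T \<in> N"
  shows "ip S T \<le> n2 S * n2 T"
proof -
  have "(ip S T)\<^sup>2 \<le> (n2 S)\<^sup>2 * (n2 T)\<^sup>2"
  proof (rule quadratic_nonneg_imp_discriminant)
    show "0 \<le> (n2 S)\<^sup>2 + 2 * t * ip S T + t\<^sup>2 * (n2 T)\<^sup>2" for t
      unfolding n2_add_scale[OF assms, symmetric] by (rule zero_le_power2)
  qed simp
  then have "(ip S T)\<^sup>2 \<le> (n2 S * n2 T)\<^sup>2" by (simp add: power_mult_distrib)
  then show ?thesis
    by (rule power2_le_imp_le) (simp add: assms n2_nonneg)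
qed

lemma n2_triangle:
  assumes "S \<in> N" "T \<in> N"
  shows "n2 (S + T) \<le> n2 S + n2 T"
proof (rule power2_le_imp_le)
  show "(n2 (S + T))\<^sup>2 \<le> (n2 S + n2 T)\<^sup>2"
    using n2_add_scale[OF assms, of 1] ip_le[OF assms] by (simp add: op_scaleC_one power2_sum)
qed (use assms in \<open>auto intro: n2_nonneg add_nonneg_nonneg\<close>)

lemma n2_scaleC: assumes "T \<in> N" shows "n2 (c *\<^sub>O T) = cmod c * n2 T"
proof -
  have c: "cnj c * c = complex_of_real ((cmod c)\<^sup>2)"
    by (simp only: complex_norm_square mult.commute)
  have "star (c *\<^sub>O T) o\<^sub>L (c *\<^sub>O T) = (cnj c * c) *\<^sub>O (star T o\<^sub>L T)"
    by (rule blinfun_eqI)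
       (simp add: star_simps(3)[OF assms] bounded_opsD[OF in_bounded_ops[OF star_in[OF assms]]] scaleC_scaleC)
  then have "\<tau> (star (c *\<^sub>O T) o\<^sub>L (c *\<^sub>O T)) = complex_of_real ((cmod c)\<^sup>2) * \<tau> (star T o\<^sub>L T)"
    using trace_scaleC[OF compose_in[OF star_in[OF assms] assms]] by (simp only: c)
  then have "(n2 (c *\<^sub>O T))\<^sup>2 = (cmod c * n2 T)\<^sup>2"
    by (simp only: n2_sq scaleC_in assms power_mult_distrib Re_complex_of_real Im_complex_of_real times_complex.sel mult_zero_left diff_zero)
  then show ?thesis
    by (rule power2_eq_imp_eq) (simp_all add: assms n2_nonneg scaleC_in)
qed

lemma n2_minus: "T \<in> N \<Longrightarrow> n2 (- T) = n2 T"
  using n2_scaleC[of T "-1"] by (simp add: op_scaleC_minus_one)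

lemma n2_diff_commute: "S \<in> N \<Longrightarrow> T \<in> N \<Longrightarrow> n2 (S - T) = n2 (T - S)"
  using n2_minus[of "T - S"] by (simp add: diff_in)

lemma n2_scaleR: "T \<in> N \<Longrightarrow> n2 (r *\<^sub>R T) = \<bar>r\<bar> * n2 T"
  by (simp add: op_scaleR n2_scaleC)

lemma n2_zero: "n2 0 = 0"
  using n2_scaleC[OF zero_in, of 0] by (simp add: op_scaleC_zero)

lemma n2_triangle_diff: "S \<in> N \<Longrightarrow> T \<in> N \<Longrightarrow> n2 (S - T) \<le> n2 S + n2 T"
  using n2_triangle[OF _ minus_in, of S T] by (simp add: n2_minus)

lemma n2_sum: "(\<And>i. i \<in> I \<Longrightarrow> f i \<in> N) \<Longrightarrow> n2 (sum f I) \<le> (\<Sum>i\<in>I. n2 (f i))"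
proof (induction I rule: infinite_finite_induct)
  case (insert i I)
  then have "n2 (f i + sum f I) \<le> n2 (f i) + n2 (sum f I)" by (intro n2_triangle sum_in) auto
  with insert show ?case by force
qed (simp_all add: n2_zero)

lemma n2_star: "T \<in> N \<Longrightarrow> n2 (star T) = n2 T"
  unfolding n2_def by (simp add: star_simps(5) trace_comm[of "star T" T] star_in)

text \<open>Left multiplication is bounded by the operator norm: for self-adjoint \<open>z\<close> the
  Cauchy--Schwarz inequality gives \<open>n2 (z b)\<^sup>2 \<le> n2 b \<cdot> n2 (z\<^sup>2 b)\<close>. Iterating along
  \<open>z, z\<^sup>2, z\<^sup>4, \<dots>\<close> against the crude bound \<open>n2 (z b) \<le> C \<parallel>z\<parallel> \<parallel>b\<parallel>\<close> removes the constant.\<close>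

lemma n2_crude_bound: "\<exists>C\<ge>0. \<forall>T\<in>N. n2 T \<le> C * norm T"
proof -
  obtain C where C: "\<And>T. T \<in> N \<Longrightarrow> cmod (\<tau> T) \<le> C * norm T" using trace_bounded by blast
  have "n2 T \<le> sqrt \<bar>C\<bar> * norm T" if "T \<in> N" for T
  proof (rule power2_le_imp_le)
    have "Re (\<tau> (star T o\<^sub>L T)) \<le> C * norm (star T o\<^sub>L T)"
      using C[OF compose_in[OF star_in[OF that] that]] complex_Re_le_cmod by (rule order_trans[rotated])
    also have "\<dots> \<le> \<bar>C\<bar> * (norm T * norm T)"
      by (intro mult_mono order_trans[OF norm_blinfun_compose] norm_star_le that) auto
    finally show "(n2 T)\<^sup>2 \<le> (sqrt \<bar>C\<bar> * norm T)\<^sup>2"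
      using that by (simp add: n2_sq power_mult_distrib power2_eq_square[of "norm T"])
  qed simp
  then show ?thesis by (intro exI[of _ "sqrt \<bar>C\<bar>"]) auto
qed

lemma n2_self_adjoint_compose:
  assumes z: "z \<in> N" "star z = z" and b: "b \<in> N"
  shows "n2 (z o\<^sub>L b) \<le> norm z * n2 b"
proof (rule ccontr)
  assume "\<not> ?thesis"
  then have gt: "norm z * n2 b < n2 (z o\<^sub>L b)" by simp
  have sq: "(n2 (z o\<^sub>L b))\<^sup>2 \<le> n2 b * n2 ((z o\<^sub>L z) o\<^sub>L b)" if "z \<in> N" "star z = z" for z
  proof -
    have "(n2 (z o\<^sub>L b))\<^sup>2 = ip b ((z o\<^sub>L z) o\<^sub>L b)"
      using that b by (simp add: n2_sq ip_def compose_in star_simps blinfun_compose_assoc)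
    also have "\<dots> \<le> n2 b * n2 ((z o\<^sub>L z) o\<^sub>L b)"
      using that b by (intro ip_le compose_in)
    finally show ?thesis .
  qed
  have b0: "n2 b > 0"
  proof (rule ccontr)
    assume "\<not> ?thesis"
    then have "n2 b = 0" using n2_nonneg[OF b] by simp
    then show False using sq[OF z] gt by simp
  qed
  \<comment> \<open>The ratio in the supposed counterexample, larger than norm z. Repeated squaring
    makes the discrepancy grow like (r / norm z)^(2^n), which the constant C cannot absorb.\<close>
  define r where "r = n2 (z o\<^sub>L b) / n2 b"
  have r: "norm z < r" using gt b0 by (simp add: r_def field_simps)
  define Z where "Z n = ((\<lambda>T. T o\<^sub>L T) ^^ n) z" for n
  have Z: "Z n \<in> N \<and> star (Z n) = Z n \<and> norm (Z n) \<le> norm z ^ (2 ^ n) \<and> r ^ (2 ^ n) * n2 b \<le> n2 (Z n o\<^sub>L b)" for n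
  proof (induction n)
    case 0
    then show ?case using z b0 by (simp add: Z_def r_def)
  next
    case (Suc n)
    have ZS: "Z (Suc n) = Z n o\<^sub>L Z n" by (simp add: Z_def)
    have "norm (Z (Suc n)) \<le> norm (Z n) * norm (Z n)" unfolding ZS by (rule norm_blinfun_compose)
    also have "\<dots> \<le> norm z ^ (2 ^ n) * norm z ^ (2 ^ n)" using Suc by (intro mult_mono) auto
    finally have 1: "norm (Z (Suc n)) \<le> norm z ^ (2 ^ Suc n)" by (simp add: mult_2 power_add)
    have "0 \<le> r" using r norm_ge_zero[of z] by linarith
    then have "(r ^ (2 ^ n) * n2 b)\<^sup>2 \<le> (n2 (Z n o\<^sub>L b))\<^sup>2"
      using Suc b0 by (intro power_mono) auto
    also have "\<dots> \<le> n2 b * n2 (Z (Suc n) o\<^sub>L b)" unfolding ZS using Suc by (intro sq) auto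
    finally have "n2 b * (r ^ (2 ^ Suc n) * n2 b) \<le> n2 b * n2 (Z (Suc n) o\<^sub>L b)"
      by (simp add: power_mult_distrib power2_eq_square mult_2 power_add algebra_simps)
    then have "r ^ (2 ^ Suc n) * n2 b \<le> n2 (Z (Suc n) o\<^sub>L b)" using b0 by simp
    with 1 Suc show ?case by (simp add: ZS compose_in star_simps)
  qed
  obtain C where C: "C \<ge> 0" "\<And>T. T \<in> N \<Longrightarrow> n2 T \<le> C * norm T" using n2_crude_bound by blast
  have bd: "r ^ (2 ^ n) * n2 b \<le> C * norm b * norm z ^ (2 ^ n)" for n
  proof -
    have "r ^ (2 ^ n) * n2 b \<le> n2 (Z n o\<^sub>L b)" using Z by blast
    also have "\<dots> \<le> C * norm (Z n o\<^sub>L b)" using Z b by (intro C compose_in) auto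
    also have "\<dots> \<le> C * (norm z ^ (2 ^ n) * norm b)"
      using Z by (intro mult_left_mono order_trans[OF norm_blinfun_compose] mult_right_mono C) auto
    finally show ?thesis by (simp add: algebra_simps)
  qed
  show False
  proof (cases "norm z = 0")
    case True
    then show False using bd[of 0] r b0 by (simp add: mult_le_0_iff)
  next
    case False
    then have z0: "norm z > 0" by simp
    define s where "s = r / norm z"
    have "s > 1" using r z0 by (simp add: s_def)
    then obtain n where n: "C * norm b / n2 b < s ^ n" using real_arch_pow by blast
    also have "s ^ n \<le> s ^ (2 ^ n)"
      using \<open>s > 1\<close> by (intro power_increasing) (auto simp: less_imp_le)
    finally have "C * norm b < s ^ (2 ^ n) * n2 b" using b0 by (simp add: field_simps)
    moreover have "s ^ (2 ^ n) * n2 b \<le> C * norm b"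
      using bd[of n] z0 by (simp add: s_def power_divide field_simps)
    ultimately show False by simp
  qed
qed

text \<open>The squared 2-norm of a b pairs b with z b for the self-adjoint z =
  \<open>star a o\<^sub>L a\<close>; Cauchy-Schwarz and the self-adjoint case finish.\<close>

lemma n2_compose_left:
  assumes "a \<in> N" "b \<in> N"
  shows "n2 (a o\<^sub>L b) \<le> norm a * n2 b"
proof (rule power2_le_imp_le)
  let ?z = "star a o\<^sub>L a"
  have z: "?z \<in> N" "star ?z = ?z" using assms by (simp_all add: compose_in star_in star_simps)
  have "(n2 (a o\<^sub>L b))\<^sup>2 = ip b (?z o\<^sub>L b)"
    using assms by (simp add: n2_sq ip_def compose_in star_in star_simps blinfun_compose_assoc)
  also have "\<dots> \<le> n2 b * n2 (?z o\<^sub>L b)" using assms z by (intro ip_le compose_in star_in)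
  also have "\<dots> \<le> n2 b * (norm ?z * n2 b)"
    using assms z by (intro mult_left_mono n2_self_adjoint_compose n2_nonneg)
  also have "norm ?z \<le> norm a * norm a"
    using assms by (intro order_trans[OF norm_blinfun_compose] mult_right_mono norm_star_le) auto
  then have "n2 b * (norm ?z * n2 b) \<le> n2 b * (norm a * norm a * n2 b)"
    using assms by (intro mult_left_mono mult_right_mono n2_nonneg)
  finally show "(n2 (a o\<^sub>L b))\<^sup>2 \<le> (norm a * n2 b)\<^sup>2"
    by (simp add: power2_eq_square algebra_simps)
qed (use assms n2_nonneg in auto)

text \<open>Taking adjoints exchanges left and right, and the trace property makes \<open>n2\<close>
  invariant under adjoints.\<close>

lemma n2_compose_right:
  assumes "a \<in> N" "b \<in> N"
  shows "n2 (b o\<^sub>L a) \<le> n2 b * norm a"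
proof -
  have "n2 (b o\<^sub>L a) = n2 (star a o\<^sub>L star b)"
    using n2_star[OF compose_in[OF assms(2,1)]] assms by (simp add: star_simps)
  also have "\<dots> \<le> norm (star a) * n2 (star b)" using assms by (intro n2_compose_left star_in)
  also have "\<dots> \<le> norm a * n2 b"
    unfolding n2_star[OF assms(2)] using assms by (intro mult_right_mono norm_star_le n2_nonneg)
  finally show ?thesis by (simp add: mult.commute)
qed

lemma n2_le_norm: assumes "T \<in> N" shows "n2 T \<le> norm T"
proof -
  have "n2 id_blinfun = 1" unfolding n2_def by (simp add: star_eq[OF is_adjoint_id] trace_id)
  then show ?thesis using n2_compose_left[OF assms id_in] by simp
qed

end

section \<open>Consequences of normality\<close>

text \<open>Alternating the coordinates of f and g merges them into one vector. In this way finitely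
  many ultraweak conditions become a condition on a single vector.\<close>

lemma l2_interleave:
  fixes f g :: "'h::complex_hilbert_space l2"
  shows "\<exists>h. \<forall>T. (norm (l2_map T h))\<^sup>2 = (norm (l2_map T f))\<^sup>2 + (norm (l2_map T g))\<^sup>2"
proof -
  define h where "h k = (if even k then l2_nth g (k div 2) else l2_nth f ((k - 1) div 2))" for k
  have s: "(\<lambda>k. (norm (blinfun_apply T (h k)))\<^sup>2) sums ((norm (l2_map T f))\<^sup>2 + (norm (l2_map T g))\<^sup>2)" for T
  proof -
    have "(\<lambda>k. (norm (blinfun_apply T (h k)))\<^sup>2) =
        (\<lambda>k. if even k then (norm (l2_nth (l2_map T g) (k div 2)))\<^sup>2 else (norm (l2_nth (l2_map T f) ((k - 1) div 2)))\<^sup>2)"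
      by (auto simp: h_def)
    then show ?thesis
      using sums_if[OF l2_norm_sums[of "l2_map T f"] l2_norm_sums[of "l2_map T g"]] by simp
  qed
  have "summable (\<lambda>k. (norm (h k))\<^sup>2)" using sums_summable[OF s[of id_blinfun]] by simp
  then have nth: "l2_nth (Abs_l2 h) k = h k" for k by (rule l2_nth_Abs)
  have "(norm (l2_map T (Abs_l2 h)))\<^sup>2 = (norm (l2_map T f))\<^sup>2 + (norm (l2_map T g))\<^sup>2" for T
    using sums_unique2[OF l2_norm_sums[of "l2_map T (Abs_l2 h)"]] s[of T] by (simp add: nth)
  then show ?thesis by blast
qed

lemma l2_interleave_le:
  fixes f g :: "'h::complex_hilbert_space l2"
  shows "\<exists>h. \<forall>T. norm (l2_map T f) \<le> norm (l2_map T h) \<and> norm (l2_map T g) \<le> norm (l2_map T h)"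
proof -
  obtain h where h: "\<And>T. (norm (l2_map T h))\<^sup>2 = (norm (l2_map T f))\<^sup>2 + (norm (l2_map T g))\<^sup>2"
    using l2_interleave[of f g] by blast
  have "norm (l2_map T f) \<le> norm (l2_map T h) \<and> norm (l2_map T g) \<le> norm (l2_map T h)" for T
    by (intro conjI; rule power2_le_imp_le) (simp_all add: h)
  then show ?thesis by blast
qed

text \<open>Since the pairing of S T \<xi> with \<eta> is that of T \<xi> with T \<eta>, smallness
  of T on one amplified vector makes S T ultraweakly small. The second half says that norm balls are
  ultraweak neighbourhoods' subsets. Both properties pass through the generation of the topology by
  induction.\<close>

lemma ultraweak_nhd_zero:
  fixes U :: "'h::complex_hilbert_space op set"
  assumes "openin ultraweak_topology U" "0 \<in> U"
  shows "(\<exists>\<zeta>. \<forall>T S. is_adjoint T S \<and> norm (l2_map T \<zeta>) < 1 \<longrightarrow> S o\<^sub>L T \<in> U) \<and>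
    (\<exists>r>0. \<forall>T. norm T < r \<longrightarrow> T \<in> U)"
  using openin_topology_generated_by[OF assms(1)[unfolded ultraweak_topology_def]] assms(2)
proof (induction U rule: generate_topology_on.induct)
  case (Int A B)
  then obtain \<zeta> \<eta> r s where
    *: "\<And>T S. is_adjoint T S \<Longrightarrow> norm (l2_map T \<zeta>) < 1 \<Longrightarrow> S o\<^sub>L T \<in> A"
      "\<And>T S. is_adjoint T S \<Longrightarrow> norm (l2_map T \<eta>) < 1 \<Longrightarrow> S o\<^sub>L T \<in> B"
      "r > 0" "\<And>T. norm T < r \<Longrightarrow> T \<in> A" "s > 0" "\<And>T. norm T < s \<Longrightarrow> T \<in> B"
  proof -
    from Int.prems have "0 \<in> A" "0 \<in> B" by auto
    from Int.IH(1)[OF this(1)] Int.IH(2)[OF this(2)] show thesis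
      using that by blast
  qed
  obtain h where h: "\<And>T. norm (l2_map T \<zeta>) \<le> norm (l2_map T h)" "\<And>T. norm (l2_map T \<eta>) \<le> norm (l2_map T h)"
    using l2_interleave_le[of \<zeta> \<eta>] by blast
  have "\<forall>T S. is_adjoint T S \<and> norm (l2_map T h) < 1 \<longrightarrow> S o\<^sub>L T \<in> A \<inter> B"
    using *(1,2) h le_less_trans by blast
  moreover have "\<forall>T. norm T < min r s \<longrightarrow> T \<in> A \<inter> B" using * by auto
  moreover have "min r s > 0" using * by simp
  ultimately show ?case by blast
next
  case (UN K)
  then obtain k where k: "k \<in> K" "0 \<in> k" by blast
  show ?case using UN.IH[OF k] k(1) by (meson UnionI)
next
  case (Basis u)
  then obtain \<xi> \<eta> V where u: "u = {T. (\<Sum>k. cinner (blinfun_apply T (\<xi> k)) (\<eta> k)) \<in> V}"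
    and s: "summable (\<lambda>k. (norm (\<xi> k))\<^sup>2)" "summable (\<lambda>k. (norm (\<eta> k))\<^sup>2)" and "open V"
    by blast
  have "0 \<in> V" using Basis(2) by (simp add: u cinner_zero_left)
  then obtain r where r: "r > 0" "ball 0 r \<subseteq> V" using \<open>open V\<close> open_contains_ball by blast
  have eq: "(\<Sum>k. cinner (blinfun_apply T (\<xi> k)) (\<eta> k)) = cinner (l2_map T (Abs_l2 \<xi>)) (Abs_l2 \<eta>)" for T
    by (simp add: cinner_l2_eq l2_nth_Abs s)
  have mem: "T \<in> u" if "cmod (cinner (l2_map T (Abs_l2 \<xi>)) (Abs_l2 \<eta>)) < r" for T
    unfolding u using that r(2) by (auto simp: eq)
  obtain h where h: "\<And>T. norm (l2_map T (Abs_l2 \<xi>)) \<le> norm (l2_map T h)"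
      "\<And>T. norm (l2_map T (Abs_l2 \<eta>)) \<le> norm (l2_map T h)"
    using l2_interleave_le[of "Abs_l2 \<xi>" "Abs_l2 \<eta>"] by blast
  \<comment> \<open>The pairing is quadratic in the norm of \<open>l2_map T h\<close>, so scaling h
    by 1 / sqrt r turns the bound r into the normalised condition "below 1".\<close>
  have "S o\<^sub>L T \<in> u" if "is_adjoint T S" "norm (l2_map T ((1 / sqrt r) *\<^sub>R h)) < 1" for T S
  proof (rule mem)
    have "norm (l2_map T h) < sqrt r"
      using that(2) r(1) by (simp add: linear_scale[OF bounded_linear.linear[OF bounded_linear_l2_map]])
    then have "(norm (l2_map T h))\<^sup>2 < (sqrt r)\<^sup>2" by (intro power_strict_mono) auto
    then have lt: "norm (l2_map T h) * norm (l2_map T h) < r" using r(1) by (simp add: power2_eq_square)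
    have "cinner (l2_map (S o\<^sub>L T) (Abs_l2 \<xi>)) (Abs_l2 \<eta>) = cinner (l2_map T (Abs_l2 \<xi>)) (l2_map T (Abs_l2 \<eta>))"
      by (simp add: cinner_l2_eq is_adjointD[OF is_adjoint_sym[OF that(1)]])
    also have "cmod \<dots> \<le> norm (l2_map T h) * norm (l2_map T h)"
      by (intro order_trans[OF cmod_cinner_le] mult_mono h) auto
    finally show "cmod (cinner (l2_map (S o\<^sub>L T) (Abs_l2 \<xi>)) (Abs_l2 \<eta>)) < r" using lt by linarith
  qed
  \<comment> \<open>The summand 1 keeps the denominator positive when \<xi> or \<eta>
    vanishes.\<close>
  moreover have "T \<in> u" if "norm T < r / (norm (Abs_l2 \<xi>) * norm (Abs_l2 \<eta>) + 1)" for T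
  proof (rule mem)
    have "cmod (cinner (l2_map T (Abs_l2 \<xi>)) (Abs_l2 \<eta>)) \<le> (norm T * norm (Abs_l2 \<xi>)) * norm (Abs_l2 \<eta>)"
      by (intro order_trans[OF cmod_cinner_le] mult_right_mono norm_l2_map_le) auto
    also have "\<dots> \<le> norm T * (norm (Abs_l2 \<xi>) * norm (Abs_l2 \<eta>) + 1)"
      by (simp add: algebra_simps)
    also have "\<dots> < r" using that by (simp add: field_simps add_pos_nonneg add_nonneg_pos)
    finally show "cmod (cinner (l2_map T (Abs_l2 \<xi>)) (Abs_l2 \<eta>)) < r" .
  qed
  moreover have "r / (norm (Abs_l2 \<xi>) * norm (Abs_l2 \<eta>) + 1) > 0"
    using r(1) by (simp add: add_nonneg_pos)
  ultimately show ?case by meson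
qed simp

lemma topspace_ultraweak: "topspace ultraweak_topology = (UNIV :: 'h::complex_hilbert_space op set)"
proof -
  define B :: "'h op set set" where
    "B = {{T. (\<Sum>k. cinner (blinfun_apply T (\<xi> k)) (\<eta> k)) \<in> U} | \<xi> \<eta> U.
        summable (\<lambda>k::nat. (norm (\<xi> k))\<^sup>2) \<and> summable (\<lambda>k. (norm (\<eta> k))\<^sup>2) \<and> open U}"
  have "\<exists>\<xi> \<eta> U. (UNIV :: 'h op set) = {T. (\<Sum>k. cinner (blinfun_apply T (\<xi> k)) (\<eta> k)) \<in> U} \<and>
        summable (\<lambda>k::nat. (norm (\<xi> k))\<^sup>2) \<and> summable (\<lambda>k. (norm (\<eta> k))\<^sup>2) \<and> open U"
    by (rule exI[of _ "\<lambda>_. 0"], rule exI[of _ "\<lambda>_. 0"], rule exI[of _ UNIV]) simp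
  then have "UNIV \<in> B" unfolding B_def by (rule CollectI)
  then have "UNIV \<subseteq> \<Union>B" by (rule Union_upper)
  then have "\<Union>B = UNIV" by (rule top.extremum_uniqueI)
  then show ?thesis unfolding ultraweak_topology_def B_def[symmetric] topology_generated_by_topspace .
qed

text \<open>Continuity of the trace at 0, read through the two kinds of neighbourhoods: the first
  will make 2-norms small, the second gives boundedness in operator norm.\<close>

lemma normal_trace_nhd:
  fixes M :: "'h::complex_hilbert_space op set"
  assumes "normalized_faithful_normal_trace M \<tau>" "0 \<in> M" "e > 0"
  shows "\<exists>\<zeta>. \<forall>T S. is_adjoint T S \<and> S o\<^sub>L T \<in> M \<and> norm (l2_map T \<zeta>) < 1 \<longrightarrow> cmod (\<tau> (S o\<^sub>L T)) < e"
    and "\<exists>r>0. \<forall>T\<in>M. norm T < r \<longrightarrow> cmod (\<tau> T) < e"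
proof -
  have cont: "continuous_map (subtopology ultraweak_topology M) euclidean \<tau>"
    and sc: "\<forall>c. \<forall>T\<in>M. \<tau> (c *\<^sub>O T) = c * \<tau> T"
    using assms(1) unfolding normalized_faithful_normal_trace_def by - (elim conjE, assumption)+
  have "\<tau> 0 = 0" using sc[rule_format, OF assms(2), of 0] by (simp add: op_scaleC_zero)
  have "openin (subtopology ultraweak_topology M) {T \<in> M. \<tau> T \<in> ball 0 e}"
    using openin_continuous_map_preimage[OF cont, of "ball 0 e"] by (simp add: topspace_ultraweak)
  then obtain U where U: "openin ultraweak_topology U" "{T \<in> M. \<tau> T \<in> ball 0 e} = U \<inter> M"
    unfolding openin_subtopology by blast
  have "0 \<in> {T \<in> M. \<tau> T \<in> ball 0 e}" using assms(2,3) \<open>\<tau> 0 = 0\<close> by simp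
  then have "0 \<in> U" unfolding U(2) by blast
  then obtain \<zeta> r where nhd: "\<And>T S. is_adjoint T S \<Longrightarrow> norm (l2_map T \<zeta>) < 1 \<Longrightarrow> S o\<^sub>L T \<in> U"
      "r > 0" "\<And>T. norm T < r \<Longrightarrow> T \<in> U"
    using ultraweak_nhd_zero[OF U(1)] by blast
  have mem: "cmod (\<tau> T) < e" if "T \<in> U" "T \<in> M" for T
  proof -
    have "T \<in> {T \<in> M. \<tau> T \<in> ball 0 e}" using that unfolding U(2) by blast
    then show ?thesis by simp
  qed
  show "\<exists>\<zeta>. \<forall>T S. is_adjoint T S \<and> S o\<^sub>L T \<in> M \<and> norm (l2_map T \<zeta>) < 1 \<longrightarrow> cmod (\<tau> (S o\<^sub>L T)) < e"
    using nhd(1) mem by (intro exI[of _ \<zeta>] allI impI) simp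
  show "\<exists>r>0. \<forall>T\<in>M. norm T < r \<longrightarrow> cmod (\<tau> T) < e"
    using nhd(2,3) mem by (intro exI[of _ r]) simp
qed

lemma id_in_commutant: "id_blinfun \<in> commutant X"
  by (simp add: commutant_def bounded_ops_def)

lemma commutant_closed:
  assumes "S \<in> commutant X" "T \<in> commutant X" "X \<subseteq> bounded_ops"
  shows "S + T \<in> commutant X" "S o\<^sub>L T \<in> commutant X" "c *\<^sub>O T \<in> commutant X"
proof -
  show "S + T \<in> commutant X"
    using assms by (auto simp: commutant_def bounded_ops_def blinfun.add_left scaleC_add_right compose_simps)
  have "S o\<^sub>L (T o\<^sub>L U) = U o\<^sub>L (S o\<^sub>L T)" if "U \<in> X" for U
  proof -
    have "S o\<^sub>L (T o\<^sub>L U) = S o\<^sub>L (U o\<^sub>L T)" using assms that by (simp add: commutant_def)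
    also have "\<dots> = (S o\<^sub>L U) o\<^sub>L T" by (simp only: blinfun_compose_assoc)
    also have "\<dots> = U o\<^sub>L (S o\<^sub>L T)" using assms that by (simp add: commutant_def blinfun_compose_assoc)
    finally show ?thesis .
  qed
  then show "S o\<^sub>L T \<in> commutant X"
    using assms by (auto simp: commutant_def bounded_ops_def blinfun_compose_assoc)
  show "c *\<^sub>O T \<in> commutant X"
    using assms by (auto simp: commutant_def bounded_ops_def scaleC_scaleC mult.commute
        blinfun_compose_scaleC_left blinfun_compose_scaleC_right)
qed

text \<open>The algebra operations stay in M because M is a commutant. The trace is below 1 on some
  norm ball of radius r, and scaling T to norm r / 2 gives the constant 2 / r.\<close>

lemma tracial_algebra_von_neumann:
  fixes M :: "'h::complex_hilbert_space op set"
  assumes vN: "von_neumann_algebra M" and tr: "normalized_faithful_normal_trace M \<tau>"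
  shows "tracial_algebra M \<tau>"
proof -
  have M: "commutant (commutant M) = M" using vN by (simp add: von_neumann_algebra_def)
  have cb: "commutant M \<subseteq> bounded_ops" by (auto simp: commutant_def)
  note cl = commutant_closed[OF _ _ cb, unfolded M]
  have id: "id_blinfun \<in> M" using id_in_commutant[of "commutant M"] by (simp add: M)
  have tr_add: "\<forall>S\<in>M. \<forall>T\<in>M. \<tau> (S + T) = \<tau> S + \<tau> T"
    and tr_comm: "\<forall>S\<in>M. \<forall>T\<in>M. \<tau> (S o\<^sub>L T) = \<tau> (T o\<^sub>L S)"
    and tr_scaleC: "\<forall>c. \<forall>T\<in>M. \<tau> (c *\<^sub>O T) = c * \<tau> T"
    and tr_id: "\<tau> id_blinfun = 1"
    and tr_pos: "\<forall>T\<in>M. \<forall>S\<in>M. is_adjoint T S \<longrightarrow> \<tau> (S o\<^sub>L T) \<in> \<real>\<^sub>\<ge>\<^sub>0"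
    using tr unfolding normalized_faithful_normal_trace_def by - (elim conjE, assumption)+
  note tr_sc = tr_scaleC[rule_format]
  have adj: "\<forall>T\<in>M. \<exists>S\<in>M. is_adjoint T S"
    using vN unfolding von_neumann_algebra_def by (elim conjE)
  have "0 *\<^sub>O id_blinfun = (0 :: 'h op)" by (rule blinfun_eqI) (simp add: scaleC_zero_left)
  then have "0 \<in> M" using cl(3)[OF id id, of 0] by simp
  then obtain r where r: "r > 0" "\<And>T. T \<in> M \<Longrightarrow> norm T < r \<Longrightarrow> cmod (\<tau> T) < 1"
    using normal_trace_nhd(2)[OF tr, of 1] by auto
  have bdd: "cmod (\<tau> T) \<le> (2 / r) * norm T" if "T \<in> M" for T
  proof (cases "T = 0")
    case True
    then show ?thesis using tr_sc[OF \<open>0 \<in> M\<close>, of 0] by (simp add: op_scaleC_zero)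
  next
    case False
    define c where "c = r / (2 * norm T)"
    have c: "c > 0" using False r(1) by (simp add: c_def)
    have "complex_of_real c *\<^sub>O T \<in> M" using cl(3)[OF that that] .
    moreover have "norm (complex_of_real c *\<^sub>O T) < r"
    proof -
      have "c * norm T = r / 2" using False by (simp add: c_def)
      then show ?thesis using c r(1) by (simp add: norm_op_scaleC)
    qed
    ultimately have "cmod (\<tau> (complex_of_real c *\<^sub>O T)) < 1" by (rule r(2))
    then have "c * cmod (\<tau> T) < 1" using c by (simp add: tr_sc[OF that] norm_mult)
    then show ?thesis using False r(1) by (simp add: c_def field_simps)
  qed
  show ?thesis
  proof
    show "\<exists>C. \<forall>T\<in>M. cmod (\<tau> T) \<le> C * norm T" using bdd by blast
    show "0 \<le> Re (\<tau> (S o\<^sub>L T))" if "T \<in> M" "S \<in> M" "is_adjoint T S" for S T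
      using tr_pos[rule_format, OF that] by (simp add: complex_nonneg_Reals_iff)
  qed (simp_all add: adj id cl tr_add tr_sc tr_id tr_comm)
qed

text \<open>The link between the density theorem and the 2-norm: one vector \<zeta> detects
  smallness of \<open>n2\<close> on all of M, and \<open>double_commutant_dense\<close> approximates
  on precisely such a vector.\<close>

lemma normal_trace_n2_small:
  fixes M :: "'h::complex_hilbert_space op set"
  assumes vN: "von_neumann_algebra M" and tr: "normalized_faithful_normal_trace M \<tau>" and "e > 0"
  shows "\<exists>\<zeta>. \<forall>T\<in>M. norm (l2_map T \<zeta>) < 1 \<longrightarrow> tracial_algebra.n2 \<tau> T < e"
proof -
  interpret tracial_algebra M \<tau> by (rule tracial_algebra_von_neumann[OF vN tr])
  obtain \<zeta> where \<zeta>: "\<And>T S. is_adjoint T S \<Longrightarrow> S o\<^sub>L T \<in> M \<Longrightarrow> norm (l2_map T \<zeta>) < 1 \<Longrightarrow> cmod (\<tau> (S o\<^sub>L T)) < e\<^sup>2"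
    using normal_trace_nhd(1)[OF tr zero_in zero_less_power[OF \<open>e > 0\<close>]] by blast
  have "n2 T < e" if "T \<in> M" "norm (l2_map T \<zeta>) < 1" for T
  proof (rule power2_less_imp_less)
    have "Re (\<tau> (star T o\<^sub>L T)) \<le> cmod (\<tau> (star T o\<^sub>L T))" by (rule complex_Re_le_cmod)
    also have "\<dots> < e\<^sup>2" using that by (intro \<zeta> is_adjoint_star compose_in star_in)
    finally show "(n2 T)\<^sup>2 < e\<^sup>2" by (simp add: n2_sq that)
  qed (use \<open>e > 0\<close> in simp)
  then show ?thesis by (intro exI[of _ \<zeta>]) simp
qed

section \<open>Kaplansky density with a polynomial cut-off\<close>

text \<open>The cut-off of Kaplansky's theorem is \<open>c \<mapsto> 2 c (1 + c\<^sup>2)\<^sup>-\<^sup>1\<close>. With \<open>e = (K\<^sup>2 - c\<^sup>2) / (1 + K\<^sup>2)\<close> one has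
  \<open>1 + c\<^sup>2 = (1 + K\<^sup>2) (1 - e)\<close>, so truncating the Neumann series of the inverse gives a polynomial,
  uniformly good for all self-adjoint \<open>c\<close> of norm at most \<open>K\<close>.\<close>

definition cutoff_res :: "real \<Rightarrow> 'h::complex_hilbert_space op \<Rightarrow> 'h op" where
  "cutoff_res K c = (1 / (1 + K\<^sup>2)) *\<^sub>R (K\<^sup>2 *\<^sub>R id_blinfun - (c o\<^sub>L c))"

definition op_pow :: "'h::complex_hilbert_space op \<Rightarrow> nat \<Rightarrow> 'h op" where
  "op_pow T l = ((\<lambda>S. T o\<^sub>L S) ^^ l) id_blinfun"

definition cutoff_inv :: "nat \<Rightarrow> real \<Rightarrow> 'h::complex_hilbert_space op \<Rightarrow> 'h op" where
  "cutoff_inv N K c = (1 / (1 + K\<^sup>2)) *\<^sub>R (\<Sum>l<N. op_pow (cutoff_res K c) l)"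

definition cutoff :: "nat \<Rightarrow> real \<Rightarrow> 'h::complex_hilbert_space op \<Rightarrow> 'h op" where
  "cutoff N K c = 2 *\<^sub>R (c o\<^sub>L cutoff_inv N K c)"

lemma op_pow_simps [simp]:
  "op_pow T 0 = id_blinfun" "op_pow T (Suc l) = T o\<^sub>L op_pow T l"
  by (simp_all add: op_pow_def)

lemma op_pow_commute: "T o\<^sub>L S = S o\<^sub>L T \<Longrightarrow> op_pow T l o\<^sub>L S = S o\<^sub>L op_pow T l"
proof (induction l)
  case (Suc l)
  have "op_pow T (Suc l) o\<^sub>L S = (T o\<^sub>L S) o\<^sub>L op_pow T l"
    by (simp only: op_pow_simps blinfun_compose_assoc Suc.IH[OF Suc.prems])
  also have "\<dots> = S o\<^sub>L op_pow T (Suc l)" by (simp only: Suc.prems blinfun_compose_assoc op_pow_simps)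
  finally show ?case .
qed simp

lemma norm_op_pow_le:
  fixes T :: "'h::complex_hilbert_space op"
  assumes "norm T \<le> t" shows "norm (op_pow T l) \<le> t ^ l"
proof (induction l)
  case 0
  show ?case by (simp add: norm_blinfun_id_le)
next
  case (Suc l)
  have "norm (T o\<^sub>L op_pow T l) \<le> norm T * norm (op_pow T l)" by (rule norm_blinfun_compose)
  also have "\<dots> \<le> t * t ^ l" using assms Suc order_trans[OF norm_ge_zero assms] by (intro mult_mono) auto
  finally show ?case by simp
qed

lemma cutoff_res_commute: "cutoff_res K c o\<^sub>L c = c o\<^sub>L cutoff_res K c"
  unfolding cutoff_res_def by (rule blinfun_eqI) (simp add: blinfun.diff_left blinfun.scaleR_left blinfun.diff_right blinfun.scaleR_right)

lemma sum_op_pow_commute: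
  assumes "T o\<^sub>L S = S o\<^sub>L T"
  shows "(\<Sum>l<N. op_pow T l) o\<^sub>L S = S o\<^sub>L (\<Sum>l<N. op_pow T l)"
  by (simp only: bounded_bilinear.sum_left[OF bounded_bilinear_blinfun_compose]
      bounded_bilinear.sum_right[OF bounded_bilinear_blinfun_compose] op_pow_commute[OF assms])

lemma cutoff_inv_commute: "cutoff_inv N K c o\<^sub>L c = c o\<^sub>L cutoff_inv N K c"
  unfolding cutoff_inv_def
  by (simp only: compose_simps sum_op_pow_commute[OF cutoff_res_commute])

lemma cutoff_inv_eq:
  "cutoff_inv N K c + (c o\<^sub>L (c o\<^sub>L cutoff_inv N K c)) = id_blinfun - op_pow (cutoff_res K c) N"
proof -
  define s where "s = 1 + K\<^sup>2"
  have s: "s > 0" unfolding s_def by (simp add: add_pos_nonneg)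
  define e where "e = cutoff_res K c"
  have cc: "(c o\<^sub>L c) = K\<^sup>2 *\<^sub>R id_blinfun - s *\<^sub>R e"
    using s by (simp add: e_def cutoff_res_def s_def)
  have tel: "(\<Sum>l<N. op_pow e l) - (e o\<^sub>L (\<Sum>l<N. op_pow e l)) = id_blinfun - op_pow e N"
  proof (induction N)
    case (Suc N)
    have "(\<Sum>l<Suc N. op_pow e l) - (e o\<^sub>L (\<Sum>l<Suc N. op_pow e l)) =
        ((\<Sum>l<N. op_pow e l) - (e o\<^sub>L (\<Sum>l<N. op_pow e l))) + (op_pow e N - op_pow e (Suc N))"
      by (simp add: compose_simps)
    then show ?case by (simp only: Suc) simp
  qed (simp add: compose_simps)
  let ?S = "\<Sum>l<N. op_pow e l"
  have "?S + ((c o\<^sub>L c) o\<^sub>L ?S) = s *\<^sub>R (?S - (e o\<^sub>L ?S))"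
    unfolding cc by (simp add: compose_simps s_def algebra_simps)
  then have "(1/s) *\<^sub>R (?S + ((c o\<^sub>L c) o\<^sub>L ?S)) = id_blinfun - op_pow e N"
    using s tel by simp
  then show ?thesis
    unfolding cutoff_inv_def e_def[symmetric] s_def[symmetric] compose_simps
    by (simp only: scaleR_add_right blinfun_compose_assoc)
qed

text \<open>Spectrally, c^2 has values in [0, K^2]. The elementary form: in the expansion of norm
  (K^2 v - c^2 v)^2 the last term is at most half of the negative cross term, because norm (c^2 v)
  is at most K norm (c v).\<close>

lemma cutoff_res_norm:
  fixes c :: "'h::complex_hilbert_space op"
  assumes c: "self_adjoint c" "norm c \<le> K"
  shows "norm (cutoff_res K c) \<le> K\<^sup>2 / (1 + K\<^sup>2)"
proof (rule norm_blinfun_bound)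
  have s: "1 + K\<^sup>2 > 0" by (simp add: add_pos_nonneg)
  show "0 \<le> K\<^sup>2 / (1 + K\<^sup>2)" by simp
  fix v
  let ?u = "blinfun_apply c v" and ?w = "blinfun_apply c (blinfun_apply c v)"
  have K: "norm (blinfun_apply c x) \<le> K * norm x" for x
    using order_trans[OF norm_blinfun mult_right_mono[OF c(2) norm_ge_zero]] .
  have K0: "0 \<le> K" using c(2) norm_ge_zero order_trans by blast
  have in1: "inner v ?w = (norm ?u)\<^sup>2"
    using is_adjointD[OF c(1)[unfolded self_adjoint_def], of v ?u]
    by (metis Re_cinner power2_norm_eq_inner)
  have "(norm (K\<^sup>2 *\<^sub>R v - ?w))\<^sup>2 = K\<^sup>2 * K\<^sup>2 * (norm v)\<^sup>2 - 2 * K\<^sup>2 * (norm ?u)\<^sup>2 + (norm ?w)\<^sup>2"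
    by (simp add: power2_norm_eq_inner inner_diff_left inner_diff_right inner_commute[of ?w v] in1 algebra_simps)
  also have "(norm ?w)\<^sup>2 \<le> K\<^sup>2 * (norm ?u)\<^sup>2"
    using power_mono[OF K[of ?u], of 2] by (simp add: power_mult_distrib)
  then have "K\<^sup>2 * K\<^sup>2 * (norm v)\<^sup>2 - 2 * K\<^sup>2 * (norm ?u)\<^sup>2 + (norm ?w)\<^sup>2 \<le> K\<^sup>2 * K\<^sup>2 * (norm v)\<^sup>2"
    using mult_nonneg_nonneg[OF zero_le_power2[of K] zero_le_power2[of "norm ?u"]] by linarith
  finally have "(norm (K\<^sup>2 *\<^sub>R v - ?w))\<^sup>2 \<le> (K\<^sup>2 * norm v)\<^sup>2"
    by (simp add: power2_eq_square[of "_ * norm v"] power2_eq_square[of "norm v"] algebra_simps)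
  then have "norm (K\<^sup>2 *\<^sub>R v - ?w) \<le> K\<^sup>2 * norm v" by (rule power2_le_imp_le) simp
  then have "(1 / (1 + K\<^sup>2)) * norm (K\<^sup>2 *\<^sub>R v - ?w) \<le> (1 / (1 + K\<^sup>2)) * (K\<^sup>2 * norm v)"
    using s by (intro mult_left_mono) auto
  then show "norm (blinfun_apply (cutoff_res K c) v) \<le> K\<^sup>2 / (1 + K\<^sup>2) * norm v"
    using s by (simp add: cutoff_res_def blinfun.scaleR_left blinfun.diff_left)
qed

text \<open>These say that (1 + c^2)^-1 and 2 c (1 + c^2)^-1 have norm at most 1. Without the
  inverse they apply equally to its truncated series. All terms in the expansion of the squared
  right-hand side are nonnegative.\<close>

lemma one_plus_square_lower:
  fixes c :: "'h::complex_hilbert_space op"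
  assumes "self_adjoint c"
  shows "norm u \<le> norm (u + blinfun_apply c (blinfun_apply c u))"
    and "norm (2 *\<^sub>R blinfun_apply c u) \<le> norm (u + blinfun_apply c (blinfun_apply c u))"
proof -
  let ?v = "blinfun_apply c u" and ?w = "blinfun_apply c (blinfun_apply c u)"
  have in1: "inner u ?w = (norm ?v)\<^sup>2"
    using is_adjointD[OF assms[unfolded self_adjoint_def], of u ?v]
    by (metis Re_cinner power2_norm_eq_inner)
  have eq: "(norm (u + ?w))\<^sup>2 = (norm u)\<^sup>2 + 2 * (norm ?v)\<^sup>2 + (norm ?w)\<^sup>2"
    by (simp add: power2_norm_eq_inner inner_add_left inner_add_right inner_commute[of ?w u] in1)
  show "norm u \<le> norm (u + ?w)"
    by (rule power2_le_imp_le) (simp_all add: eq)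
  have "(norm ?v)\<^sup>2 \<le> norm u * norm ?w"
    unfolding in1[symmetric] by (rule norm_cauchy_schwarz)
  also have "2 * (norm u * norm ?w) \<le> (norm u)\<^sup>2 + (norm ?w)\<^sup>2"
    using sum_squares_bound[of "norm u" "norm ?w"] by simp
  finally have "(norm (2 *\<^sub>R ?v))\<^sup>2 \<le> (norm (u + ?w))\<^sup>2"
    unfolding eq by (simp add: power_mult_distrib)
  then show "norm (2 *\<^sub>R ?v) \<le> norm (u + ?w)" by (rule power2_le_imp_le) simp
qed

text \<open>The excess over 1 is the error of the truncated Neumann series. It tends to 0 with N, so
  any room between b and \<rho> can absorb it after scaling by b.\<close>

lemma cutoff_norm:
  fixes c :: "'h::complex_hilbert_space op"
  assumes c: "self_adjoint c" "norm c \<le> K"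
  shows "norm (cutoff_inv N K c) \<le> 1 + (K\<^sup>2 / (1 + K\<^sup>2)) ^ N"
    and "norm (cutoff N K c) \<le> 1 + (K\<^sup>2 / (1 + K\<^sup>2)) ^ N"
proof -
  let ?t = "(K\<^sup>2 / (1 + K\<^sup>2)) ^ N"
  have t: "0 \<le> 1 + ?t" by simp
  have bd: "norm (blinfun_apply (id_blinfun - op_pow (cutoff_res K c) N) v) \<le> (1 + ?t) * norm v" for v
  proof -
    have "norm (blinfun_apply (op_pow (cutoff_res K c) N) v) \<le> ?t * norm v"
      by (rule order_trans[OF norm_blinfun mult_right_mono[OF norm_op_pow_le[OF cutoff_res_norm[OF c]] norm_ge_zero]])
    then show ?thesis
      using norm_triangle_ineq4[of v "blinfun_apply (op_pow (cutoff_res K c) N) v"]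
      by (simp add: blinfun.diff_left distrib_right)
  qed
  have eq: "blinfun_apply (cutoff_inv N K c) v + blinfun_apply c (blinfun_apply c (blinfun_apply (cutoff_inv N K c) v))
      = blinfun_apply (id_blinfun - op_pow (cutoff_res K c) N) v" for v
    unfolding cutoff_inv_eq[symmetric] by (simp add: blinfun.add_left)
  note low = one_plus_square_lower[OF c(1), of "blinfun_apply (cutoff_inv N K c) _", unfolded eq]
  show "norm (cutoff_inv N K c) \<le> 1 + ?t"
    by (rule norm_blinfun_bound[OF t order_trans[OF low(1) bd]])
  show "norm (cutoff N K c) \<le> 1 + ?t"
  proof (rule norm_blinfun_bound[OF t])
    fix v show "norm (blinfun_apply (cutoff N K c) v) \<le> (1 + ?t) * norm v"
      using order_trans[OF low(2) bd, of v] by (simp add: cutoff_def blinfun.scaleR_left)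
  qed
qed

lemma is_adjoint_scaleR: "is_adjoint T S \<Longrightarrow> is_adjoint (r *\<^sub>R T) (r *\<^sub>R S)"
  using is_adjoint_scaleC[of T S "complex_of_real r"] by (simp add: op_scaleR)

lemma is_adjoint_sum: "(\<And>i. i \<in> I \<Longrightarrow> is_adjoint (f i) (g i)) \<Longrightarrow> is_adjoint (sum f I) (sum g I)"
  by (induction I rule: infinite_finite_induct) (auto simp: is_adjoint_0 is_adjoint_add)

lemma self_adjoint_cutoff:
  assumes "self_adjoint c"
  shows "self_adjoint (cutoff N K c)"
proof -
  let ?e = "cutoff_res K c"
  have c: "is_adjoint c c" using assms by (simp add: self_adjoint_def)
  have e: "is_adjoint ?e ?e"
    unfolding cutoff_res_def by (intro is_adjoint_scaleR is_adjoint_diff is_adjoint_compose is_adjoint_id c)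
  have pow: "is_adjoint (op_pow ?e l) (op_pow ?e l)" for l
  proof (induction l)
    case (Suc l)
    from is_adjoint_compose[OF e Suc] show ?case
      using op_pow_commute[of ?e ?e l] by simp
  qed (simp add: is_adjoint_id)
  have "is_adjoint (cutoff_inv N K c) (cutoff_inv N K c)"
    unfolding cutoff_inv_def by (intro is_adjoint_scaleR is_adjoint_sum pow)
  from is_adjoint_compose[OF c this]
  have "is_adjoint (c o\<^sub>L cutoff_inv N K c) (c o\<^sub>L cutoff_inv N K c)"
    by (simp only: cutoff_inv_commute)
  then show ?thesis unfolding self_adjoint_def cutoff_def by (rule is_adjoint_scaleR)
qed

text \<open>Here \<open>y = 2 h (1 + h\<^sup>2)\<^sup>-\<^sup>1\<close> is the cut-off of \<open>h\<close>.\<close>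

lemma (in tracial_algebra) cutoff_n2:
  assumes N: "c \<in> N" "h \<in> N" "y \<in> N" and c: "self_adjoint c" "norm c \<le> K"
    and h: "norm h \<le> r" "r < 1" and y: "y + ((y o\<^sub>L h) o\<^sub>L h) = 2 *\<^sub>R h"
    and t: "t = (K\<^sup>2 / (1 + K\<^sup>2)) ^ L"
  shows "cutoff L K c \<in> N" and "n2 (cutoff L K c - y) \<le> (6 * n2 (c - h) + 2 * t) / (1 - r\<^sup>2)"
proof -
  define e where "e = op_pow (cutoff_res K c) L"
  define g where "g = cutoff_inv L K c"
  have res_in: "cutoff_res K c \<in> N"
    unfolding cutoff_res_def by (intro scaleR_in diff_in id_in compose_in N)
  have pow_in: "op_pow (cutoff_res K c) l \<in> N" for l
    by (induction l) (auto intro: id_in compose_in res_in)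
  have g_in: "g \<in> N" unfolding g_def cutoff_inv_def by (intro scaleR_in sum_in pow_in)
  have e_in: "e \<in> N" unfolding e_def by (rule pow_in)
  show T0: "cutoff L K c \<in> N"
    unfolding cutoff_def g_def[symmetric] by (intro scaleR_in compose_in N g_in)
  have gc: "g o\<^sub>L c = c o\<^sub>L g" unfolding g_def by (rule cutoff_inv_commute)
  have K0: "K\<^sup>2 / (1 + K\<^sup>2) \<le> 1" by (simp add: add_pos_nonneg)
  have t01: "0 \<le> t" "t \<le> 1" unfolding t using K0 by (auto intro: power_le_one)
  have ng: "norm g \<le> 2" "norm (cutoff L K c) \<le> 2" and ne: "norm e \<le> t"
    using cutoff_norm[OF c, of L] t01 norm_op_pow_le[OF cutoff_res_norm[OF c], of L] unfolding g_def e_def t by auto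
  have r0: "0 \<le> r" using h(1) norm_ge_zero order_trans by blast
  define T where "T = cutoff L K c - y"
  have T_in: "T \<in> N" unfolding T_def using T0 N by (rule_tac diff_in)
  \<comment> \<open>Multiplying 1 = g + g c^2 + e by h rewrites 2 h, the right-hand side of the
    equation for y, in terms comparable with the cut-off of c.\<close>
  have one: "(g o\<^sub>L h) + ((g o\<^sub>L c) o\<^sub>L (c o\<^sub>L h)) + (e o\<^sub>L h) = h"
  proof -
    have "g + ((g o\<^sub>L c) o\<^sub>L c) + e = id_blinfun"
      using cutoff_inv_eq[of L K c] unfolding g_def[symmetric] e_def[symmetric]
      by (simp add: gc blinfun_compose_assoc)
    then have "(g + ((g o\<^sub>L c) o\<^sub>L c) + e) o\<^sub>L h = h" by simp
    then show ?thesis by (simp add: compose_simps blinfun_compose_assoc)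
  qed
  have kap: "cutoff L K c = 2 *\<^sub>R (g o\<^sub>L c)" by (simp add: cutoff_def g_def cutoff_inv_commute)
  \<comment> \<open>A resolvent identity without inverses: the first two terms carry the factor c -
    h, the last one is the truncation error.\<close>
  have D: "T + ((T o\<^sub>L h) o\<^sub>L h) =
      2 *\<^sub>R (g o\<^sub>L (c - h)) - (cutoff L K c o\<^sub>L ((c - h) o\<^sub>L h)) - 2 *\<^sub>R (e o\<^sub>L h)"
  proof -
    have "T + ((T o\<^sub>L h) o\<^sub>L h) = cutoff L K c + ((cutoff L K c o\<^sub>L h) o\<^sub>L h) - (y + ((y o\<^sub>L h) o\<^sub>L h))"
      by (simp add: T_def compose_simps)
    also have "\<dots> = cutoff L K c + ((cutoff L K c o\<^sub>L h) o\<^sub>L h)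
        - 2 *\<^sub>R ((g o\<^sub>L h) + ((g o\<^sub>L c) o\<^sub>L (c o\<^sub>L h)) + (e o\<^sub>L h))"
      unfolding y one ..
    also have "\<dots> = 2 *\<^sub>R (g o\<^sub>L (c - h)) - (cutoff L K c o\<^sub>L ((c - h) o\<^sub>L h)) - 2 *\<^sub>R (e o\<^sub>L h)"
      unfolding kap by (simp add: compose_simps blinfun_compose_assoc scaleR_add_right scaleR_diff_right)
    finally show ?thesis .
  qed
  have d_in: "c - h \<in> N" by (intro diff_in N)
  have d0: "0 \<le> n2 (c - h)" by (rule n2_nonneg[OF d_in])
  have b1: "n2 (2 *\<^sub>R (g o\<^sub>L (c - h))) \<le> 4 * n2 (c - h)"
    using order_trans[OF n2_compose_left[OF g_in d_in] mult_right_mono[OF ng(1) d0]]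
    by (simp add: n2_scaleR compose_in g_in d_in)
  have b2: "n2 (cutoff L K c o\<^sub>L ((c - h) o\<^sub>L h)) \<le> 2 * n2 (c - h)"
  proof -
    have "n2 ((c - h) o\<^sub>L h) \<le> n2 (c - h) * norm h" by (rule n2_compose_right[OF N(2) d_in])
    also have "\<dots> \<le> n2 (c - h) * 1" using h d0 by (intro mult_left_mono) auto
    finally have "norm (cutoff L K c) * n2 ((c - h) o\<^sub>L h) \<le> 2 * n2 (c - h)"
      using ng(2) by (intro mult_mono) (auto intro: n2_nonneg compose_in d_in N)
    then show ?thesis by (rule order_trans[OF n2_compose_left[OF T0 compose_in[OF d_in N(2)]]])
  qed
  have b3: "n2 (2 *\<^sub>R (e o\<^sub>L h)) \<le> 2 * t"
  proof -
    have "n2 (e o\<^sub>L h) \<le> norm (e o\<^sub>L h)" by (intro n2_le_norm compose_in e_in N)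
    also have "\<dots> \<le> norm e * norm h" by (rule norm_blinfun_compose)
    also have "\<dots> \<le> t * 1" using ne h t01 by (intro mult_mono) auto
    finally show ?thesis by (simp add: n2_scaleR compose_in e_in N)
  qed
  have "n2 (T + ((T o\<^sub>L h) o\<^sub>L h)) \<le> n2 (2 *\<^sub>R (g o\<^sub>L (c - h))) + n2 (cutoff L K c o\<^sub>L ((c - h) o\<^sub>L h)) + n2 (2 *\<^sub>R (e o\<^sub>L h))"
    unfolding D by (intro order_trans[OF n2_triangle_diff] add_right_mono n2_triangle_diff
        diff_in scaleR_in compose_in g_in e_in N T0)
  with b1 b2 b3 have bD: "n2 (T + ((T o\<^sub>L h) o\<^sub>L h)) \<le> 6 * n2 (c - h) + 2 * t" by linarith
  \<comment> \<open>Since norm h \<le> r < 1, right multiplication by h^2 contracts the 2-norm. So T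
    is controlled by T + T h^2, which is the origin of the factor 1 / (1 - r^2).\<close>
  have Thh: "n2 ((T o\<^sub>L h) o\<^sub>L h) \<le> n2 T * r\<^sup>2"
  proof -
    have "n2 ((T o\<^sub>L h) o\<^sub>L h) \<le> n2 (T o\<^sub>L h) * norm h" by (intro n2_compose_right compose_in T_in N)
    also have "\<dots> \<le> (n2 T * norm h) * norm h" by (intro mult_right_mono n2_compose_right T_in N) simp
    also have "\<dots> \<le> (n2 T * r) * r"
      using h r0 n2_nonneg[OF T_in] by (intro mult_mono mult_nonneg_nonneg) auto
    finally show ?thesis by (simp add: power2_eq_square mult.assoc)
  qed
  have "n2 T \<le> n2 (T + ((T o\<^sub>L h) o\<^sub>L h)) + n2 ((T o\<^sub>L h) o\<^sub>L h)"
    using n2_triangle_diff[OF add_in[OF T_in] , of "(T o\<^sub>L h) o\<^sub>L h" "(T o\<^sub>L h) o\<^sub>L h"]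
    by (simp add: compose_in T_in N)
  with bD Thh have "n2 T * (1 - r\<^sup>2) \<le> 6 * n2 (c - h) + 2 * t" by (simp add: algebra_simps)
  moreover have "0 < 1 - r\<^sup>2" using r0 h(2) power_strict_mono[of r 1 2] by simp
  ultimately show "n2 (cutoff L K c - y) \<le> (6 * n2 (c - h) + 2 * t) / (1 - r\<^sup>2)"
    by (simp add: T_def pos_le_divide_eq)
qed

section \<open>Solving for the preimage of an operator under the cut-off\<close>

lemma bounded_linear_cinner_left: "bounded_linear (\<lambda>x::'h::complex_hilbert_space. cinner x y)"
proof (rule bounded_linear_intro[where K = "norm y"])
  fix x z :: 'h and r
  show "cinner (x + z) y = cinner x y + cinner z y" by (rule cinner_add_left)
  show "cinner (r *\<^sub>R x) y = r *\<^sub>R cinner x y"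
    by (simp only: scaleC_of_real[symmetric, of r x] cinner_scaleC_left scaleR_conv_of_real)
  show "norm (cinner x y) \<le> norm x * norm y" by (rule cmod_cinner_le)
qed

lemma closed_self_adjoint: "closed {T :: 'h::complex_hilbert_space op. self_adjoint T}"
proof -
  have 1: "continuous_on UNIV (\<lambda>T::'h op. cinner (blinfun_apply T u) v)" for u v
    by (intro linear_continuous_on bounded_linear_compose[OF bounded_linear_cinner_left blinfun.bounded_linear_left])
  have 2: "continuous_on UNIV (\<lambda>T::'h op. cinner u (blinfun_apply T v))" for u v
  proof -
    have "(\<lambda>T::'h op. cinner u (blinfun_apply T v)) = (\<lambda>T. cnj (cinner (blinfun_apply T v) u))"
      by (rule ext, rule cinner_commute)
    then show ?thesis using continuous_on_cnj[OF 1[of v u]] by (simp only:)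
  qed
  have "{T :: 'h op. self_adjoint T} = (\<Inter>u. \<Inter>v. {T. cinner (blinfun_apply T u) v = cinner u (blinfun_apply T v)})"
    by (simp only: self_adjoint_def is_adjoint_def) blast
  moreover have "closed (\<Inter>u. \<Inter>v. {T::'h op. cinner (blinfun_apply T u) v = cinner u (blinfun_apply T v)})"
    by (intro closed_INT ballI closed_Collect_eq 1 2)
  ultimately show ?thesis by simp
qed

text \<open>Banach's fixed point theorem for h \<mapsto> (y + y h^2) / 2 replaces the functional
  calculus. The iteration runs among operators commuting with whatever commutes with y, which later
  places h in the double commutant of the generators.\<close>

lemma cutoff_preimage:
  fixes y :: "'h::complex_hilbert_space op"
  assumes y: "self_adjoint y" "norm y \<le> r" and r: "0 \<le> r" "r < 1"
  shows "\<exists>h. self_adjoint h \<and> norm h \<le> r \<and> (\<forall>S. y o\<^sub>L S = S o\<^sub>L y \<longrightarrow> h o\<^sub>L S = S o\<^sub>L h) \<and>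
    y + ((y o\<^sub>L h) o\<^sub>L h) = 2 *\<^sub>R h"
proof -
  define A where "A = {h :: 'h op. self_adjoint h} \<inter> cball 0 r \<inter> (\<Inter>S\<in>{S. y o\<^sub>L S = S o\<^sub>L y}. {h. h o\<^sub>L S = S o\<^sub>L h})"
  define f where "f h = (1/2) *\<^sub>R (y + ((y o\<^sub>L h) o\<^sub>L h))" for h
  have A: "h \<in> A \<longleftrightarrow> self_adjoint h \<and> norm h \<le> r \<and> (\<forall>S. y o\<^sub>L S = S o\<^sub>L y \<longrightarrow> h o\<^sub>L S = S o\<^sub>L h)" for h
    by (simp add: A_def)
  have "closed A"
    unfolding A_def
    by (intro closed_Int closed_self_adjoint closed_cball closed_INT ballI closed_Collect_eq
        linear_continuous_on bounded_bilinear.bounded_linear_left[OF bounded_bilinear_blinfun_compose]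
        bounded_bilinear.bounded_linear_right[OF bounded_bilinear_blinfun_compose])
  then have "complete A" by (simp add: complete_eq_closed)
  moreover have "0 \<in> A" unfolding A using r by (simp add: self_adjoint_def is_adjoint_0 compose_simps)
  then have "A \<noteq> {}" by blast
  moreover have "0 \<le> r\<^sup>2" "r\<^sup>2 < 1" using r power_strict_mono[of r 1 2] by simp_all
  moreover have "f ` A \<subseteq> A"
  proof (rule image_subsetI)
    fix h assume "h \<in> A"
    then have h: "is_adjoint h h" "norm h \<le> r" "\<And>S. y o\<^sub>L S = S o\<^sub>L y \<Longrightarrow> h o\<^sub>L S = S o\<^sub>L h"
      unfolding A self_adjoint_def by blast+
    have yy: "is_adjoint y y" using y(1) by (simp add: self_adjoint_def)
    have hy: "h o\<^sub>L y = y o\<^sub>L h" by (rule h(3)) simp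
    \<comment> \<open>The map preserves self-adjointness because h commutes with y; this is why
      commutation is built into A.\<close>
    have comm: "(y o\<^sub>L h) o\<^sub>L h = h o\<^sub>L (h o\<^sub>L y)" by (simp only: hy[symmetric] blinfun_compose_assoc)
    have "is_adjoint ((y o\<^sub>L h) o\<^sub>L h) ((y o\<^sub>L h) o\<^sub>L h)"
      using is_adjoint_compose[OF is_adjoint_compose[OF yy h(1)] h(1)] by (simp only: comm)
    then have 1: "self_adjoint (f h)"
      unfolding self_adjoint_def f_def by (intro is_adjoint_scaleR is_adjoint_add yy)
    have "norm ((y o\<^sub>L h) o\<^sub>L h) \<le> norm (y o\<^sub>L h) * norm h" by (rule norm_blinfun_compose)
    also have "\<dots> \<le> (norm y * norm h) * norm h" by (intro mult_right_mono norm_blinfun_compose norm_ge_zero)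
    also have "\<dots> \<le> (r * 1) * 1"
      using y h(2) r by (intro mult_mono mult_nonneg_nonneg) auto
    finally have "norm (y + ((y o\<^sub>L h) o\<^sub>L h)) \<le> 2 * r"
      using y(2) norm_triangle_ineq[of y "(y o\<^sub>L h) o\<^sub>L h"] by linarith
    then have 2: "norm (f h) \<le> r" by (simp add: f_def)
    have "f h o\<^sub>L S = S o\<^sub>L f h" if S: "y o\<^sub>L S = S o\<^sub>L y" for S
    proof -
      have hS: "h o\<^sub>L S = S o\<^sub>L h" by (rule h(3)[OF S])
      have "((y o\<^sub>L h) o\<^sub>L h) o\<^sub>L S = (y o\<^sub>L h) o\<^sub>L (S o\<^sub>L h)" by (simp only: blinfun_compose_assoc hS)
      also have "\<dots> = y o\<^sub>L ((h o\<^sub>L S) o\<^sub>L h)" by (simp only: blinfun_compose_assoc)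
      also have "\<dots> = (y o\<^sub>L S) o\<^sub>L (h o\<^sub>L h)" by (simp only: hS blinfun_compose_assoc)
      also have "\<dots> = S o\<^sub>L ((y o\<^sub>L h) o\<^sub>L h)" by (simp only: S blinfun_compose_assoc)
      finally show ?thesis by (simp add: f_def compose_simps S)
    qed
    with 1 2 show "f h \<in> A" unfolding A by blast
  qed
  moreover have "\<forall>h\<in>A. \<forall>h'\<in>A. dist (f h) (f h') \<le> r\<^sup>2 * dist h h'"
  proof (intro ballI)
    fix h h' assume "h \<in> A" "h' \<in> A"
    then have n: "norm h \<le> r" "norm h' \<le> r" unfolding A by blast+
    \<comment> \<open>With h^2 - h'^2 = h (h - h') + (h - h') h' the Lipschitz constant is (1/2) r
      (r + r) = r^2.\<close>
    have "f h - f h' = (1/2) *\<^sub>R (y o\<^sub>L ((h o\<^sub>L (h - h')) + ((h - h') o\<^sub>L h')))"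
      by (simp add: f_def compose_simps blinfun_compose_assoc scaleR_diff_right scaleR_add_right)
    also have "norm \<dots> \<le> (1/2) * (norm y * (norm h * norm (h - h') + norm (h - h') * norm h'))"
      unfolding norm_scaleR
      by (intro mult_mono order_trans[OF norm_blinfun_compose] order_trans[OF norm_triangle_ineq]
          add_mono norm_blinfun_compose) auto
    also have "\<dots> \<le> (1/2) * (r * (r * norm (h - h') + norm (h - h') * r))"
      using n y r by (intro mult_mono add_mono mult_nonneg_nonneg add_nonneg_nonneg) auto
    also have "\<dots> = r\<^sup>2 * norm (h - h')" by (simp add: power2_eq_square)
    finally show "dist (f h) (f h') \<le> r\<^sup>2 * dist h h'" by (simp add: dist_norm)
  qed
  ultimately obtain h where h: "h \<in> A" "f h = h"
    using Banach_fix[of A "r\<^sup>2" f] by blast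
  have "2 *\<^sub>R f h = y + ((y o\<^sub>L h) o\<^sub>L h)" by (simp add: f_def)
  then have "y + ((y o\<^sub>L h) o\<^sub>L h) = 2 *\<^sub>R h" using h(2) by simp
  then show ?thesis using h(1) unfolding A by blast
qed

section \<open>The cut-off as a polynomial expression\<close>

fun nc_pow :: "ncpoly \<Rightarrow> nat \<Rightarrow> ncpoly" where
  "nc_pow p 0 = [(1, [])]"
| "nc_pow p (Suc l) = nc_mult p (nc_pow p l)"

fun nc_geometric :: "ncpoly \<Rightarrow> nat \<Rightarrow> ncpoly" where
  "nc_geometric p 0 = []"
| "nc_geometric p (Suc l) = nc_geometric p l @ nc_pow p l"

text \<open>Follows \<open>cutoff\<close> step by step with polynomials for operators; its
  coefficients depend on K and N but not on the point of evaluation.\<close>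

definition nc_cutoff :: "nat \<Rightarrow> real \<Rightarrow> ncpoly \<Rightarrow> ncpoly" where
  "nc_cutoff N K p = nc_scale 2 (nc_mult p (nc_scale (complex_of_real (1 / (1 + K\<^sup>2)))
     (nc_geometric (nc_scale (complex_of_real (1 / (1 + K\<^sup>2)))
       ((complex_of_real (K\<^sup>2), []) # nc_scale (-1) (nc_mult p p))) N)))"

lemma nc_eval_cutoff:
  assumes x: "\<And>i. i < m \<Longrightarrow> x i \<in> bounded_ops" and p: "nc_vars m p"
  shows "nc_vars m (nc_cutoff N K p)" "nc_eval (nc_cutoff N K p) x = cutoff N K (nc_eval p x)"
proof -
  have pow: "nc_vars m (nc_pow q l)" "nc_eval (nc_pow q l) x = op_pow (nc_eval q x) l" if q: "nc_vars m q" for q l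
    by (induction l) (auto intro: nc_vars_mult q simp: nc_eval_mult[OF x q] op_scaleC_one)
  have geo: "nc_vars m (nc_geometric q l)" "nc_eval (nc_geometric q l) x = (\<Sum>j<l. op_pow (nc_eval q x) j)"
    if q: "nc_vars m q" for q l
    by (induction l) (simp_all add: pow[OF q])
  define e where "e = nc_scale (complex_of_real (1 / (1 + K\<^sup>2)))
       ((complex_of_real (K\<^sup>2), []) # nc_scale (-1) (nc_mult p p))"
  have e: "nc_vars m e" unfolding e_def by (simp add: nc_vars_mult p)
  have ee: "nc_eval e x = cutoff_res K (nc_eval p x)"
    unfolding e_def nc_eval_scale cutoff_res_def
    by (simp only: nc_eval_simps nc_eval_scale nc_eval_mult[OF x p] op_scaleC_minus_one op_word_simps
        op_scaleR[symmetric] add_uminus_conv_diff)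
  show "nc_vars m (nc_cutoff N K p)"
    unfolding nc_cutoff_def e_def[symmetric] by (simp add: nc_vars_mult p geo e)
  show "nc_eval (nc_cutoff N K p) x = cutoff N K (nc_eval p x)"
    unfolding nc_cutoff_def e_def[symmetric] cutoff_def cutoff_inv_def
    by (simp only: nc_eval_scale nc_eval_mult[OF x p] geo e ee op_scaleR of_real_numeral)
qed

text \<open>A weighted l^1 norm of the coefficients. It bounds operator norms at tuples of norm at
  most r; at r = 1 it measures how errors in the moments propagate.\<close>

definition nc_bound :: "ncpoly \<Rightarrow> real \<Rightarrow> real" where
  "nc_bound p r = (\<Sum>(c, w)\<leftarrow>p. cmod c * r ^ length w)"

lemma norm_op_word_le:
  assumes "\<And>i. i < m \<Longrightarrow> norm (x i) \<le> r" "set w \<subseteq> {..<m}"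
  shows "norm (op_word x w) \<le> r ^ length w"
  using assms(2)
proof (induction w)
  case Nil
  show ?case by (simp add: norm_blinfun_id_le)
next
  case (Cons i w)
  then have i: "norm (x i) \<le> r" by (intro assms(1)) auto
  have "norm (x i o\<^sub>L op_word x w) \<le> norm (x i) * norm (op_word x w)" by (rule norm_blinfun_compose)
  also have "\<dots> \<le> r * r ^ length w"
    using Cons i order_trans[OF norm_ge_zero i] by (intro mult_mono) auto
  finally show ?case by simp
qed

lemma norm_nc_eval_le:
  assumes "\<And>i. i < m \<Longrightarrow> norm (x i) \<le> r" "nc_vars m p"
  shows "norm (nc_eval p x) \<le> nc_bound p r"
  using assms(2)
proof (induction p)
  case Nil
  show ?case by (simp add: nc_bound_def)
next
  case (Cons a p)
  obtain c w where a: "a = (c, w)" by (cases a)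
  have "norm (c *\<^sub>O op_word x w) \<le> cmod c * r ^ length w"
    unfolding norm_op_scaleC using Cons.prems a by (intro mult_left_mono norm_op_word_le[OF assms(1)]) auto
  moreover have "norm (nc_eval p x) \<le> nc_bound p r" using Cons a by simp
  ultimately show ?case
    using norm_triangle_ineq[of "c *\<^sub>O op_word x w" "nc_eval p x"] by (simp add: a nc_bound_def)
qed

lemma (in tracial_algebra) nc_eval_in:
  assumes "\<And>i. i < m \<Longrightarrow> x i \<in> N" "nc_vars m p"
  shows "nc_eval p x \<in> N"
proof -
  have w: "op_word x w \<in> N" if "set w \<subseteq> {..<m}" for w
    using that by (induction w) (auto intro: id_in compose_in assms(1))
  show ?thesis
    using assms(2) by (induction p) (auto intro!: zero_in add_in scaleC_in w)
qed

text \<open>The Hermitian part taken at the level of syntax: self-adjointness is required at every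
  self-adjoint tuple, not only at x.\<close>

definition nc_sym :: "ncpoly \<Rightarrow> ncpoly" where
  "nc_sym p = nc_scale (complex_of_real (1/2)) (p @ nc_star p)"

lemma nc_vars_sym [simp]: "nc_vars m (nc_sym p) = nc_vars m p"
  by (simp add: nc_sym_def)

lemma nc_eval_sym: "nc_eval (nc_sym p) x = (1/2) *\<^sub>R (nc_eval p x + nc_eval (nc_star p) x)"
  by (simp only: nc_sym_def nc_eval_scale op_scaleR nc_eval_simps)

lemma self_adjoint_nc_sym:
  assumes "\<And>i. i < m \<Longrightarrow> self_adjoint (x i)" "nc_vars m p"
  shows "self_adjoint (nc_eval (nc_sym p) x)"
proof -
  have a: "is_adjoint (nc_eval p x) (nc_eval (nc_star p) x)" by (rule is_adjoint_nc_eval[OF assms])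
  have "is_adjoint (nc_eval p x + nc_eval (nc_star p) x) (nc_eval (nc_star p) x + nc_eval p x)"
    by (rule is_adjoint_add[OF a is_adjoint_sym[OF a]])
  then have "is_adjoint (nc_eval p x + nc_eval (nc_star p) x) (nc_eval p x + nc_eval (nc_star p) x)"
    by (simp only: add.commute)
  then show ?thesis unfolding self_adjoint_def nc_eval_sym by (rule is_adjoint_scaleR)
qed

text \<open>The norm bound for \<open>Z\<close> also holds at tuples of operators on another Hilbert space; it is
  needed there for the matrices in a microstate space.\<close>

lemma kaplansky_polynomial:
  fixes M :: "'h::complex_hilbert_space op set" and x :: "nat \<Rightarrow> 'h op"
  assumes vN: "von_neumann_algebra M" and tr: "normalized_faithful_normal_trace M \<tau>"
    and x: "\<And>i. i < m \<Longrightarrow> x i \<in> M" "\<And>i. i < m \<Longrightarrow> self_adjoint (x i)"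
    and y: "self_adjoint y" "y \<in> commutant (commutant (x ` {..<m}))"
    and b: "norm y < b" "b < \<rho>" and "\<epsilon> > 0"
  shows "\<exists>Z. nc_vars m Z \<and> tracial_algebra.n2 \<tau> (nc_eval Z x - y) < \<epsilon> \<and> norm (nc_eval Z x) \<le> \<rho> \<and>
    (\<forall>X :: nat \<Rightarrow> 'k::complex_hilbert_space op. (\<forall>i<m. self_adjoint (X i) \<and> norm (X i) \<le> R) \<longrightarrow>
       self_adjoint (nc_eval Z X) \<and> norm (nc_eval Z X) \<le> \<rho>)"
proof -
  interpret tracial_algebra M \<tau> by (rule tracial_algebra_von_neumann[OF vN tr])
  have b0: "b > 0" using b(1) norm_ge_zero[of y] by linarith
  have MM: "commutant (commutant M) = M" using vN by (simp add: von_neumann_algebra_def)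
  have "x ` {..<m} \<subseteq> M" using x(1) by blast
  then have "commutant (commutant (x ` {..<m})) \<subseteq> commutant (commutant M)"
    unfolding commutant_def by blast
  then have sub: "commutant (commutant (x ` {..<m})) \<subseteq> M" by (simp add: MM)
  \<comment> \<open>Dividing by b > norm y brings the norm below 1, where the cut-off can be
    inverted by contraction.\<close>
  define y' where "y' = (1 / b) *\<^sub>R y"
  define r where "r = norm y / b"
  have r: "0 \<le> r" "r < 1" using b(1) b0 by (simp_all add: r_def)
  have "self_adjoint y'" unfolding self_adjoint_def y'_def
    using y(1) unfolding self_adjoint_def by (rule is_adjoint_scaleR)
  moreover have "norm y' \<le> r" using b0 by (simp add: y'_def r_def)
  ultimately obtain h where h: "self_adjoint h" "norm h \<le> r"
      "\<And>S. y' o\<^sub>L S = S o\<^sub>L y' \<Longrightarrow> h o\<^sub>L S = S o\<^sub>L h" "y' + ((y' o\<^sub>L h) o\<^sub>L h) = 2 *\<^sub>R h"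
    using cutoff_preimage[OF _ _ r, of y'] by blast
  have "h o\<^sub>L S = S o\<^sub>L h" if S: "S \<in> commutant (x ` {..<m})" for S
  proof (rule h(3))
    have "y o\<^sub>L S = S o\<^sub>L y" using y(2) S unfolding commutant_def by blast
    then show "y' o\<^sub>L S = S o\<^sub>L y'" by (simp add: y'_def compose_simps)
  qed
  then have hc: "h \<in> commutant (commutant (x ` {..<m}))"
    using self_adjoint_bounded_ops[OF h(1)] unfolding commutant_def by blast
  have h_in: "h \<in> M" using hc sub by blast
  have y_in: "y \<in> M" using y(2) sub by blast
  have y'_in: "y' \<in> M" unfolding y'_def by (rule scaleR_in[OF y_in])
  have r2: "0 < 1 - r\<^sup>2" using r power_strict_mono[of r 1 2] by simp
  \<comment> \<open>The density error contributes 6/16 of \<epsilon> and the truncation error 2/8,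
    in total 5/8.\<close>
  define \<Delta> where "\<Delta> = \<epsilon> * (1 - r\<^sup>2) / (16 * b)"
  have D: "\<Delta> > 0" using \<open>\<epsilon> > 0\<close> r2 b0 by (simp add: \<Delta>_def)
  obtain \<zeta> where \<zeta>: "\<And>T. T \<in> M \<Longrightarrow> norm (l2_map T \<zeta>) < 1 \<Longrightarrow> n2 T < \<Delta>"
    using normal_trace_n2_small[OF vN tr D] by blast
  obtain Q where Q: "nc_vars m Q" "norm (l2_map (nc_eval Q x - h) \<zeta>) < 1"
    using double_commutant_dense[OF x(2) hc, of 1 \<zeta>] by auto
  have Q_in: "nc_eval Q x \<in> M" by (rule nc_eval_in[OF x(1) Q(1)])
  have QD: "n2 (nc_eval Q x - h) < \<Delta>" by (rule \<zeta>[OF diff_in[OF Q_in h_in] Q(2)])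
  define S where "S = nc_sym Q"
  have S: "nc_vars m S" by (simp add: S_def Q)
  have S_in: "nc_eval S x \<in> M" by (rule nc_eval_in[OF x(1) S])
  have Qs_in: "nc_eval (nc_star Q) x \<in> M" by (rule nc_eval_in[of m x]) (simp_all add: Q(1) x(1))
  have SD: "n2 (nc_eval S x - h) < \<Delta>"
  proof -
    \<comment> \<open>As h is self-adjoint and \<open>n2\<close> is invariant under adjoints,
      passing to the Hermitian part of Q does not increase the distance to h.\<close>
    have "star (nc_eval Q x - h) = nc_eval (nc_star Q) x - h"
      by (intro star_eq is_adjoint_diff is_adjoint_nc_eval[OF x(2) Q(1)] h(1)[unfolded self_adjoint_def])
    then have eq: "n2 (nc_eval (nc_star Q) x - h) = n2 (nc_eval Q x - h)"
      using n2_star[OF diff_in[OF Q_in h_in]] by simp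
    have "(1/2) *\<^sub>R (h + h) = h" by (simp flip: scaleR_2)
    then have "nc_eval S x - h = (1/2) *\<^sub>R ((nc_eval Q x + nc_eval (nc_star Q) x) - (h + h))"
      unfolding S_def nc_eval_sym scaleR_diff_right by simp
    also have "\<dots> = (1/2) *\<^sub>R ((nc_eval Q x - h) + (nc_eval (nc_star Q) x - h))"
      by (simp add: algebra_simps)
    finally have "nc_eval S x - h = (1/2) *\<^sub>R ((nc_eval Q x - h) + (nc_eval (nc_star Q) x - h))" .
    then have "n2 (nc_eval S x - h) = (1/2) * n2 ((nc_eval Q x - h) + (nc_eval (nc_star Q) x - h))"
      by (simp add: n2_scaleR add_in diff_in Q_in Qs_in h_in)
    also have "\<dots> \<le> (1/2) * (n2 (nc_eval Q x - h) + n2 (nc_eval (nc_star Q) x - h))"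
      by (intro mult_left_mono n2_triangle diff_in Q_in Qs_in h_in) simp
    finally show ?thesis using QD eq by simp
  qed
  \<comment> \<open>R' dominates both the prescribed bound R and the norms of the x_i, so one K
    serves x and the tuples X alike.\<close>
  define R' where "R' = max R (\<Sum>i<m. norm (x i))"
  have xR: "norm (x i) \<le> R'" if "i < m" for i
    unfolding R'_def using member_le_sum[of i "{..<m}" "\<lambda>i. norm (x i)"] that by (simp add: le_max_iff_disj)
  define K where "K = nc_bound S R'"
  define q where "q = K\<^sup>2 / (1 + K\<^sup>2)"
  have "0 \<le> q" "q < 1" by (simp_all add: q_def add_pos_nonneg)
  \<comment> \<open>The first bound keeps b (1 + q^L) below \<rho>, the second keeps the truncation
    error small in 2-norm.\<close>
  define \<eta> where "\<eta> = min ((\<rho> - b) / b) (\<epsilon> * (1 - r\<^sup>2) / (8 * b))"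
  have "\<eta> > 0" using b(2) b0 \<open>\<epsilon> > 0\<close> r2 by (simp add: \<eta>_def)
  then obtain L where L: "q ^ L < \<eta>" using real_arch_pow_inv[OF _ \<open>q < 1\<close>] by blast
  define Z where "Z = nc_scale (complex_of_real b) (nc_cutoff L K S)"
  have bound: "b * (1 + q ^ L) \<le> \<rho>"
  proof -
    have "q ^ L \<le> (\<rho> - b) / b" using L by (simp add: \<eta>_def)
    then show ?thesis using b0 by (simp add: field_simps)
  qed
  \<comment> \<open>Polymorphic in the Hilbert space: used below for x itself and for tuples on the
    other space.\<close>
  have Xprop: "self_adjoint (nc_eval Z X) \<and> norm (nc_eval Z X) \<le> \<rho>"
    if X: "\<And>i. i < m \<Longrightarrow> self_adjoint (X i)" "\<And>i. i < m \<Longrightarrow> norm (X i) \<le> R'"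
    for X :: "nat \<Rightarrow> 'z::complex_hilbert_space op"
  proof -
    have ev: "nc_eval Z X = b *\<^sub>R cutoff L K (nc_eval S X)"
      unfolding Z_def nc_eval_scale op_scaleR
      by (simp only: nc_eval_cutoff[OF self_adjoint_bounded_ops[OF X(1)] S])
    have sa: "self_adjoint (nc_eval S X)" unfolding S_def by (rule self_adjoint_nc_sym[OF X(1) Q(1)])
    have "norm (nc_eval S X) \<le> K" unfolding K_def by (rule norm_nc_eval_le[OF X(2) S])
    then have "norm (cutoff L K (nc_eval S X)) \<le> 1 + q ^ L"
      unfolding q_def by (rule cutoff_norm(2)[OF sa])
    then have "b * norm (cutoff L K (nc_eval S X)) \<le> b * (1 + q ^ L)"
      using b0 by (intro mult_left_mono) auto
    then have "norm (nc_eval Z X) \<le> \<rho>" using b0 order_trans[OF _ bound] by (simp add: ev)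
    moreover have "self_adjoint (nc_eval Z X)"
      using self_adjoint_cutoff[OF sa, of L K] unfolding self_adjoint_def ev by (rule is_adjoint_scaleR)
    ultimately show ?thesis by blast
  qed
  have sa: "self_adjoint (nc_eval S x)" unfolding S_def by (rule self_adjoint_nc_sym[OF x(2) Q(1)])
  have nS: "norm (nc_eval S x) \<le> K" unfolding K_def by (rule norm_nc_eval_le[OF xR S])
  note cut = cutoff_n2[OF S_in h_in y'_in sa nS h(2) r(2) h(4) refl, of L, folded q_def]
  have evx: "nc_eval Z x - y = b *\<^sub>R (cutoff L K (nc_eval S x) - y')"
    unfolding Z_def nc_eval_scale op_scaleR[symmetric] y'_def
    using b0 by (simp add: nc_eval_cutoff(2)[OF self_adjoint_bounded_ops[OF x(2)] S] scaleR_diff_right)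
  have "n2 (nc_eval Z x - y) = b * n2 (cutoff L K (nc_eval S x) - y')"
    unfolding evx using b0 by (simp add: n2_scaleR diff_in cut(1) y'_in)
  also have "\<dots> \<le> b * ((6 * n2 (nc_eval S x - h) + 2 * q ^ L) / (1 - r\<^sup>2))"
    using b0 by (intro mult_left_mono cut(2)) simp
  also have "\<dots> \<le> b * ((6 * \<Delta> + 2 * (\<epsilon> * (1 - r\<^sup>2) / (8 * b))) / (1 - r\<^sup>2))"
    using b0 r2 SD L by (intro mult_left_mono divide_right_mono add_mono) (auto simp: \<eta>_def)
  also have "\<dots> = (5/8) * \<epsilon>" using b0 r2 by (simp add: \<Delta>_def field_simps)
  also have "\<dots> < \<epsilon>" using \<open>\<epsilon> > 0\<close> by simp
  finally have "n2 (nc_eval Z x - y) < \<epsilon>" .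
  moreover have "nc_vars m Z" unfolding Z_def nc_vars_scale by (rule nc_eval_cutoff(1)[OF self_adjoint_bounded_ops[OF x(2)] S])
  moreover have "norm (nc_eval Z x) \<le> \<rho>" using Xprop[of x] x(2) xR by blast
  moreover have "self_adjoint (nc_eval Z X) \<and> norm (nc_eval Z X) \<le> \<rho>"
    if "\<forall>i<m. self_adjoint (X i) \<and> norm (X i) \<le> R" for X :: "nat \<Rightarrow> 'k op"
    using that by (intro Xprop) (auto simp: R'_def le_max_iff_disj)
  ultimately show ?thesis by blast
qed

section \<open>Noncommutative power series\<close>

lemma words_eq_n_lists: "words n k = set (List.n_lists k [0..<n])"
  by (auto simp: words_def set_n_lists)

definition nc_trunc ::
    "nat \<Rightarrow> nat \<Rightarrow> (nat list \<Rightarrow> complex) \<Rightarrow> (nat \<Rightarrow> 'h op) \<Rightarrow> 'h::complex_hilbert_space op" where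
  "nc_trunc N n a y = (\<Sum>k<N. \<Sum>w\<in>words n k. a w *\<^sub>O op_word y w)"

lemma nc_trunc_tendsto:
  fixes y :: "nat \<Rightarrow> 'h::complex_hilbert_space op"
  assumes a: "radius_of_convergence n a R" and y: "\<And>j. j < n \<Longrightarrow> norm (y j) \<le> R"
  shows "(\<lambda>N. nc_trunc N n a y) \<longlonglongrightarrow> nc_power_series_eval n a y"
proof -
  have "summable (\<lambda>k. \<Sum>w\<in>words n k. a w *\<^sub>O op_word y w)"
  proof (rule summable_comparison_test')
    show "summable (\<lambda>k. \<Sum>w\<in>words n k. cmod (a w) * R ^ k)"
      using a by (simp add: radius_of_convergence_def)
    fix k
    have "norm (a w *\<^sub>O op_word y w) \<le> cmod (a w) * R ^ k" if "w \<in> words n k" for w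
      unfolding norm_op_scaleC
      using norm_op_word_le[of n y R w] y that by (auto simp: words_def intro: mult_left_mono)
    then show "norm (\<Sum>w\<in>words n k. a w *\<^sub>O op_word y w) \<le> (\<Sum>w\<in>words n k. cmod (a w) * R ^ k)"
      by (rule sum_norm_le)
  qed
  then show ?thesis
    unfolding nc_trunc_def nc_power_series_eval_def by (rule summable_LIMSEQ)
qed

text \<open>This sum majorises the Lipschitz constants of all truncations: a word of length k has k
  letters to exchange, the other k - 1 being bounded by \<rho>. Boundedness of k (\<rho> / R)^k pays
  for the derivative with the gap between \<rho> and R. For k = 0 the factor k makes the exponent
  harmless.\<close>

lemma derivative_series_bounded:
  assumes a: "radius_of_convergence n a R" and \<rho>: "0 < \<rho>" "\<rho> < R"
  shows "\<exists>L\<ge>0. \<forall>N. (\<Sum>k<N. \<Sum>w\<in>words n k. cmod (a w) * (real k * \<rho> ^ (k - 1))) \<le> L"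
proof -
  have R: "R > 0" and s: "summable (\<lambda>k. \<Sum>w\<in>words n k. cmod (a w) * R ^ k)"
    using a by (simp_all add: radius_of_convergence_def)
  have "(\<lambda>k. real k * (\<rho> / R) ^ k) \<longlonglongrightarrow> 0"
    by (rule powser_times_n_limit_0) (use \<rho> R in simp)
  then have "Bseq (\<lambda>k. real k * (\<rho> / R) ^ k)" by (rule convergent_imp_Bseq[OF convergentI])
  then obtain C where C: "C > 0" "\<And>k. norm (real k * (\<rho> / R) ^ k) \<le> C" by (auto simp: Bseq_def)
  have le: "real k * \<rho> ^ (k - 1) \<le> (C / \<rho>) * R ^ k" for k
  proof (cases k)
    case (Suc l)
    have "real k * (\<rho> / R) ^ k \<le> C" using C(2)[of k] by simp
    then have "real k * \<rho> ^ k \<le> C * R ^ k" using R by (simp add: power_divide field_simps)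
    then show ?thesis using \<rho> Suc by (simp add: field_simps)
  qed (use C \<rho> in simp)
  define L where "L = (C / \<rho>) * (\<Sum>k. \<Sum>w\<in>words n k. cmod (a w) * R ^ k)"
  have pos: "0 \<le> (\<Sum>w\<in>words n k. cmod (a w) * R ^ k)" for k using R by (intro sum_nonneg) auto
  have "(\<Sum>k<N. \<Sum>w\<in>words n k. cmod (a w) * (real k * \<rho> ^ (k - 1))) \<le> L" for N
  proof -
    have "(\<Sum>k<N. \<Sum>w\<in>words n k. cmod (a w) * (real k * \<rho> ^ (k - 1)))
        \<le> (\<Sum>k<N. \<Sum>w\<in>words n k. cmod (a w) * ((C / \<rho>) * R ^ k))"
      by (intro sum_mono mult_left_mono le) auto
    also have "\<dots> = (C / \<rho>) * (\<Sum>k<N. \<Sum>w\<in>words n k. cmod (a w) * R ^ k)"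
      by (simp add: sum_distrib_left algebra_simps)
    also have "\<dots> \<le> L"
      unfolding L_def using C \<rho> by (intro mult_left_mono sum_le_suminf s) (auto simp: pos)
    finally show ?thesis .
  qed
  moreover have "0 \<le> L" unfolding L_def using C \<rho> by (intro mult_nonneg_nonneg suminf_nonneg s pos) auto
  ultimately show ?thesis by blast
qed

context tracial_algebra
begin

lemma op_word_in: "(\<And>j. j < n \<Longrightarrow> y j \<in> N) \<Longrightarrow> set w \<subseteq> {..<n} \<Longrightarrow> op_word y w \<in> N"
  by (induction w) (auto intro: id_in compose_in)

lemma nc_trunc_in: "(\<And>j. j < n \<Longrightarrow> y j \<in> N) \<Longrightarrow> nc_trunc L n a y \<in> N"
  unfolding nc_trunc_def by (intro sum_in scaleC_in op_word_in[of n]) (auto simp: words_def)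

text \<open>The words are changed one letter at a time. The changed letter is measured in 2-norm and
  its neighbours on both sides in operator norm, which uses both composition bounds.\<close>

lemma n2_op_word_diff:
  assumes B: "\<And>j. j < n \<Longrightarrow> B j \<in> N" "\<And>j. j < n \<Longrightarrow> norm (B j) \<le> \<rho>"
    and B': "\<And>j. j < n \<Longrightarrow> B' j \<in> N" "\<And>j. j < n \<Longrightarrow> norm (B' j) \<le> \<rho>"
    and d: "\<And>j. j < n \<Longrightarrow> n2 (B j - B' j) \<le> \<Delta>" and "0 \<le> \<rho>" "0 \<le> \<Delta>"
    and "set w \<subseteq> {..<n}"
  shows "n2 (op_word B w - op_word B' w) \<le> real (length w) * \<rho> ^ (length w - 1) * \<Delta>"
  using \<open>set w \<subseteq> {..<n}\<close>
proof (induction w)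
  case Nil
  show ?case by (simp add: n2_zero)
next
  case (Cons i w)
  then have i: "i < n" and w: "set w \<subseteq> {..<n}" by auto
  let ?W = "op_word B w" and ?W' = "op_word B' w"
  have in_N: "?W \<in> N" "?W' \<in> N" "B i - B' i \<in> N" "?W - ?W' \<in> N" "B' i \<in> N"
    using op_word_in[of n B w] op_word_in[of n B' w] B B' w i by (auto intro: diff_in)
  have "n2 ((B i - B' i) o\<^sub>L ?W) \<le> n2 (B i - B' i) * norm ?W" by (intro n2_compose_right in_N)
  also have "\<dots> \<le> \<Delta> * \<rho> ^ length w"
    using d[OF i] norm_op_word_le[of n B \<rho> w] B w \<open>0 \<le> \<Delta>\<close> by (intro mult_mono) auto
  finally have 1: "n2 ((B i - B' i) o\<^sub>L ?W) \<le> \<Delta> * \<rho> ^ length w" .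
  have "n2 (B' i o\<^sub>L (?W - ?W')) \<le> norm (B' i) * n2 (?W - ?W')" by (intro n2_compose_left in_N)
  also have "\<dots> \<le> \<rho> * (real (length w) * \<rho> ^ (length w - 1) * \<Delta>)"
    using B'(2)[OF i] Cons.IH[OF w] \<open>0 \<le> \<rho>\<close> by (intro mult_mono) (auto intro: n2_nonneg in_N)
  \<comment> \<open>For the empty word the exponent is cut off at 0, but the factor
    \<open>length w\<close> vanishes on both sides.\<close>
  also have "\<dots> = real (length w) * \<rho> ^ length w * \<Delta>" by (cases w) auto
  finally have 2: "n2 (B' i o\<^sub>L (?W - ?W')) \<le> real (length w) * \<rho> ^ length w * \<Delta>" .
  have "op_word B (i # w) - op_word B' (i # w) = ((B i - B' i) o\<^sub>L ?W) + (B' i o\<^sub>L (?W - ?W'))"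
    by (simp add: compose_simps)
  also have "n2 \<dots> \<le> n2 ((B i - B' i) o\<^sub>L ?W) + n2 (B' i o\<^sub>L (?W - ?W'))"
    by (intro n2_triangle compose_in in_N)
  finally show ?case using 1 2 by (simp add: algebra_simps)
qed

lemma n2_trunc_diff:
  assumes B: "\<And>j. j < n \<Longrightarrow> B j \<in> N" "\<And>j. j < n \<Longrightarrow> norm (B j) \<le> \<rho>"
    and B': "\<And>j. j < n \<Longrightarrow> B' j \<in> N" "\<And>j. j < n \<Longrightarrow> norm (B' j) \<le> \<rho>"
    and d: "\<And>j. j < n \<Longrightarrow> n2 (B j - B' j) \<le> \<Delta>" and "0 \<le> \<rho>" "0 \<le> \<Delta>"
    and L: "(\<Sum>k<N'. \<Sum>w\<in>words n k. cmod (a w) * (real k * \<rho> ^ (k - 1))) \<le> L"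
  shows "n2 (nc_trunc N' n a B - nc_trunc N' n a B') \<le> L * \<Delta>"
proof -
  have eq: "nc_trunc N' n a B - nc_trunc N' n a B' = (\<Sum>k<N'. \<Sum>w\<in>words n k. a w *\<^sub>O (op_word B w - op_word B' w))"
  proof -
    have "a w *\<^sub>O (op_word B w - op_word B' w) = a w *\<^sub>O op_word B w - a w *\<^sub>O op_word B' w" for w
      by (rule blinfun_eqI) (simp add: blinfun.diff_left scaleC_diff_right)
    then show ?thesis by (simp add: nc_trunc_def sum_subtractf)
  qed
  have W: "op_word B w - op_word B' w \<in> N" if "w \<in> words n k" for w k
    using that B(1) B'(1) by (intro diff_in op_word_in[of n]) (auto simp: words_def)
  have "n2 (nc_trunc N' n a B - nc_trunc N' n a B') \<le> (\<Sum>k<N'. \<Sum>w\<in>words n k. n2 (a w *\<^sub>O (op_word B w - op_word B' w)))"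
    unfolding eq
    by (rule order_trans[OF n2_sum sum_mono[OF n2_sum]]) (auto intro: sum_in scaleC_in W)
  also have "\<dots> \<le> (\<Sum>k<N'. \<Sum>w\<in>words n k. cmod (a w) * (real k * \<rho> ^ (k - 1)) * \<Delta>)"
  proof (intro sum_mono)
    fix k w assume w: "w \<in> words n k"
    have "n2 (op_word B w - op_word B' w) \<le> real (length w) * \<rho> ^ (length w - 1) * \<Delta>"
      using w assms by (intro n2_op_word_diff[of n]) (auto simp: words_def)
    then have "cmod (a w) * n2 (op_word B w - op_word B' w) \<le> cmod (a w) * (real k * \<rho> ^ (k - 1) * \<Delta>)"
      using w by (intro mult_left_mono) (auto simp: words_def)
    then show "n2 (a w *\<^sub>O (op_word B w - op_word B' w)) \<le> cmod (a w) * (real k * \<rho> ^ (k - 1)) * \<Delta>"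
      by (simp add: n2_scaleC W[OF w] mult.assoc)
  qed
  also have "\<dots> = (\<Sum>k<N'. \<Sum>w\<in>words n k. cmod (a w) * (real k * \<rho> ^ (k - 1))) * \<Delta>"
    by (simp add: sum_distrib_right)
  also have "\<dots> \<le> L * \<Delta>" using L \<open>0 \<le> \<Delta>\<close> by (rule mult_right_mono)
  finally show ?thesis .
qed

end

section \<open>Substituting polynomials into truncated power series\<close>

fun nc_subst :: "(nat \<Rightarrow> ncpoly) \<Rightarrow> nat list \<Rightarrow> ncpoly" where
  "nc_subst Z [] = [(1, [])]"
| "nc_subst Z (j # w) = nc_mult (Z j) (nc_subst Z w)"

text \<open>A truncation of P_i evaluated at the Z_j must itself be a polynomial in x, so that
  finitely many moments of x control it.\<close>

definition nc_trunc_poly :: "nat \<Rightarrow> nat \<Rightarrow> (nat list \<Rightarrow> complex) \<Rightarrow> (nat \<Rightarrow> ncpoly) \<Rightarrow> ncpoly" where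
  "nc_trunc_poly N n a Z = concat (map (\<lambda>w. nc_scale (a w) (nc_subst Z w))
     (concat (map (\<lambda>k. List.n_lists k [0..<n]) [0..<N])))"

lemma nc_subst:
  assumes x: "\<And>i. i < m \<Longrightarrow> x i \<in> bounded_ops" and Z: "\<And>j. j < n \<Longrightarrow> nc_vars m (Z j)" and "set w \<subseteq> {..<n}"
  shows "nc_vars m (nc_subst Z w) \<and> nc_eval (nc_subst Z w) x = op_word (\<lambda>j. nc_eval (Z j) x) w"
  using \<open>set w \<subseteq> {..<n}\<close>
proof (induction w)
  case (Cons j w)
  then have j: "nc_vars m (Z j)" by (intro Z) auto
  from Cons show ?case by (simp add: nc_vars_mult j nc_eval_mult[OF x j])
qed (simp add: op_scaleC_one)

lemma nc_vars_concat: "nc_vars m (concat ps) \<longleftrightarrow> (\<forall>p\<in>set ps. nc_vars m p)"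
  by (induction ps) auto

lemma nc_eval_concat: "nc_eval (concat ps) x = (\<Sum>p\<leftarrow>ps. nc_eval p x)"
  by (induction ps) auto

lemma nc_trunc_poly:
  assumes x: "\<And>i. i < m \<Longrightarrow> x i \<in> bounded_ops" and Z: "\<And>j. j < n \<Longrightarrow> nc_vars m (Z j)"
  shows "nc_vars m (nc_trunc_poly N n a Z)"
    and "nc_eval (nc_trunc_poly N n a Z) x = nc_trunc N n a (\<lambda>j. nc_eval (Z j) x)"
proof -
  let ?f = "\<lambda>w. nc_scale (a w) (nc_subst Z w)"
  have word: "set w \<subseteq> {..<n}" if "w \<in> set (concat (map (\<lambda>k. List.n_lists k [0..<n]) ks))" for w ks
    using that by (auto simp: set_n_lists)
  have sub: "nc_vars m (nc_subst Z w)" "nc_eval (nc_subst Z w) x = op_word (\<lambda>j. nc_eval (Z j) x) w"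
    if "set w \<subseteq> {..<n}" for w
    using nc_subst[of m x n Z w] x Z that by auto
  show "nc_vars m (nc_trunc_poly N n a Z)"
    unfolding nc_trunc_poly_def nc_vars_concat using word[of _ "[0..<N]"] sub by auto
  have "nc_eval (concat (map ?f (concat (map (\<lambda>k. List.n_lists k [0..<n]) [0..<N])))) x
      = (\<Sum>k<N. \<Sum>w\<in>words n k. a w *\<^sub>O op_word (\<lambda>j. nc_eval (Z j) x) w)"
  proof (induction N)
    case (Suc N)
    have "nc_eval (concat (map ?f (List.n_lists N [0..<n]))) x = (\<Sum>w\<leftarrow>List.n_lists N [0..<n]. nc_eval (?f w) x)"
      by (simp add: nc_eval_concat comp_def)
    also have "\<dots> = (\<Sum>w\<in>words n N. nc_eval (?f w) x)"
      by (simp add: sum_list_distinct_conv_sum_set distinct_n_lists words_eq_n_lists)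
    also have "\<dots> = (\<Sum>w\<in>words n N. a w *\<^sub>O op_word (\<lambda>j. nc_eval (Z j) x) w)"
      by (intro sum.cong refl) (simp add: nc_eval_scale sub words_def)
    finally show ?case using Suc by simp
  qed simp
  then show "nc_eval (nc_trunc_poly N n a Z) x = nc_trunc N n a (\<lambda>j. nc_eval (Z j) x)"
    by (simp add: nc_trunc_poly_def nc_trunc_def)
qed

section \<open>Approximation of the generators on microstates\<close>

text \<open>The total length of all words, a convenient upper bound for the degree: moments up to
  this order cover every word that occurs.\<close>

definition nc_deg :: "ncpoly \<Rightarrow> nat" where
  "nc_deg p = (\<Sum>(c, w)\<leftarrow>p. length w)"

lemma trace_nc_eval_close:
  fixes x :: "nat \<Rightarrow> 'h::complex_hilbert_space op" and X :: "nat \<Rightarrow> 'k::complex_hilbert_space op"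
  assumes "tracial_algebra N \<tau>" "tracial_algebra N' \<tau>'"
    and x: "\<And>i. i < m \<Longrightarrow> x i \<in> N" and X: "\<And>i. i < m \<Longrightarrow> X i \<in> N'"
    and close: "\<And>s w. 1 \<le> s \<Longrightarrow> s \<le> q \<Longrightarrow> w \<in> words m s \<Longrightarrow> cmod (\<tau> (op_word x w) - \<tau>' (op_word X w)) < \<epsilon>"
    and p: "nc_vars m p" "nc_deg p \<le> q" and "0 \<le> \<epsilon>"
  shows "cmod (\<tau> (nc_eval p x) - \<tau>' (nc_eval p X)) \<le> \<epsilon> * nc_bound p 1"
proof -
  interpret A: tracial_algebra N \<tau> by fact
  interpret B: tracial_algebra N' \<tau>' by fact
  \<comment> \<open>The moment condition starts at s = 1; at the empty word both traces equal
    1.\<close>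
  have word: "cmod (\<tau> (op_word x w) - \<tau>' (op_word X w)) \<le> \<epsilon>" if "set w \<subseteq> {..<m}" "length w \<le> q" for w
  proof (cases "w = []")
    case True
    then show ?thesis using A.trace_id B.trace_id \<open>0 \<le> \<epsilon>\<close> by simp
  next
    case False
    then have "1 \<le> length w" by (cases w) auto
    then show ?thesis using close[of "length w" w] that by (auto simp: words_def)
  qed
  show ?thesis
    using p
  proof (induction p)
    case Nil
    then show ?case
      using A.trace_scaleC[OF A.zero_in, of 0] B.trace_scaleC[OF B.zero_in, of 0]
      by (simp add: op_scaleC_zero nc_bound_def)
  next
    case (Cons a p)
    obtain c w where a: "a = (c, w)" by (cases a)
    have w: "set w \<subseteq> {..<m}" "length w \<le> q" and p: "nc_vars m p" "nc_deg p \<le> q"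
      using Cons.prems by (auto simp: a nc_deg_def)
    have in_A: "op_word x w \<in> N" "nc_eval p x \<in> N"
      using A.op_word_in[of m x w] A.nc_eval_in[of m x p] x w p by auto
    have in_B: "op_word X w \<in> N'" "nc_eval p X \<in> N'"
      using B.op_word_in[of m X w] B.nc_eval_in[of m X p] X w p by auto
    have "\<tau> (nc_eval (a # p) x) - \<tau>' (nc_eval (a # p) X) =
        c * (\<tau> (op_word x w) - \<tau>' (op_word X w)) + (\<tau> (nc_eval p x) - \<tau>' (nc_eval p X))"
      by (simp add: a A.trace_add B.trace_add A.trace_scaleC B.trace_scaleC A.scaleC_in B.scaleC_in
          in_A in_B algebra_simps)
    also have "cmod \<dots> \<le> cmod c * cmod (\<tau> (op_word x w) - \<tau>' (op_word X w)) + cmod (\<tau> (nc_eval p x) - \<tau>' (nc_eval p X))"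
      by (rule order_trans[OF norm_triangle_ineq]) (simp add: norm_mult)
    also have "\<dots> \<le> cmod c * \<epsilon> + \<epsilon> * nc_bound p 1"
      by (intro add_mono mult_left_mono word w Cons.IH p) auto
    finally show ?case by (simp add: a nc_bound_def algebra_simps)
  qed
qed

lemma nc_bound_nonneg: "0 \<le> r \<Longrightarrow> 0 \<le> nc_bound p r"
  unfolding nc_bound_def by (rule sum_list_nonneg) auto

text \<open>The squared 2-norm of x_i - P_i(Z), with P_i truncated, is the trace of one polynomial,
  so closeness of moments transports the estimate from x to any X. First N is chosen for \<delta>,
  then Z, and q and \<epsilon> last, since they depend on the resulting polynomials.\<close>

lemma microstate_approximation:
  fixes M :: "'h::complex_hilbert_space op set" and x y :: "nat \<Rightarrow> 'h op"
  assumes vN: "von_neumann_algebra M" and tr: "normalized_faithful_normal_trace M \<tau>"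
    and x: "\<And>i. i < m \<Longrightarrow> x i \<in> M" "\<And>i. i < m \<Longrightarrow> self_adjoint (x i)"
    and y: "\<And>j. j < n \<Longrightarrow> y j \<in> M" "\<And>j. j < n \<Longrightarrow> self_adjoint (y j)"
      "\<And>j. j < n \<Longrightarrow> y j \<in> commutant (commutant (x ` {..<m}))"
    and b: "\<And>j. j < n \<Longrightarrow> norm (y j) < b" and \<rho>: "0 < b" "b < \<rho>" "\<rho> < R"
    and P: "\<And>i. i < m \<Longrightarrow> radius_of_convergence n (P i) R"
    and xP: "\<And>i. i < m \<Longrightarrow> x i = nc_power_series_eval n (P i) y"
    and L: "\<And>i N. i < m \<Longrightarrow> (\<Sum>k<N. \<Sum>w\<in>words n k. cmod (P i w) * (real k * \<rho> ^ (k - 1))) \<le> L" "0 \<le> L"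
    and \<delta>: "\<delta> > 0"
  obtains q \<epsilon> Z N where "\<epsilon> > 0" and "\<And>j. j < n \<Longrightarrow> nc_vars m (Z j)"
    and "\<forall>N' \<tau>'. \<forall>X :: nat \<Rightarrow> 'k::complex_hilbert_space op. tracial_algebra N' \<tau>' \<longrightarrow>
      (\<forall>i<m. X i \<in> N' \<and> self_adjoint (X i) \<and> norm (X i) \<le> R0) \<longrightarrow>
      (\<forall>s w. 1 \<le> s \<and> s \<le> q \<and> w \<in> words m s \<longrightarrow> cmod (\<tau> (op_word x w) - \<tau>' (op_word X w)) < \<epsilon>) \<longrightarrow>
      (\<forall>j<n. self_adjoint (nc_eval (Z j) X) \<and> norm (nc_eval (Z j) X) \<le> \<rho>) \<and>
      (\<forall>i<m. tracial_algebra.n2 \<tau>' (X i - nc_trunc N n (P i) (\<lambda>j. nc_eval (Z j) X)) \<le> \<delta>)"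
proof -
  interpret tracial_algebra M \<tau> by (rule tracial_algebra_von_neumann[OF vN tr])
  have xb: "x i \<in> bounded_ops" if "i < m" for i using self_adjoint_bounded_ops x(2) that by blast
  have "\<forall>\<^sub>F N in sequentially. \<forall>i\<in>{..<m}. norm (x i - nc_trunc N n (P i) y) < \<delta> / 3"
  proof (rule eventually_ball_finite, simp, intro ballI)
    fix i assume "i \<in> {..<m}"
    then have i: "i < m" by simp
    have "norm (y j) \<le> R" if "j < n" for j using b[OF that] \<rho> by linarith
    then have "(\<lambda>N. nc_trunc N n (P i) y) \<longlonglongrightarrow> x i"
      unfolding xP[OF i] by (rule nc_trunc_tendsto[OF P[OF i]])
    then have "\<forall>\<^sub>F N in sequentially. dist (nc_trunc N n (P i) y) (x i) < \<delta> / 3"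
      using \<delta> by (intro tendstoD) auto
    then show "\<forall>\<^sub>F N in sequentially. norm (x i - nc_trunc N n (P i) y) < \<delta> / 3"
      by (simp add: dist_norm norm_minus_commute)
  qed
  then obtain N where N: "\<And>i. i < m \<Longrightarrow> norm (x i - nc_trunc N n (P i) y) < \<delta> / 3"
    unfolding eventually_sequentially by blast
  \<comment> \<open>Replacing y by Z(x) then costs at most L * \<eta> \<le> \<delta> / 3; the
    summand 1 covers L = 0.\<close>
  define \<eta> where "\<eta> = \<delta> / (3 * (L + 1))"
  have \<eta>: "\<eta> > 0" "L * \<eta> \<le> \<delta> / 3" using \<delta> L(2) by (simp_all add: \<eta>_def field_simps)
  have "\<exists>Z. nc_vars m Z \<and> n2 (nc_eval Z x - y j) < \<eta> \<and> norm (nc_eval Z x) \<le> \<rho> \<and>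
    (\<forall>X :: nat \<Rightarrow> 'k op. (\<forall>i<m. self_adjoint (X i) \<and> norm (X i) \<le> R0) \<longrightarrow>
       self_adjoint (nc_eval Z X) \<and> norm (nc_eval Z X) \<le> \<rho>)" if j: "j < n" for j
    by (rule kaplansky_polynomial[OF vN tr x y(2)[OF j] y(3)[OF j] b[OF j] \<rho>(2) \<eta>(1)])
  then obtain Z where Z: "\<And>j. j < n \<Longrightarrow> nc_vars m (Z j)" "\<And>j. j < n \<Longrightarrow> n2 (nc_eval (Z j) x - y j) < \<eta>"
    "\<And>j. j < n \<Longrightarrow> norm (nc_eval (Z j) x) \<le> \<rho>"
    "\<And>j X. j < n \<Longrightarrow> (\<forall>i<m. self_adjoint (X i) \<and> norm (X i) \<le> R0) \<Longrightarrow>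
       self_adjoint (nc_eval (Z j) (X :: nat \<Rightarrow> 'k op)) \<and> norm (nc_eval (Z j) X) \<le> \<rho>"
    by metis
  \<comment> \<open>\<open>T i\<close> stands for x_i minus the truncated P_i at Z, and
    \<open>S i\<close> below for its adjoint times itself.\<close>
  define T where "T i = (1, [i]) # nc_scale (-1) (nc_trunc_poly N n (P i) Z)" for i
  have T: "nc_vars m (T i)" if "i < m" for i
    using nc_trunc_poly(1)[of m x n Z N "P i"] xb Z(1) that by (simp add: T_def)
  have evT: "nc_eval (T i) X = X i - nc_trunc N n (P i) (\<lambda>j. nc_eval (Z j) X)"
    if "\<And>i. i < m \<Longrightarrow> X i \<in> bounded_ops" for i and X :: "nat \<Rightarrow> 'z::complex_hilbert_space op"
    using nc_trunc_poly(2)[of m X n Z N "P i"] that Z(1)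
    by (simp add: T_def nc_eval_scale op_scaleC_minus_one op_scaleC_one)
  define S where "S i = nc_mult (nc_star (T i)) (T i)" for i
  have S: "nc_vars m (S i)" if "i < m" for i using T[OF that] by (simp add: S_def nc_vars_mult)
  have n2_T: "n2 (nc_eval (T i) x) \<le> 2 * \<delta> / 3" if i: "i < m" for i
  proof -
    have z_in: "nc_eval (Z j) x \<in> M" if "j < n" for j
      using nc_eval_in[of m x "Z j"] x(1) Z(1)[OF that] by blast
    let ?u = "nc_trunc N n (P i) y" and ?v = "nc_trunc N n (P i) (\<lambda>j. nc_eval (Z j) x)"
    have u: "?u \<in> M" "?v \<in> M" using y(1) z_in by (auto intro: nc_trunc_in)
    have "n2 (x i - ?u) \<le> \<delta> / 3"
      using n2_le_norm[OF diff_in[OF x(1)[OF i] u(1)]] N[OF i] by linarith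
    moreover have "n2 (?u - ?v) \<le> L * \<eta>"
    proof (rule n2_trunc_diff[OF _ _ _ _ _ _ _ L(1)[OF i]])
      fix j assume j: "j < n"
      show "norm (y j) \<le> \<rho>" using b[OF j] \<rho> by linarith
      show "n2 (y j - nc_eval (Z j) x) \<le> \<eta>"
        using Z(2)[OF j] n2_diff_commute[OF y(1)[OF j] z_in[OF j]] by simp
    qed (use y(1) z_in Z(3) \<rho> \<eta> in auto)
    moreover have "n2 ((x i - ?u) + (?u - ?v)) \<le> n2 (x i - ?u) + n2 (?u - ?v)"
      by (intro n2_triangle diff_in x(1) i u)
    ultimately show ?thesis using \<eta>(2) by (simp add: evT[OF xb])
  qed
  \<comment> \<open>Sums over i serve as bounds that hold for every i simultaneously.\<close>
  define q where "q = (\<Sum>i<m. nc_deg (S i))"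
  define C where "C = (\<Sum>i<m. nc_bound (S i) 1)"
  have "0 \<le> C" unfolding C_def by (intro sum_nonneg nc_bound_nonneg) simp
  \<comment> \<open>The moment error adds at most \<delta>^2 / 2 to (2 \<delta> / 3)^2, and 4/9 +
    1/2 is below 1.\<close>
  define \<epsilon> where "\<epsilon> = \<delta>\<^sup>2 / (2 * (C + 1))"
  have \<epsilon>: "\<epsilon> > 0" using \<delta> \<open>0 \<le> C\<close> by (simp add: \<epsilon>_def)
  have \<epsilon>C: "\<epsilon> * C \<le> \<delta>\<^sup>2 / 2" using \<open>0 \<le> C\<close> by (simp add: \<epsilon>_def field_simps)
  have main: "tracial_algebra.n2 \<tau>' (X i - nc_trunc N n (P i) (\<lambda>j. nc_eval (Z j) X)) \<le> \<delta>"
    if tr': "tracial_algebra N' \<tau>'" and X: "\<And>i. i < m \<Longrightarrow> X i \<in> N'" "\<And>i. i < m \<Longrightarrow> self_adjoint (X i)"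
      and close: "\<And>s w. 1 \<le> s \<Longrightarrow> s \<le> q \<Longrightarrow> w \<in> words m s \<Longrightarrow> cmod (\<tau> (op_word x w) - \<tau>' (op_word X w)) < \<epsilon>"
      and i: "i < m" for N' \<tau>' i and X :: "nat \<Rightarrow> 'k op"
  proof -
    interpret B: tracial_algebra N' \<tau>' by (rule tr')
    have Xb: "X i \<in> bounded_ops" if "i < m" for i using self_adjoint_bounded_ops X(2) that by blast
    have sA: "star (nc_eval (T i) x) = nc_eval (nc_star (T i)) x"
      by (rule star_eq[OF is_adjoint_nc_eval[OF x(2) T[OF i]]])
    have sB: "B.star (nc_eval (T i) X) = nc_eval (nc_star (T i)) X"
      by (rule B.star_eq[OF is_adjoint_nc_eval[OF X(2) T[OF i]]])
    have vs: "nc_vars m (nc_star (T i))" using T[OF i] by simp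
    have TA: "nc_eval (T i) x \<in> M" using nc_eval_in[of m x "T i"] x(1) T[OF i] by blast
    have TB: "nc_eval (T i) X \<in> N'" using B.nc_eval_in[of m X "T i"] X(1) T[OF i] by blast
    have A2: "(n2 (nc_eval (T i) x))\<^sup>2 = Re (\<tau> (nc_eval (S i) x))"
    proof -
      have "nc_eval (S i) x = nc_eval (nc_star (T i)) x o\<^sub>L nc_eval (T i) x"
        unfolding S_def by (rule nc_eval_mult[of m]) (use xb vs in auto)
      then show ?thesis by (simp only: n2_sq[OF TA] sA)
    qed
    have B2: "(B.n2 (nc_eval (T i) X))\<^sup>2 = Re (\<tau>' (nc_eval (S i) X))"
    proof -
      have "nc_eval (S i) X = nc_eval (nc_star (T i)) X o\<^sub>L nc_eval (T i) X"
        unfolding S_def by (rule nc_eval_mult[of m]) (use Xb vs in auto)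
      then show ?thesis by (simp only: B.n2_sq[OF TB] sB)
    qed
    have deg: "nc_deg (S i) \<le> q"
      unfolding q_def using i by (intro member_le_sum) auto
    have bd: "nc_bound (S i) 1 \<le> C"
      unfolding C_def using i by (intro member_le_sum) (auto intro: nc_bound_nonneg)
    have "cmod (\<tau> (nc_eval (S i) x) - \<tau>' (nc_eval (S i) X)) \<le> \<epsilon> * nc_bound (S i) 1"
      using \<epsilon> by (intro trace_nc_eval_close[OF tracial_algebra_axioms tr' x(1) X(1) close S[OF i] deg]) auto
    also have "\<dots> \<le> \<epsilon> * C" using \<epsilon> bd by (intro mult_left_mono) auto
    finally have "cmod (\<tau> (nc_eval (S i) x) - \<tau>' (nc_eval (S i) X)) \<le> \<delta>\<^sup>2 / 2" using \<epsilon>C by linarith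
    then have "\<bar>Re (\<tau> (nc_eval (S i) x) - \<tau>' (nc_eval (S i) X))\<bar> \<le> \<delta>\<^sup>2 / 2"
      using abs_Re_le_cmod order_trans by blast
    then have "Re (\<tau>' (nc_eval (S i) X)) \<le> Re (\<tau> (nc_eval (S i) x)) + \<delta>\<^sup>2 / 2"
      unfolding minus_complex.sel by linarith
    moreover have "Re (\<tau> (nc_eval (S i) x)) \<le> (2 * \<delta> / 3)\<^sup>2"
      unfolding A2[symmetric] by (intro power_mono n2_T i n2_nonneg TA)
    moreover have "(2 * \<delta> / 3)\<^sup>2 = (4/9) * \<delta>\<^sup>2" by (simp add: power2_eq_square)
    ultimately have "(B.n2 (nc_eval (T i) X))\<^sup>2 \<le> \<delta>\<^sup>2"
      unfolding B2 using zero_le_power2[of \<delta>] by linarith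
    then have "B.n2 (nc_eval (T i) X) \<le> \<delta>" by (rule power2_le_imp_le) (use \<delta> in simp)
    then show ?thesis by (simp only: evT[OF Xb])
  qed
  show thesis
  proof (rule that[of \<epsilon> Z q N], rule \<epsilon>, rule Z(1), assumption, intro allI impI)
    fix N' \<tau>' and X :: "nat \<Rightarrow> 'k op"
    assume tr': "tracial_algebra N' \<tau>'" and X: "\<forall>i<m. X i \<in> N' \<and> self_adjoint (X i) \<and> norm (X i) \<le> R0"
      and close: "\<forall>s w. 1 \<le> s \<and> s \<le> q \<and> w \<in> words m s \<longrightarrow> cmod (\<tau> (op_word x w) - \<tau>' (op_word X w)) < \<epsilon>"
    have "self_adjoint (nc_eval (Z j) X) \<and> norm (nc_eval (Z j) X) \<le> \<rho>" if "j < n" for j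
      using Z(4)[OF that, of X] X by auto
    moreover have "tracial_algebra.n2 \<tau>' (X i - nc_trunc N n (P i) (\<lambda>j. nc_eval (Z j) X)) \<le> \<delta>" if "i < m" for i
      by (rule main[OF tr']) (use X close that in auto)
    ultimately show "(\<forall>j<n. self_adjoint (nc_eval (Z j) X) \<and> norm (nc_eval (Z j) X) \<le> \<rho>) \<and>
        (\<forall>i<m. tracial_algebra.n2 \<tau>' (X i - nc_trunc N n (P i) (\<lambda>j. nc_eval (Z j) X)) \<le> \<delta>)"
      by blast
  qed
qed

section \<open>Matrices as operators\<close>

text \<open>A \<open>k \<times> k\<close> matrix acts on the fixed space \<open>complex l2\<close> through its first \<open>k\<close> coordinates.\<close>

definition mat_op :: "nat \<Rightarrow> complex mat \<Rightarrow> complex l2 op" where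
  "mat_op k A = Blinfun (\<lambda>v. \<Sum>i<k. l2_single i (\<Sum>j<k. A $$ (i, j) * l2_nth v j))"

abbreviation unit_l2 :: "nat \<Rightarrow> complex l2" where
  "unit_l2 j \<equiv> l2_single j 1"

definition entry :: "complex l2 op \<Rightarrow> nat \<Rightarrow> nat \<Rightarrow> complex" where
  "entry T i j = l2_nth (blinfun_apply T (unit_l2 j)) i"

abbreviation corner :: "nat \<Rightarrow> complex l2 op" where
  "corner k \<equiv> mat_op k (1\<^sub>m k)"

text \<open>Operators that are block diagonal for the first k coordinates. The lower block is left
  free so that the identity of the whole space, which is the value of the empty word, belongs to the
  algebra; the trace ignores that block.\<close>

definition corner_algebra :: "nat \<Rightarrow> complex l2 op set" where
  "corner_algebra k = {T. (\<exists>S. is_adjoint T S) \<and> T o\<^sub>L corner k = corner k o\<^sub>L T}"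

definition corner_trace :: "nat \<Rightarrow> complex l2 op \<Rightarrow> complex" where
  "corner_trace k T = (\<Sum>j<k. entry T j j) / of_nat k"

lemma l2_nth_sum: "l2_nth (sum f I) i = (\<Sum>k\<in>I. l2_nth (f k) i)"
  by (rule linear_sum[OF bounded_linear.linear[OF bounded_linear_l2_nth]])

lemma mat_op_apply: "blinfun_apply (mat_op k A) v = (\<Sum>i<k. l2_single i (\<Sum>j<k. A $$ (i, j) * l2_nth v j))"
proof -
  have "bounded_linear (\<lambda>v. \<Sum>i<k. l2_single i (\<Sum>j<k. A $$ (i, j) * l2_nth v j))"
    by (intro bounded_linear_sum bounded_linear_compose[OF bounded_linear_l2_single]
        bounded_linear_compose[OF bounded_linear_mult_right] bounded_linear_l2_nth)
  then show ?thesis unfolding mat_op_def by (simp add: bounded_linear_Blinfun_apply)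
qed

lemma mat_op_nth: "l2_nth (blinfun_apply (mat_op k A) v) i = (if i < k then \<Sum>j<k. A $$ (i, j) * l2_nth v j else 0)"
  by (auto simp: mat_op_apply l2_nth_sum)

lemma entry_mat_op: "i < k \<Longrightarrow> j < k \<Longrightarrow> entry (mat_op k A) i j = A $$ (i, j)"
proof -
  assume ij: "i < k" "j < k"
  have "entry (mat_op k A) i j = (\<Sum>l<k. if l = j then A $$ (i, j) else 0)"
    unfolding entry_def mat_op_nth if_P[OF ij(1)] by (intro sum.cong) auto
  then show ?thesis using ij by simp
qed

lemma corner_nth: "l2_nth (blinfun_apply (corner k) v) i = (if i < k then l2_nth v i else 0)"
proof (cases "i < k")
  case True
  have "(\<Sum>j<k. (1\<^sub>m k) $$ (i, j) * l2_nth v j) = (\<Sum>j<k. if j = i then l2_nth v i else 0)"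
    using True by (intro sum.cong) auto
  then show ?thesis using True by (simp add: mat_op_nth)
qed (simp add: mat_op_nth)

lemma cinner_unit: "cinner v (unit_l2 i) = l2_nth v i"
proof -
  have "(\<lambda>k. cinner (l2_nth v k) (l2_nth (unit_l2 i) k)) sums (\<Sum>k\<in>{i}. cinner (l2_nth v k) (l2_nth (unit_l2 i) k))"
    by (rule sums_finite) (auto simp: cinner_complex_def)
  then show ?thesis by (simp add: cinner_l2_eq sums_iff cinner_complex_def)
qed

lemma entry_adjoint:
  assumes "is_adjoint T S"
  shows "entry S i j = cnj (entry T j i)"
proof -
  have "entry S i j = cinner (blinfun_apply S (unit_l2 j)) (unit_l2 i)"
    by (simp only: entry_def cinner_unit)
  also have "\<dots> = cnj (cinner (unit_l2 i) (blinfun_apply S (unit_l2 j)))" by (rule cinner_commute)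
  also have "cinner (unit_l2 i) (blinfun_apply S (unit_l2 j)) = entry T j i"
    by (simp only: entry_def cinner_unit flip: is_adjointD[OF assms])
  finally show ?thesis .
qed

lemma cinner_finite_support:
  fixes u v :: "complex l2"
  assumes "\<And>i. i \<ge> k \<Longrightarrow> l2_nth u i = 0 \<or> l2_nth v i = 0"
  shows "cinner u v = (\<Sum>i<k. l2_nth u i * cnj (l2_nth v i))"
proof -
  have "(\<lambda>i. cinner (l2_nth u i) (l2_nth v i)) sums (\<Sum>i<k. cinner (l2_nth u i) (l2_nth v i))"
    by (rule sums_finite) (use assms in \<open>auto simp: cinner_complex_def not_less\<close>)
  then show ?thesis by (simp add: cinner_l2_eq sums_iff cinner_complex_def)
qed

lemma self_adjoint_mat_op:
  assumes "A \<in> sa_mats k"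
  shows "self_adjoint (mat_op k A)"
  unfolding self_adjoint_def is_adjoint_def
proof (intro allI)
  fix u v
  have A: "cnj (A $$ (j, i)) = A $$ (i, j)" if "i < k" "j < k" for i j
  proof -
    have "A $$ (j, i) = cnj (A $$ (i, j))" using assms that unfolding sa_mats_def by blast
    then show ?thesis by simp
  qed
  have "cinner (blinfun_apply (mat_op k A) u) v = (\<Sum>i<k. l2_nth (blinfun_apply (mat_op k A) u) i * cnj (l2_nth v i))"
    by (rule cinner_finite_support) (simp add: mat_op_nth)
  also have "\<dots> = (\<Sum>i<k. \<Sum>j<k. A $$ (i, j) * l2_nth u j * cnj (l2_nth v i))"
    by (intro sum.cong refl) (simp add: mat_op_nth sum_distrib_right)
  also have "\<dots> = (\<Sum>j<k. \<Sum>i<k. A $$ (i, j) * l2_nth u j * cnj (l2_nth v i))" by (rule sum.swap)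
  also have "\<dots> = (\<Sum>j<k. l2_nth u j * cnj (\<Sum>i<k. A $$ (j, i) * l2_nth v i))"
    unfolding cnj_sum sum_distrib_left by (intro sum.cong refl) (simp add: A)
  also have "\<dots> = (\<Sum>j<k. l2_nth u j * cnj (l2_nth (blinfun_apply (mat_op k A) v) j))"
    by (intro sum.cong refl) (simp add: mat_op_nth)
  also have "\<dots> = cinner u (blinfun_apply (mat_op k A) v)"
    by (rule cinner_finite_support[symmetric]) (simp add: mat_op_nth)
  finally show "cinner (blinfun_apply (mat_op k A) u) v = cinner u (blinfun_apply (mat_op k A) v)" .
qed

lemma one_mat_sa: "1\<^sub>m k \<in> sa_mats k"
  by (auto simp: sa_mats_def)

lemma is_adjoint_corner: "is_adjoint (corner k) (corner k)"
  using self_adjoint_mat_op[OF one_mat_sa] by (simp add: self_adjoint_def)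

lemma mat_op_mult:
  assumes "A \<in> carrier_mat k k" "B \<in> carrier_mat k k"
  shows "mat_op k (A * B) = mat_op k A o\<^sub>L mat_op k B"
proof (rule blinfun_eqI, rule l2_eqI)
  fix v i
  show "l2_nth (blinfun_apply (mat_op k (A * B)) v) i = l2_nth (blinfun_apply (mat_op k A o\<^sub>L mat_op k B) v) i"
  proof (cases "i < k")
    case True
    have "(\<Sum>j<k. (A * B) $$ (i, j) * l2_nth v j) = (\<Sum>j<k. \<Sum>l<k. A $$ (i, l) * B $$ (l, j) * l2_nth v j)"
      using True assms by (intro sum.cong refl) (auto simp: scalar_prod_def lessThan_atLeast0 sum_distrib_right)
    also have "\<dots> = (\<Sum>l<k. \<Sum>j<k. A $$ (i, l) * B $$ (l, j) * l2_nth v j)" by (rule sum.swap)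
    also have "\<dots> = (\<Sum>l<k. A $$ (i, l) * (\<Sum>j<k. B $$ (l, j) * l2_nth v j))"
      by (simp add: sum_distrib_left mult.assoc)
    finally show ?thesis using True by (simp add: mat_op_nth)
  qed (simp add: mat_op_nth)
qed

lemma mat_op_in_corner_algebra:
  assumes "A \<in> sa_mats k"
  shows "mat_op k A \<in> corner_algebra k"
proof -
  have A: "A \<in> carrier_mat k k" using assms unfolding sa_mats_def by blast
  have "mat_op k A o\<^sub>L corner k = corner k o\<^sub>L mat_op k A"
    using mat_op_mult[OF A one_carrier_mat] mat_op_mult[OF one_carrier_mat A] A by simp
  then show ?thesis
    using self_adjoint_mat_op[OF assms] unfolding corner_algebra_def self_adjoint_def by blast
qed

lemma corner_unit: "j < k \<Longrightarrow> blinfun_apply (corner k) (unit_l2 j) = unit_l2 j"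
  by (rule l2_eqI) (simp add: corner_nth)

text \<open>Commuting with the corner keeps the image of the j-th unit vector inside the first k
  coordinates; thus entries multiply as for k x k matrices.\<close>

lemma corner_algebra_unit:
  assumes "T \<in> corner_algebra k" "j < k"
  shows "blinfun_apply T (unit_l2 j) = (\<Sum>l<k. entry T l j *\<^sub>C unit_l2 l)"
proof -
  have "blinfun_apply T (unit_l2 j) = blinfun_apply (T o\<^sub>L corner k) (unit_l2 j)"
    using assms(2) by (simp add: corner_unit)
  also have "T o\<^sub>L corner k = corner k o\<^sub>L T" using assms(1) by (simp add: corner_algebra_def)
  finally have eq: "blinfun_apply T (unit_l2 j) = blinfun_apply (corner k) (blinfun_apply T (unit_l2 j))" by simp
  show ?thesis
  proof (rule l2_eqI)
    fix i
    have "l2_nth (blinfun_apply T (unit_l2 j)) i = (if i < k then entry T i j else 0)"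
      by (subst eq) (simp add: corner_nth entry_def)
    also have "\<dots> = (\<Sum>l<k. if l = i then entry T i j else 0)" by simp
    also have "\<dots> = (\<Sum>l<k. l2_nth (entry T l j *\<^sub>C unit_l2 l) i)"
      by (intro sum.cong refl) (auto simp: scaleC_complex_def)
    finally show "l2_nth (blinfun_apply T (unit_l2 j)) i = l2_nth (\<Sum>l<k. entry T l j *\<^sub>C unit_l2 l) i"
      by (simp only: l2_nth_sum)
  qed
qed

lemma entry_compose:
  assumes "S \<in> bounded_ops" "T \<in> corner_algebra k" "j < k"
  shows "entry (S o\<^sub>L T) i j = (\<Sum>l<k. entry S i l * entry T l j)"
proof -
  have "entry (S o\<^sub>L T) i j = l2_nth (blinfun_apply S (\<Sum>l<k. entry T l j *\<^sub>C unit_l2 l)) i"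
    by (simp add: entry_def[of "S o\<^sub>L T"] corner_algebra_unit[OF assms(2,3)])
  also have "\<dots> = (\<Sum>l<k. entry T l j * entry S i l)"
    by (simp add: blinfun.sum_right bounded_opsD[OF assms(1)] l2_nth_sum entry_def scaleC_complex_def)
  finally show ?thesis by (simp add: mult.commute)
qed

lemma corner_algebra_bounded_ops: "T \<in> corner_algebra k \<Longrightarrow> T \<in> bounded_ops"
  by (auto simp: corner_algebra_def intro: adjointable_in_bounded_ops)

lemma corner_algebra_adjoint:
  assumes "T \<in> corner_algebra k" "is_adjoint T S"
  shows "S \<in> corner_algebra k"
proof -
  have eq: "T o\<^sub>L corner k = corner k o\<^sub>L T" using assms(1) by (simp add: corner_algebra_def)
  have "is_adjoint (T o\<^sub>L corner k) (corner k o\<^sub>L S)" by (rule is_adjoint_compose[OF assms(2) is_adjoint_corner])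
  moreover have "is_adjoint (T o\<^sub>L corner k) (S o\<^sub>L corner k)"
    unfolding eq by (rule is_adjoint_compose[OF is_adjoint_corner assms(2)])
  ultimately have "corner k o\<^sub>L S = S o\<^sub>L corner k" by (rule is_adjoint_unique)
  then show ?thesis using is_adjoint_sym[OF assms(2)] by (auto simp: corner_algebra_def)
qed

lemma entry_simps:
  "entry (S + T) i j = entry S i j + entry T i j"
  "entry (S - T) i j = entry S i j - entry T i j"
  "entry (c *\<^sub>O T) i j = c * entry T i j"
  by (simp_all add: entry_def blinfun.add_left blinfun.diff_left scaleC_complex_def)

lemma corner_trace_adjoint:
  assumes "T \<in> corner_algebra k" "is_adjoint T S"
  shows "corner_trace k (S o\<^sub>L T) = complex_of_real ((\<Sum>i<k. \<Sum>j<k. (cmod (entry T i j))\<^sup>2) / real k)"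
proof -
  have S: "S \<in> bounded_ops" using corner_algebra_adjoint[OF assms] by (rule corner_algebra_bounded_ops)
  have "(\<Sum>j<k. entry (S o\<^sub>L T) j j) = (\<Sum>j<k. \<Sum>i<k. complex_of_real ((cmod (entry T i j))\<^sup>2))"
    by (intro sum.cong refl)
       (simp add: entry_compose[OF S assms(1)] entry_adjoint[OF assms(2)] complex_norm_square
         mult.commute[of "cnj _"] del: of_real_power)
  also have "\<dots> = complex_of_real (\<Sum>i<k. \<Sum>j<k. (cmod (entry T i j))\<^sup>2)"
    by (subst sum.swap) simp
  finally show ?thesis by (simp add: corner_trace_def)
qed

lemma tracial_algebra_corner:
  assumes "k \<ge> 1"
  shows "tracial_algebra (corner_algebra k) (corner_trace k)"
proof
  fix S T :: "complex l2 op" and c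
  show "id_blinfun \<in> corner_algebra k"
    using is_adjoint_id by (auto simp: corner_algebra_def)
  show "corner_trace k id_blinfun = 1"
    using assms by (simp add: corner_trace_def entry_def)
  show "\<exists>C. \<forall>T\<in>corner_algebra k. cmod (corner_trace k T) \<le> C * norm T"
  proof (intro exI[of _ 1] ballI)
    fix T :: "complex l2 op"
    have "cmod (entry T j j) \<le> norm T" for j
    proof -
      have "cmod (entry T j j) \<le> norm (blinfun_apply T (unit_l2 j))"
        unfolding entry_def by (rule l2_nth_le_norm)
      also have "\<dots> \<le> norm T * norm (unit_l2 j)" by (rule norm_blinfun)
      finally show ?thesis by (simp add: norm_l2_single)
    qed
    then have "cmod (\<Sum>j<k. entry T j j) \<le> (\<Sum>j<k. norm T)" by (intro sum_norm_le) auto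
    then show "cmod (corner_trace k T) \<le> 1 * norm T"
      using assms by (simp add: corner_trace_def norm_divide field_simps)
  qed
  assume T: "T \<in> corner_algebra k"
  show "\<exists>S\<in>corner_algebra k. is_adjoint T S"
    using T corner_algebra_adjoint[OF T] by (auto simp: corner_algebra_def)
  show "corner_trace k (c *\<^sub>O T) = c * corner_trace k T"
    by (simp add: corner_trace_def entry_simps sum_distrib_left)
  have Tb: "T \<in> bounded_ops" using T by (rule corner_algebra_bounded_ops)
  have cb: "corner k \<in> bounded_ops" by (rule adjointable_in_bounded_ops[OF is_adjoint_corner])
  obtain T' where T': "is_adjoint T T'" using T by (auto simp: corner_algebra_def)
  show "c *\<^sub>O T \<in> corner_algebra k"
    using T is_adjoint_scaleC[OF T']
    by (auto simp: corner_algebra_def blinfun_compose_scaleC_left blinfun_compose_scaleC_right[OF cb])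
  {
    assume "is_adjoint T S"
    then show "0 \<le> Re (corner_trace k (S o\<^sub>L T))"
      using corner_trace_adjoint[OF T] by (simp add: sum_nonneg)
  }
  assume S: "S \<in> corner_algebra k"
  then have Sb: "S \<in> bounded_ops" by (rule corner_algebra_bounded_ops)
  obtain S' where S': "is_adjoint S S'" using S by (auto simp: corner_algebra_def)
  show "S + T \<in> corner_algebra k"
    using S T is_adjoint_add[OF S' T'] by (auto simp: corner_algebra_def compose_simps)
  have "(S o\<^sub>L T) o\<^sub>L corner k = (S o\<^sub>L corner k) o\<^sub>L T"
    using T by (simp add: corner_algebra_def blinfun_compose_assoc)
  also have "\<dots> = corner k o\<^sub>L (S o\<^sub>L T)" using S by (simp add: corner_algebra_def blinfun_compose_assoc)
  finally show "S o\<^sub>L T \<in> corner_algebra k"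
    using is_adjoint_compose[OF S' T'] by (auto simp: corner_algebra_def)
  show "corner_trace k (S + T) = corner_trace k S + corner_trace k T"
    by (simp add: corner_trace_def entry_simps sum.distrib add_divide_distrib)
  have "(\<Sum>j<k. entry (S o\<^sub>L T) j j) = (\<Sum>j<k. \<Sum>l<k. entry S j l * entry T l j)"
    by (simp add: entry_compose[OF Sb T])
  also have "\<dots> = (\<Sum>l<k. \<Sum>j<k. entry S j l * entry T l j)" by (rule sum.swap)
  also have "\<dots> = (\<Sum>l<k. entry (T o\<^sub>L S) l l)"
    by (simp add: entry_compose[OF Tb S] mult.commute)
  finally show "corner_trace k (S o\<^sub>L T) = corner_trace k (T o\<^sub>L S)" by (simp add: corner_trace_def)
qed

text \<open>The factor k is the square of the sqrt k in \<open>mat_euclidean_norm\<close>: the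
  2-norm bounds the Euclidean distance underlying the Lebesgue measure.\<close>

lemma corner_n2_sq:
  assumes "k \<ge> 1" "T \<in> corner_algebra k"
  shows "real k * (tracial_algebra.n2 (corner_trace k) T)\<^sup>2 = (\<Sum>i<k. \<Sum>j<k. (cmod (entry T i j))\<^sup>2)"
proof -
  interpret tracial_algebra "corner_algebra k" "corner_trace k" by (rule tracial_algebra_corner[OF assms(1)])
  show ?thesis
    using assms corner_trace_adjoint[OF assms(2) is_adjoint_star[OF assms(2)]] by (simp add: n2_sq)
qed

lemma corner_trace_mat_op:
  "corner_trace k (mat_op k A) = normalized_mat_trace k A"
  by (simp add: corner_trace_def normalized_mat_trace_def entry_mat_op)

text \<open>\<open>mat_word\<close> ends in the k x k identity, \<open>op_word\<close> in the
  identity of the whole space; this accounts for the additional corner.\<close>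

lemma mat_word_op:
  assumes "\<And>i. i < m \<Longrightarrow> A i \<in> carrier_mat k k" "set w \<subseteq> {..<m}"
  shows "mat_word k A w \<in> carrier_mat k k \<and> mat_op k (mat_word k A w) = op_word (\<lambda>i. mat_op k (A i)) w o\<^sub>L corner k"
  using assms(2)
proof (induction w)
  case (Cons i w)
  then have i: "A i \<in> carrier_mat k k" by (intro assms(1)) auto
  have eq: "mat_word k A (i # w) = A i * mat_word k A w" by (simp add: mat_word_def)
  show ?case using Cons i by (simp add: eq mat_op_mult blinfun_compose_assoc)
qed (simp add: mat_word_def)

lemma corner_trace_word:
  assumes "\<And>i. i < m \<Longrightarrow> A i \<in> carrier_mat k k" "set w \<subseteq> {..<m}"
  shows "corner_trace k (op_word (\<lambda>i. mat_op k (A i)) w) = normalized_mat_trace k (mat_word k A w)"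
proof -
  have "corner_trace k (T o\<^sub>L corner k) = corner_trace k T" for T
    by (simp add: corner_trace_def entry_def corner_unit)
  then show ?thesis using mat_word_op[of m A k w] assms by (simp flip: corner_trace_mat_op)
qed

lemma norm_finite_support:
  fixes f :: "complex l2"
  assumes "\<And>i. i \<ge> k \<Longrightarrow> l2_nth f i = 0"
  shows "norm f = L2_set (\<lambda>i. cmod (l2_nth f i)) {..<k}"
proof -
  have "(\<lambda>i. (norm (l2_nth f i))\<^sup>2) sums (\<Sum>i<k. (norm (l2_nth f i))\<^sup>2)"
    by (rule sums_finite) (use assms in \<open>auto simp: not_less\<close>)
  then have "(norm f)\<^sup>2 = (\<Sum>i<k. (norm (l2_nth f i))\<^sup>2)" using sums_unique2[OF l2_norm_sums] by blast
  then show ?thesis unfolding L2_set_def by (metis norm_ge_zero real_sqrt_unique)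
qed

lemma norm_mat_op_apply:
  assumes A: "A \<in> carrier_mat k k"
  shows "norm (blinfun_apply (mat_op k A) v) = vec_l2_norm (A *\<^sub>v Matrix.vec k (l2_nth v))"
proof -
  have "norm (blinfun_apply (mat_op k A) v) = L2_set (\<lambda>i. cmod (l2_nth (blinfun_apply (mat_op k A) v) i)) {..<k}"
    by (rule norm_finite_support) (simp add: mat_op_nth)
  also have "\<dots> = vec_l2_norm (A *\<^sub>v Matrix.vec k (l2_nth v))"
    unfolding vec_l2_norm_def using A
    by (intro L2_set_cong) (auto simp: mat_op_nth scalar_prod_def lessThan_atLeast0)
  finally show ?thesis .
qed

text \<open>Carries the norm condition of the microstates, a supremum over k-vectors, over to
  operators on the infinite-dimensional space.\<close>

lemma norm_mat_op_le:
  assumes A: "A \<in> carrier_mat k k"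
  shows "norm (mat_op k A) \<le> mat_opnorm A"
proof -
  have dim: "dim_col A = k" using A by simp
  define lv :: "complex Matrix.vec \<Rightarrow> complex l2" where "lv u = (\<Sum>i<k. l2_single i (vec_index u i))" for u
  have lv_nth: "l2_nth (lv u) i = (if i < k then vec_index u i else 0)" for u i
    by (simp add: lv_def l2_nth_sum)
  have lv_norm: "norm (lv u) = vec_l2_norm u" if "u \<in> carrier_vec k" for u
    using that by (subst norm_finite_support[of k]) (auto simp: lv_nth vec_l2_norm_def intro!: L2_set_cong)
  have lv_vec: "Matrix.vec k (l2_nth (lv u)) = u" if "u \<in> carrier_vec k" for u
    using that by (intro eq_vecI) (auto simp: lv_nth)
  have app: "vec_l2_norm (A *\<^sub>v u) = norm (blinfun_apply (mat_op k A) (lv u))" if "u \<in> carrier_vec k" for u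
    using norm_mat_op_apply[OF A, of "lv u"] lv_vec[OF that] by simp
  \<comment> \<open>A vector gives a lower bound for the real supremum only once the set is known to
    be bounded above; the operator norm of \<open>mat_op k A\<close> supplies the bound.\<close>
  have bdd: "bdd_above ((\<lambda>v. vec_l2_norm (A *\<^sub>v v)) ` {v \<in> carrier_vec k. vec_l2_norm v \<le> 1})"
  proof (rule bdd_aboveI2)
    fix u :: "complex Matrix.vec" assume u: "u \<in> {v \<in> carrier_vec k. vec_l2_norm v \<le> 1}"
    have "norm (blinfun_apply (mat_op k A) (lv u)) \<le> norm (mat_op k A) * norm (lv u)" by (rule norm_blinfun)
    also have "\<dots> \<le> norm (mat_op k A) * 1" using u by (intro mult_left_mono) (auto simp: lv_norm)
    finally show "vec_l2_norm (A *\<^sub>v u) \<le> norm (mat_op k A) * 1" using u by (simp add: app)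
  qed
  have up: "vec_l2_norm (A *\<^sub>v u) \<le> mat_opnorm A" if "u \<in> carrier_vec k" "vec_l2_norm u \<le> 1" for u
    unfolding mat_opnorm_def dim using that by (intro cSUP_upper bdd) auto
  have z: "vec_l2_norm (0\<^sub>v k) \<le> 1" by (simp add: vec_l2_norm_def L2_set_def)
  have "0 \<le> vec_l2_norm (A *\<^sub>v 0\<^sub>v k)" by (simp add: vec_l2_norm_def)
  with up[OF zero_carrier_vec z] have op0: "0 \<le> mat_opnorm A" by linarith
  show ?thesis
  proof (rule norm_blinfun_bound[OF op0])
    fix v
    \<comment> \<open>Only the first k coordinates of v matter. Projecting onto them does not
      increase the norm, and after rescaling the projection is admissible in the supremum.\<close>
    let ?w = "blinfun_apply (corner k) v"
    have wv: "norm ?w \<le> norm v"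
      by (rule l2_norm_le_sum) (auto intro!: order_trans[OF sum_mono l2_sum_le_norm] simp: corner_nth)
    have Aw: "blinfun_apply (mat_op k A) v = blinfun_apply (mat_op k A) ?w"
      by (rule l2_eqI) (auto simp: mat_op_nth[of k A] corner_nth intro!: sum.cong)
    show "norm (blinfun_apply (mat_op k A) v) \<le> mat_opnorm A * norm v"
    proof (cases "?w = 0")
      case True
      then show ?thesis unfolding Aw using op0 by (simp add: blinfun.zero_right)
    next
      case False
      define u where "u = (1 / norm ?w) *\<^sub>R ?w"
      have un: "norm u = 1" using False by (simp add: u_def)
      have u0: "l2_nth u i = 0" if "i \<ge> k" for i using that by (simp add: u_def corner_nth)
      have "vec_l2_norm (Matrix.vec k (l2_nth u)) = norm u"
        using norm_finite_support[OF u0] by (simp add: vec_l2_norm_def L2_set_def)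
      then have "vec_l2_norm (A *\<^sub>v Matrix.vec k (l2_nth u)) \<le> mat_opnorm A"
        using un by (intro up) auto
      then have "norm (blinfun_apply (mat_op k A) u) \<le> mat_opnorm A" by (simp add: norm_mat_op_apply[OF A])
      then have "norm (blinfun_apply (mat_op k A) ?w) \<le> mat_opnorm A * norm ?w"
        using False by (simp add: u_def blinfun.scaleR_right field_simps)
      also have "\<dots> \<le> mat_opnorm A * norm v" using op0 wv by (intro mult_left_mono)
      finally show ?thesis unfolding Aw .
    qed
  qed
qed

section \<open>Real coordinates of self-adjoint matrices\<close>

lemma sum_symmetrized_le:
  fixes f g :: "nat \<Rightarrow> nat \<Rightarrow> real"
  assumes "\<And>i j. i < k \<Longrightarrow> j < k \<Longrightarrow> f i j + f j i \<le> g i j + g j i"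
  shows "(\<Sum>i<k. \<Sum>j<k. f i j) \<le> (\<Sum>i<k. \<Sum>j<k. g i j)"
proof -
  \<comment> \<open>Coordinates and matrix entries mix the positions (i, j) and (j, i), so the two
    sums become comparable termwise only after symmetrising.\<close>
  have sym: "(\<Sum>i<k. \<Sum>j<k. h i j + h j i) = 2 * (\<Sum>i<k. \<Sum>j<k. h i j)" for h :: "nat \<Rightarrow> nat \<Rightarrow> real"
    using sum.swap[of "\<lambda>i j. h j i" "{..<k}" "{..<k}"] by (simp add: sum.distrib)
  have "(\<Sum>i<k. \<Sum>j<k. f i j + f j i) \<le> (\<Sum>i<k. \<Sum>j<k. g i j + g j i)"
    by (intro sum_mono assms) auto
  then show ?thesis unfolding sym by simp
qed

lemma sa_mat_of_coords_dist_le: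
  "(\<Sum>i<k. \<Sum>j<k. (t (i, j) - t' (i, j))\<^sup>2)
    \<le> (\<Sum>i<k. \<Sum>j<k. (cmod (sa_mat_of_coords k t $$ (i, j) - sa_mat_of_coords k t' $$ (i, j)))\<^sup>2)"
proof (rule sum_symmetrized_le)
  fix i j assume "i < k" "j < k"
  then show "(t (i, j) - t' (i, j))\<^sup>2 + (t (j, i) - t' (j, i))\<^sup>2
    \<le> (cmod (sa_mat_of_coords k t $$ (i, j) - sa_mat_of_coords k t' $$ (i, j)))\<^sup>2
      + (cmod (sa_mat_of_coords k t $$ (j, i) - sa_mat_of_coords k t' $$ (j, i)))\<^sup>2"
    by (cases i j rule: linorder_cases)
       (auto simp: sa_mat_of_coords_def cmod_power2 power_divide power2_commute[of "t' _"] simp flip: diff_divide_distrib)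
qed

text \<open>Real parts on and above the diagonal, imaginary parts below it: k^2 independent reals
  instead of 2 k^2. They are not scaled to be isometric, which costs a factor of at most 2 in
  squared norms.\<close>

definition sa_coord :: "complex l2 op \<Rightarrow> nat \<times> nat \<Rightarrow> real" where
  "sa_coord B = (\<lambda>(a, b). if a \<le> b then Re (entry B a b) else Im (entry B b a))"

lemma sa_coord_diff: "sa_coord (B - B') p = sa_coord B p - sa_coord B' p"
  by (simp add: sa_coord_def entry_simps split: prod.split)

lemma sa_coord_bounds:
  assumes "self_adjoint B"
  shows "(\<Sum>i<k. \<Sum>j<k. (sa_coord B (i, j))\<^sup>2) \<le> (\<Sum>i<k. \<Sum>j<k. (cmod (entry B i j))\<^sup>2)"
    and "(\<Sum>i<k. \<Sum>j<k. (cmod (entry B i j))\<^sup>2) \<le> 2 * (\<Sum>i<k. \<Sum>j<k. (sa_coord B (i, j))\<^sup>2)"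
proof -
  have adj: "entry B i j = cnj (entry B j i)" for i j
    using assms unfolding self_adjoint_def by (rule entry_adjoint)
  have Im0: "Im (entry B i i) = 0" for i using arg_cong[OF adj[of i i], of Im] by simp
  show "(\<Sum>i<k. \<Sum>j<k. (sa_coord B (i, j))\<^sup>2) \<le> (\<Sum>i<k. \<Sum>j<k. (cmod (entry B i j))\<^sup>2)"
  proof (rule sum_symmetrized_le)
    fix i j
    show "(sa_coord B (i, j))\<^sup>2 + (sa_coord B (j, i))\<^sup>2 \<le> (cmod (entry B i j))\<^sup>2 + (cmod (entry B j i))\<^sup>2"
      by (cases i j rule: linorder_cases) (auto simp: sa_coord_def cmod_power2)
  qed
  have "(\<Sum>i<k. \<Sum>j<k. (cmod (entry B i j))\<^sup>2) \<le> (\<Sum>i<k. \<Sum>j<k. 2 * (sa_coord B (i, j))\<^sup>2)"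
  proof (rule sum_symmetrized_le)
    fix i j
    show "(cmod (entry B i j))\<^sup>2 + (cmod (entry B j i))\<^sup>2 \<le> 2 * (sa_coord B (i, j))\<^sup>2 + 2 * (sa_coord B (j, i))\<^sup>2"
      using adj[of i j] Im0[of i]
      by (cases i j rule: linorder_cases) (auto simp: sa_coord_def cmod_power2)
  qed
  then show "(\<Sum>i<k. \<Sum>j<k. (cmod (entry B i j))\<^sup>2) \<le> 2 * (\<Sum>i<k. \<Sum>j<k. (sa_coord B (i, j))\<^sup>2)"
    by (simp add: sum_distrib_left)
qed

section \<open>Counting and volume\<close>

lemma sum_exp_int_le:
  assumes "\<kappa> > 0"
  shows "(\<Sum>z\<in>{- int D..int D}. exp (- \<bar>real_of_int z\<bar> / \<kappa>)) \<le> 1 + 2 * \<kappa>"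
proof -
  define q where "q = exp (- 1 / \<kappa>)"
  have q: "0 < q" "q < 1" using assms by (simp_all add: q_def)
  have pow: "exp (- real n / \<kappa>) = q ^ n" for n
    by (simp add: q_def flip: exp_of_nat_mult)
  \<comment> \<open>Rearranged, this is q / (1 - q) \<le> \<kappa>, a bound for the geometric series
    that does not involve D.\<close>
  have "1 + 1 / \<kappa> \<le> exp (1 / \<kappa>)" by (rule exp_ge_add_one_self)
  then have "(1 + 1 / \<kappa>) * q \<le> exp (1 / \<kappa>) * q" using q by (intro mult_right_mono) auto
  also have "\<dots> = 1" by (simp add: q_def flip: exp_add)
  finally have q_le: "q \<le> \<kappa> * (1 - q)" using assms by (simp add: field_simps)
  have split: "(\<Sum>z\<in>{- int D..int D}. exp (- \<bar>real_of_int z\<bar> / \<kappa>)) = 1 + 2 * (\<Sum>n=1..D. q ^ n)"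
  proof (induction D)
    case (Suc D)
    have "{- int (Suc D)..int (Suc D)} = insert (int (Suc D)) (insert (- int (Suc D)) {- int D..int D})" by auto
    then have "(\<Sum>z\<in>{- int (Suc D)..int (Suc D)}. exp (- \<bar>real_of_int z\<bar> / \<kappa>)) =
        2 * exp (- real (Suc D) / \<kappa>) + (\<Sum>z\<in>{- int D..int D}. exp (- \<bar>real_of_int z\<bar> / \<kappa>))"
      by (simp add: add_divide_distrib diff_divide_distrib)
    then show ?case unfolding pow Suc by simp
  qed simp
  have tel: "(\<Sum>n=1..D. q ^ n) * (1 - q) = q - q ^ Suc D"
  proof (induction D)
    case (Suc D)
    have "(\<Sum>n=1..Suc D. q ^ n) * (1 - q) = (\<Sum>n=1..D. q ^ n) * (1 - q) + q ^ Suc D * (1 - q)"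
      by (simp add: distrib_right)
    then show ?case by (simp only: Suc) (simp add: algebra_simps)
  qed simp
  have "(\<Sum>n=1..D. q ^ n) * (1 - q) \<le> \<kappa> * (1 - q)"
    unfolding tel using q q_le by (smt (verit) zero_le_power)
  then have "(\<Sum>n=1..D. q ^ n) \<le> \<kappa>" using q by simp
  then show ?thesis unfolding split by simp
qed

text \<open>An exponential moment bound. Give each point the product of the weights exp (1 - |z_p| /
  \<kappa>). Points of Z have weight at least 1, and the total weight factorises over coordinates.
  Counting a box would not do: single coordinates may be as large as \<kappa> card J, and the base
  has to be independent of J.\<close>

lemma card_integer_points_le:
  assumes "finite J" "\<kappa> > 0"
  defines "Z \<equiv> {z \<in> J \<rightarrow>\<^sub>E UNIV. (\<Sum>p\<in>J. \<bar>real_of_int (z p)\<bar>) \<le> \<kappa> * real (card J)}"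
  shows "finite Z" "real (card Z) \<le> (exp 1 * (1 + 2 * \<kappa>)) ^ card J"
proof -
  \<comment> \<open>Any finite box containing Z would serve; D does not enter the final
    bound.\<close>
  define D where "D = nat \<lceil>\<kappa> * real (card J)\<rceil>"
  define F where "F = J \<rightarrow>\<^sub>E {- int D..int D}"
  have finF: "finite F" unfolding F_def using assms(1) by (intro finite_PiE) auto
  have ZF: "Z \<subseteq> F"
  proof
    fix z assume z: "z \<in> Z"
    have "z p \<in> {- int D..int D}" if "p \<in> J" for p
    proof -
      have "\<bar>real_of_int (z p)\<bar> \<le> (\<Sum>p\<in>J. \<bar>real_of_int (z p)\<bar>)"
        using that assms(1) by (intro member_le_sum) auto
      also have "\<dots> \<le> \<kappa> * real (card J)" using z by (simp add: Z_def)
      also have "\<dots> \<le> real D" unfolding D_def by (rule real_nat_ceiling_ge)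
      finally show ?thesis by (simp add: abs_le_iff)
    qed
    then show "z \<in> F" using z by (auto simp: F_def Z_def PiE_def)
  qed
  then show "finite Z" using finF finite_subset by blast
  define f where "f z = exp 1 * exp (- \<bar>real_of_int z\<bar> / \<kappa>)" for z
  have f0: "0 \<le> f z" for z by (simp add: f_def)
  have one: "1 \<le> (\<Prod>p\<in>J. f (z p))" if "z \<in> Z" for z
  proof -
    have "(\<Sum>p\<in>J. \<bar>real_of_int (z p)\<bar> / \<kappa>) \<le> real (card J)"
      using that assms(2) by (simp add: Z_def field_simps flip: sum_divide_distrib)
    then have "0 \<le> (\<Sum>p\<in>J. 1 + - \<bar>real_of_int (z p)\<bar> / \<kappa>)"
      by (simp add: sum_subtractf)
    then have "1 \<le> exp (\<Sum>p\<in>J. 1 + - \<bar>real_of_int (z p)\<bar> / \<kappa>)" by simp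
    also have "\<dots> = (\<Prod>p\<in>J. f (z p))"
      unfolding f_def exp_add[symmetric] using assms(1) by (rule exp_sum)
    finally show ?thesis .
  qed
  have "real (card Z) = (\<Sum>z\<in>Z. 1)" by simp
  also have "\<dots> \<le> (\<Sum>z\<in>Z. \<Prod>p\<in>J. f (z p))" by (intro sum_mono one)
  also have "\<dots> \<le> (\<Sum>z\<in>F. \<Prod>p\<in>J. f (z p))"
    using ZF finF by (intro sum_mono2) (auto intro: prod_nonneg f0)
  also have "\<dots> = (\<Prod>p\<in>J. \<Sum>z\<in>{- int D..int D}. f z)"
    unfolding F_def using assms(1) by (intro prod_sum_PiE[symmetric]) auto
  also have "\<dots> \<le> (\<Prod>p\<in>J. exp 1 * (1 + 2 * \<kappa>))"
    unfolding f_def sum_distrib_left[symmetric]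
    by (intro prod_mono conjI mult_nonneg_nonneg sum_nonneg mult_left_mono sum_exp_int_le assms(2)) auto
  finally show "real (card Z) \<le> (exp 1 * (1 + 2 * \<kappa>)) ^ card J" by simp
qed

text \<open>S is split into cells by rounding \<beta> to multiples of h. The representatives are
  taken from S rather than from the grid, because the estimates on B are known only at actual
  microstates.\<close>

lemma grid_representatives:
  fixes \<beta> :: "'s \<Rightarrow> 'p \<Rightarrow> real"
  assumes J: "finite J" and "h > 0" "\<kappa> > 0"
    and bd: "\<And>s. s \<in> S \<Longrightarrow> (\<Sum>p\<in>J. \<bar>\<beta> s p\<bar>) \<le> (\<kappa> - 1) * h * real (card J)"
  shows "\<exists>T\<subseteq>S. finite T \<and> real (card T) \<le> (exp 1 * (1 + 2 * \<kappa>)) ^ card J \<and>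
    (\<forall>s\<in>S. \<exists>s'\<in>T. \<forall>p\<in>J. \<bar>\<beta> s p - \<beta> s' p\<bar> \<le> h)"
proof -
  define z where "z s = (\<lambda>p\<in>J. \<lfloor>\<beta> s p / h\<rfloor>)" for s
  define Z where "Z = {z \<in> J \<rightarrow>\<^sub>E UNIV. (\<Sum>p\<in>J. \<bar>real_of_int (z p)\<bar>) \<le> \<kappa> * real (card J)}"
  note card = card_integer_points_le[OF J \<open>\<kappa> > 0\<close>, folded Z_def]
  have zZ: "z s \<in> Z" if "s \<in> S" for s
  proof -
    \<comment> \<open>Rounding costs at most 1 per coordinate, hence \<kappa> - 1 in the
      hypothesis.\<close>
    have fl: "\<bar>real_of_int \<lfloor>u\<rfloor>\<bar> \<le> \<bar>u\<bar> + 1" for u :: real by linarith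
    have "(\<Sum>p\<in>J. \<bar>real_of_int (z s p)\<bar>) \<le> (\<Sum>p\<in>J. \<bar>\<beta> s p / h\<bar> + 1)"
      unfolding z_def using fl by (intro sum_mono) (simp del: abs_divide)
    also have "\<dots> = (\<Sum>p\<in>J. \<bar>\<beta> s p\<bar>) / h + real (card J)"
      using \<open>h > 0\<close> by (simp add: sum.distrib sum_divide_distrib)
    also have "\<dots> \<le> \<kappa> * real (card J)"
      using bd[OF that] \<open>h > 0\<close> by (simp add: field_simps)
    finally show ?thesis by (simp add: Z_def z_def)
  qed
  define T where "T = inv_into S z ` (z ` S)"
  have "z ` S \<subseteq> Z" using zZ by blast
  then have fin: "finite (z ` S)" and le: "card (z ` S) \<le> card Z"
    using card(1) finite_subset card_mono by blast+
  have "card T \<le> card (z ` S)" unfolding T_def by (rule card_image_le[OF fin])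
  then have c: "real (card T) \<le> (exp 1 * (1 + 2 * \<kappa>)) ^ card J" using le card(2) by linarith
  have TS: "T \<subseteq> S" unfolding T_def by (auto intro: inv_into_into)
  have rep: "\<exists>s'\<in>T. \<forall>p\<in>J. \<bar>\<beta> s p - \<beta> s' p\<bar> \<le> h" if "s \<in> S" for s
  proof (rule bexI[of _ "inv_into S z (z s)"], rule ballI)
    let ?s' = "inv_into S z (z s)"
    have eq: "z ?s' = z s" using that by (intro f_inv_into_f) auto
    fix p assume p: "p \<in> J"
    have "\<lfloor>\<beta> ?s' p / h\<rfloor> = \<lfloor>\<beta> s p / h\<rfloor>"
      using fun_cong[OF eq, of p] p by (simp add: z_def)
    then have "\<bar>\<beta> s p / h - \<beta> ?s' p / h\<bar> \<le> 1" by linarith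
    then have "\<bar>\<beta> s p - \<beta> ?s' p\<bar> / h \<le> 1" using \<open>h > 0\<close> by (simp flip: diff_divide_distrib)
    then show "\<bar>\<beta> s p - \<beta> ?s' p\<bar> \<le> h" using \<open>h > 0\<close> by simp
  qed (use that in \<open>simp add: T_def\<close>)
  show ?thesis using TS fin c rep by (intro exI[of _ T]) (simp add: T_def)
qed

text \<open>The indicator of the ball lies below a multiple of a product Gaussian density, whose
  integral is the bound. This gives the order r / sqrt (card J) per dimension without the Gamma
  function.\<close>

lemma emeasure_l2_ball_le:
  fixes c :: "'p \<Rightarrow> real"
  assumes J: "finite J" "J \<noteq> {}" and r: "r > 0"
  defines "\<mu> \<equiv> (\<Pi>\<^sub>M p\<in>J. (lborel :: real measure))"
  shows "{t \<in> space \<mu>. (\<Sum>p\<in>J. (t p - c p)\<^sup>2) \<le> r\<^sup>2} \<in> sets \<mu>"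
    and "emeasure \<mu> {t \<in> space \<mu>. (\<Sum>p\<in>J. (t p - c p)\<^sup>2) \<le> r\<^sup>2}
      \<le> ennreal ((sqrt (2 * pi * exp 1) * r / sqrt (real (card J))) ^ card J)"
proof -
  let ?B = "{t \<in> space \<mu>. (\<Sum>p\<in>J. (t p - c p)\<^sup>2) \<le> r\<^sup>2}"
  show B: "?B \<in> sets \<mu>" unfolding \<mu>_def by measurable
  interpret product_sigma_finite "\<lambda>p::'p. lborel :: real measure" ..
  define d where "d = real (card J)"
  have d: "d > 0" using J by (simp add: d_def card_gt_0_iff)
  \<comment> \<open>With this variance the sum of (t_p - c_p)^2 / (2 \<sigma>^2) is at most d / 2 on
    the ball, exactly compensated by the 1/2 that C adds per coordinate.\<close>
  define \<sigma> where "\<sigma> = r / sqrt d"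
  have \<sigma>: "\<sigma> > 0" using r d by (simp add: \<sigma>_def)
  have \<sigma>2: "\<sigma>\<^sup>2 = r\<^sup>2 / d" using d by (simp add: \<sigma>_def power_divide)
  define C where "C = sqrt (2 * pi * exp 1) * \<sigma>"
  have C: "C > 0" using \<sigma> by (simp add: C_def)
  have dens: "C * normal_density a \<sigma> u = exp (1/2 - (u - a)\<^sup>2 / (2 * \<sigma>\<^sup>2))" for a u
  proof -
    have "C = sqrt (2 * pi * \<sigma>\<^sup>2) * exp (1/2)"
    proof -
      have "sqrt (exp 1 :: real) = exp (1/2)"
        by (rule real_sqrt_unique) (simp_all add: power2_eq_square flip: exp_add)
      then show ?thesis using \<sigma> by (simp add: C_def real_sqrt_mult)
    qed
    moreover have "sqrt (2 * pi * \<sigma>\<^sup>2) > 0" using \<sigma> by simp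
    moreover have "exp (1/2 - (u - a)\<^sup>2 / (2 * \<sigma>\<^sup>2)) = exp (1/2) * exp (- (u - a)\<^sup>2 / (2 * \<sigma>\<^sup>2))"
      by (simp flip: exp_add)
    ultimately show ?thesis unfolding normal_density_def using \<sigma> by simp
  qed
  have ind: "indicator ?B t \<le> (\<Prod>p\<in>J. ennreal (C * normal_density (c p) \<sigma> (t p)))" for t
  proof (cases "t \<in> ?B")
    case True
    then have "(\<Sum>p\<in>J. (t p - c p)\<^sup>2) / (2 * \<sigma>\<^sup>2) \<le> r\<^sup>2 / (2 * \<sigma>\<^sup>2)"
      by (intro divide_right_mono) auto
    also have "\<dots> = d / 2" using r d by (simp add: \<sigma>2)
    finally have "0 \<le> (\<Sum>p\<in>J. 1/2 - (t p - c p)\<^sup>2 / (2 * \<sigma>\<^sup>2))"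
      by (simp add: sum_subtractf sum_divide_distrib d_def)
    then have "1 \<le> exp (\<Sum>p\<in>J. 1/2 - (t p - c p)\<^sup>2 / (2 * \<sigma>\<^sup>2))" by simp
    also have "\<dots> = (\<Prod>p\<in>J. C * normal_density (c p) \<sigma> (t p))"
      unfolding dens using J(1) by (rule exp_sum)
    finally have "ennreal 1 \<le> ennreal (\<Prod>p\<in>J. C * normal_density (c p) \<sigma> (t p))" by (rule ennreal_leI)
    also have "\<dots> = (\<Prod>p\<in>J. ennreal (C * normal_density (c p) \<sigma> (t p)))"
      using C by (intro prod_ennreal[symmetric]) auto
    finally show ?thesis using True by simp
  qed simp
  have "emeasure \<mu> ?B = (\<integral>\<^sup>+t. indicator ?B t \<partial>\<mu>)" using B by simp
  also have "\<dots> \<le> (\<integral>\<^sup>+t. (\<Prod>p\<in>J. ennreal (C * normal_density (c p) \<sigma> (t p))) \<partial>\<mu>)"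
    by (intro nn_integral_mono ind)
  also have "\<dots> = (\<Prod>p\<in>J. \<integral>\<^sup>+u. ennreal (C * normal_density (c p) \<sigma> u) \<partial>lborel)"
    unfolding \<mu>_def by (rule product_nn_integral_prod[OF J(1)]) measurable
  also have "\<dots> = (\<Prod>p\<in>J. ennreal C)"
  proof (rule prod.cong[OF refl])
    fix p
    have "(\<integral>\<^sup>+u. ennreal (C * normal_density (c p) \<sigma> u) \<partial>lborel) = ennreal (\<integral>u. C * normal_density (c p) \<sigma> u \<partial>lborel)"
      using C \<sigma> by (intro nn_integral_eq_integral) auto
    then show "(\<integral>\<^sup>+u. ennreal (C * normal_density (c p) \<sigma> u) \<partial>lborel) = ennreal C"
      using \<sigma> by simp
  qed
  also have "\<dots> = ennreal ((sqrt (2 * pi * exp 1) * r / sqrt (real (card J))) ^ card J)"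
    using C by (simp add: ennreal_power C_def \<sigma>_def d_def)
  finally show "emeasure \<mu> ?B \<le> ennreal ((sqrt (2 * pi * exp 1) * r / sqrt (real (card J))) ^ card J)" .
qed

section \<open>The volume of a microstate space\<close>

text \<open>The cell width is fitted to this: k^2 coordinates differing by at most \<delta> / (2
  sqrt k) give 2 k^2 \<delta>^2 / (4 k) = k \<delta>^2 / 2.\<close>

lemma n2_corner_le_coord:
  assumes "k \<ge> 1" "B \<in> corner_algebra k" "B' \<in> corner_algebra k" "self_adjoint B" "self_adjoint B'" "0 \<le> \<delta>"
    and cell: "\<And>a b. a < k \<Longrightarrow> b < k \<Longrightarrow> \<bar>sa_coord B (a, b) - sa_coord B' (a, b)\<bar> \<le> \<delta> / (2 * sqrt (real k))"
  shows "tracial_algebra.n2 (corner_trace k) (B - B') \<le> \<delta>"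
proof -
  interpret tracial_algebra "corner_algebra k" "corner_trace k" by (rule tracial_algebra_corner[OF assms(1)])
  have k: "real k > 0" using assms(1) by simp
  have D: "B - B' \<in> corner_algebra k" by (rule diff_in[OF assms(2,3)])
  have sa: "self_adjoint (B - B')" using assms(4,5) unfolding self_adjoint_def by (rule is_adjoint_diff)
  have "real k * (n2 (B - B'))\<^sup>2 \<le> 2 * (\<Sum>i<k. \<Sum>j<k. (sa_coord (B - B') (i, j))\<^sup>2)"
    unfolding corner_n2_sq[OF assms(1) D] by (rule sa_coord_bounds(2)[OF sa])
  also have "\<dots> \<le> 2 * (\<Sum>i<k. \<Sum>j<k. (\<delta> / (2 * sqrt (real k)))\<^sup>2)"
    unfolding sa_coord_diff using cell assms(6) by (intro mult_left_mono sum_mono abs_le_square_iff[THEN iffD1]) auto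
  also have "\<dots> = real k * (\<delta>\<^sup>2 / 2)"
    using k by (simp add: power_divide power_mult_distrib field_simps)
  finally have "(n2 (B - B'))\<^sup>2 \<le> \<delta>\<^sup>2 / 2" using k by simp
  then have "(n2 (B - B'))\<^sup>2 \<le> \<delta>\<^sup>2" using zero_le_power2[of \<delta>] by linarith
  then show ?thesis by (rule power2_le_imp_le) (rule assms(6))
qed

text \<open>Cauchy-Schwarz over the k^2 coordinates of each B_j. The mean absolute coordinate is
  thus at most \<rho> / sqrt k, the same order in k as the cell width, so the counting constant does
  not depend on k.\<close>

lemma sum_abs_coord_le:
  assumes "k \<ge> 1" "0 \<le> \<rho>"
    and B: "\<And>j. j < n \<Longrightarrow> B j \<in> corner_algebra k" "\<And>j. j < n \<Longrightarrow> self_adjoint (B j)"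
      "\<And>j. j < n \<Longrightarrow> norm (B j) \<le> \<rho>"
  shows "(\<Sum>(j, p)\<in>{..<n} \<times> {..<k} \<times> {..<k}. \<bar>sa_coord (B j) p\<bar>) \<le> real n * real k * sqrt (real k) * \<rho>"
proof -
  interpret tracial_algebra "corner_algebra k" "corner_trace k" by (rule tracial_algebra_corner[OF assms(1)])
  have one: "(\<Sum>p\<in>{..<k} \<times> {..<k}. \<bar>sa_coord (B j) p\<bar>) \<le> real k * sqrt (real k) * \<rho>" if j: "j < n" for j
  proof -
    have "(\<Sum>p\<in>{..<k} \<times> {..<k}. (sa_coord (B j) p)\<^sup>2) = (\<Sum>a<k. \<Sum>b<k. (sa_coord (B j) (a, b))\<^sup>2)"
      by (simp add: sum.cartesian_product)
    also have "\<dots> \<le> real k * (n2 (B j))\<^sup>2"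
      unfolding corner_n2_sq[OF assms(1) B(1)[OF j]] by (rule sa_coord_bounds(1)[OF B(2)[OF j]])
    also have "\<dots> \<le> real k * \<rho>\<^sup>2"
      using n2_le_norm[OF B(1)[OF j]] B(3)[OF j] n2_nonneg[OF B(1)[OF j]]
      by (intro mult_left_mono power_mono) auto
    finally have sq: "(\<Sum>p\<in>{..<k} \<times> {..<k}. (sa_coord (B j) p)\<^sup>2) \<le> real k * \<rho>\<^sup>2" .
    have "(\<Sum>p\<in>{..<k} \<times> {..<k}. \<bar>sa_coord (B j) p\<bar> * \<bar>1\<bar>)
        \<le> L2_set (sa_coord (B j)) ({..<k} \<times> {..<k}) * L2_set (\<lambda>_. 1) ({..<k} \<times> {..<k})"
      by (rule L2_set_mult_ineq)
    also have "L2_set (\<lambda>_. 1 :: real) ({..<k} \<times> {..<k}) = real k"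
      by (simp add: L2_set_def)
    also have "L2_set (sa_coord (B j)) ({..<k} \<times> {..<k}) \<le> sqrt (real k * \<rho>\<^sup>2)"
      unfolding L2_set_def using sq by (rule real_sqrt_le_mono)
    also have "sqrt (real k * \<rho>\<^sup>2) = sqrt (real k) * \<rho>" using assms(2) by (simp add: real_sqrt_mult)
    finally show ?thesis by (simp add: mult_ac mult_right_mono)
  qed
  have "(\<Sum>(j, p)\<in>{..<n} \<times> {..<k} \<times> {..<k}. \<bar>sa_coord (B j) p\<bar>) = (\<Sum>j<n. \<Sum>p\<in>{..<k} \<times> {..<k}. \<bar>sa_coord (B j) p\<bar>)"
    by (rule sum.cartesian_product[symmetric])
  also have "\<dots> \<le> (\<Sum>j<n. real k * sqrt (real k) * \<rho>)" by (intro sum_mono one) simp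
  finally show ?thesis by simp
qed

lemma coords_dist_le:
  assumes "k \<ge> 1"
    and d: "tracial_algebra.n2 (corner_trace k)
      (mat_op k (sa_mat_of_coords k t) - mat_op k (sa_mat_of_coords k t')) \<le> \<delta>"
  shows "(\<Sum>p\<in>{..<k} \<times> {..<k}. (t p - t' p)\<^sup>2) \<le> real k * \<delta>\<^sup>2"
proof -
  interpret tracial_algebra "corner_algebra k" "corner_trace k" by (rule tracial_algebra_corner[OF assms(1)])
  let ?T = "mat_op k (sa_mat_of_coords k t) - mat_op k (sa_mat_of_coords k t')"
  have T: "?T \<in> corner_algebra k"
    by (intro diff_in mat_op_in_corner_algebra sa_mat_of_coords_in_sa_mats)
  have "(\<Sum>p\<in>{..<k} \<times> {..<k}. (t p - t' p)\<^sup>2) = (\<Sum>i<k. \<Sum>j<k. (t (i, j) - t' (i, j))\<^sup>2)"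
    by (simp add: sum.cartesian_product)
  also have "\<dots> \<le> (\<Sum>i<k. \<Sum>j<k. (cmod (sa_mat_of_coords k t $$ (i, j) - sa_mat_of_coords k t' $$ (i, j)))\<^sup>2)"
    by (rule sa_mat_of_coords_dist_le)
  also have "\<dots> = (\<Sum>i<k. \<Sum>j<k. (cmod (entry ?T i j))\<^sup>2)"
    by (intro sum.cong refl) (simp add: entry_simps entry_mat_op)
  also have "\<dots> = real k * (n2 ?T)\<^sup>2" by (rule corner_n2_sq[OF assms(1) T, symmetric])
  also have "\<dots> \<le> real k * \<delta>\<^sup>2" using d n2_nonneg[OF T] by (intro mult_left_mono power_mono) auto
  finally show ?thesis .
qed

text \<open>Here q and \<epsilon> may depend on \<delta>, but not on k. The exponent n k^2 counts
  cells for B and m k^2 is the dimension of the balls around A; the opposite powers of \<delta>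
  leave \<delta> to the power (m - n) k^2.\<close>

lemma microstate_volume_le:
  fixes M :: "'h::complex_hilbert_space op set" and x y :: "nat \<Rightarrow> 'h op"
  assumes vN: "von_neumann_algebra M" and tr: "normalized_faithful_normal_trace M \<tau>"
    and x: "\<And>i. i < m \<Longrightarrow> x i \<in> M" "\<And>i. i < m \<Longrightarrow> self_adjoint (x i)"
    and y: "\<And>j. j < n \<Longrightarrow> y j \<in> M" "\<And>j. j < n \<Longrightarrow> self_adjoint (y j)"
      "\<And>j. j < n \<Longrightarrow> y j \<in> commutant (commutant (x ` {..<m}))"
    and b: "\<And>j. j < n \<Longrightarrow> norm (y j) < b" and \<rho>: "0 < b" "b < \<rho>" "\<rho> < R"
    and P: "\<And>i. i < m \<Longrightarrow> radius_of_convergence n (P i) R"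
    and xP: "\<And>i. i < m \<Longrightarrow> x i = nc_power_series_eval n (P i) y"
    and L: "\<And>i N. i < m \<Longrightarrow> (\<Sum>k<N. \<Sum>w\<in>words n k. cmod (P i w) * (real k * \<rho> ^ (k - 1))) \<le> L" "0 \<le> L"
    and \<delta>: "\<delta> > 0" "\<delta> \<le> 1" and "m \<ge> 1"
  shows "\<exists>q \<epsilon>. \<epsilon> > 0 \<and> (\<forall>k\<ge>1. sa_tuple_volume m k (microstates \<tau> m x R0 q k \<epsilon>) \<le>
    ennreal ((exp 1 * (3 + 4 * \<rho>) / \<delta>) ^ (n * k\<^sup>2) *
      (sqrt (2 * pi * exp 1) * (2 + L) * \<delta> / sqrt (real k)) ^ (m * k\<^sup>2)))"
proof -
  obtain q \<epsilon> Z N where "\<epsilon> > 0" and Z: "\<And>j. j < n \<Longrightarrow> nc_vars m (Z j)"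
    and approximation: "\<forall>N' \<tau>'. \<forall>X :: nat \<Rightarrow> complex l2 op. tracial_algebra N' \<tau>' \<longrightarrow>
      (\<forall>i<m. X i \<in> N' \<and> self_adjoint (X i) \<and> norm (X i) \<le> R0) \<longrightarrow>
      (\<forall>s w. 1 \<le> s \<and> s \<le> q \<and> w \<in> words m s \<longrightarrow> cmod (\<tau> (op_word x w) - \<tau>' (op_word X w)) < \<epsilon>) \<longrightarrow>
      (\<forall>j<n. self_adjoint (nc_eval (Z j) X) \<and> norm (nc_eval (Z j) X) \<le> \<rho>) \<and>
      (\<forall>i<m. tracial_algebra.n2 \<tau>' (X i - nc_trunc N n (P i) (\<lambda>j. nc_eval (Z j) X)) \<le> \<delta>)"
    by (rule microstate_approximation[where x = x and y = y and m = m and n = n and P = P and \<rho> = \<rho>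
          and R = R and b = b and L = L, OF vN tr x y b \<rho> P xP L \<delta>(1)]) (assumption | rule that)+
  note approx = approximation[THEN spec, THEN spec, THEN spec, THEN mp, THEN mp, THEN mp]
  have "sa_tuple_volume m k (microstates \<tau> m x R0 q k \<epsilon>) \<le>
    ennreal ((exp 1 * (3 + 4 * \<rho>) / \<delta>) ^ (n * k\<^sup>2) *
      (sqrt (2 * pi * exp 1) * (2 + L) * \<delta> / sqrt (real k)) ^ (m * k\<^sup>2))" if k: "k \<ge> 1" for k
  proof -
    interpret tracial_algebra "corner_algebra k" "corner_trace k" by (rule tracial_algebra_corner[OF k])
    have k0: "real k > 0" using k by simp
    have \<rho>0: "0 < \<rho>" using \<rho> by linarith
    define I where "I = {..<m} \<times> {..<k} \<times> {..<k}"
    define J where "J = {..<n} \<times> {..<k} \<times> {..<k}"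
    have fI: "finite I" "I \<noteq> {}" and cI: "card I = m * k\<^sup>2" and fJ: "finite J" and cJ: "card J = n * k\<^sup>2"
      using k \<open>m \<ge> 1\<close> by (auto simp: I_def J_def power2_eq_square lessThan_empty_iff)
    define \<mu> where "\<mu> = (\<Pi>\<^sub>M p\<in>I. (lborel :: real measure))"
    define A where "A t = (\<lambda>l\<in>{..<m}. sa_mat_of_coords k (\<lambda>p. t (l, p)))" for t :: "nat \<times> nat \<times> nat \<Rightarrow> real"
    define S where "S = {t \<in> space \<mu>. A t \<in> microstates \<tau> m x R0 q k \<epsilon>}"
    define X where "X t i = mat_op k (A t i)" for t i
    define B where "B t j = nc_eval (Z j) (X t)" for t j
    have A: "A t i = sa_mat_of_coords k (\<lambda>p. t (i, p))" if "i < m" for t i using that by (simp add: A_def)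
    have Asa: "A t i \<in> sa_mats k" if "i < m" for t i
      unfolding A[OF that] by (rule sa_mat_of_coords_in_sa_mats)
    have Ac: "A t i \<in> carrier_mat k k" if "i < m" for t i using Asa[OF that] unfolding sa_mats_def by blast
    have Xin: "X t i \<in> corner_algebra k" "self_adjoint (X t i)" if "i < m" for t i
      unfolding X_def using Asa[OF that] by (rule mat_op_in_corner_algebra self_adjoint_mat_op)+
    have Bin: "B t j \<in> corner_algebra k" if "j < n" for t j
      unfolding B_def by (rule nc_eval_in[of m]) (use Xin Z that in auto)
    have S_prop: "(\<forall>j<n. self_adjoint (B t j) \<and> norm (B t j) \<le> \<rho>) \<and>
        (\<forall>i<m. n2 (X t i - nc_trunc N n (P i) (B t)) \<le> \<delta>)" if t: "t \<in> S" for t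
      unfolding B_def
    proof (rule approx[OF tracial_algebra_axioms])
      have mic: "\<forall>j<m. mat_opnorm (A t j) \<le> R0" "\<forall>s w. 1 \<le> s \<and> s \<le> q \<and> w \<in> words m s \<longrightarrow>
           cmod (\<tau> (op_word x w) - normalized_mat_trace k (mat_word k (A t) w)) < \<epsilon>"
        using t unfolding S_def microstates_def by blast+
      have "norm (X t i) \<le> R0" if "i < m" for i
        unfolding X_def using norm_mat_op_le[OF Ac[OF that]] mic(1) that order_trans by blast
      then show "\<forall>i<m. X t i \<in> corner_algebra k \<and> self_adjoint (X t i) \<and> norm (X t i) \<le> R0"
        using Xin by blast
      have "corner_trace k (op_word (X t) w) = normalized_mat_trace k (mat_word k (A t) w)" if "w \<in> words m s" for w s
        unfolding X_def[abs_def] by (rule corner_trace_word[of m]) (use that Ac in \<open>auto simp: words_def\<close>)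
      then show "\<forall>s w. 1 \<le> s \<and> s \<le> q \<and> w \<in> words m s \<longrightarrow>
          cmod (\<tau> (op_word x w) - corner_trace k (op_word (X t) w)) < \<epsilon>"
        using mic(2) by (intro allI impI) (elim conjE, simp only:)
    qed
    define \<beta> where "\<beta> t = (\<lambda>(j, p). sa_coord (B t j) p)" for t
    define h where "h = \<delta> / (2 * sqrt (real k))"
    \<comment> \<open>Makes (\<kappa> - 1) h = \<rho> / sqrt k, the mean coordinate bound from
      \<open>sum_abs_coord_le\<close>.\<close>
    define \<kappa> where "\<kappa> = 1 + 2 * \<rho> / \<delta>"
    have h: "h > 0" and \<kappa>: "\<kappa> > 0" using \<delta> k0 \<rho>0 by (simp_all add: h_def \<kappa>_def add_pos_pos)
    have "(\<Sum>p\<in>J. \<bar>\<beta> t p\<bar>) \<le> (\<kappa> - 1) * h * real (card J)" if "t \<in> S" for t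
    proof -
      have "(\<Sum>p\<in>J. \<bar>\<beta> t p\<bar>) = (\<Sum>(j, p)\<in>J. \<bar>sa_coord (B t j) p\<bar>)"
        by (simp add: \<beta>_def case_prod_unfold)
      also have "\<dots> \<le> real n * real k * sqrt (real k) * \<rho>"
        unfolding J_def using S_prop[OF that] Bin \<rho>0 k by (intro sum_abs_coord_le) auto
      also have "\<dots> = (\<kappa> - 1) * h * real (card J)"
      proof -
        have "sqrt (real k) * sqrt (real k) = real k" by simp
        then have "real k / sqrt (real k) = sqrt (real k)" by (simp add: real_div_sqrt)
        then show ?thesis using \<delta> k0 unfolding \<kappa>_def h_def cJ by (simp add: power2_eq_square field_simps)
      qed
      finally show ?thesis .
    qed
    then obtain T where T: "T \<subseteq> S" "finite T" "real (card T) \<le> (exp 1 * (1 + 2 * \<kappa>)) ^ card J"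
      "\<And>s. s \<in> S \<Longrightarrow> \<exists>s'\<in>T. \<forall>p\<in>J. \<bar>\<beta> s p - \<beta> s' p\<bar> \<le> h"
      using grid_representatives[OF fJ h \<kappa>, of S \<beta>] by metis
    \<comment> \<open>Each of the m matrices moves by at most (2 + L) \<delta> in 2-norm: \<delta>
      at either end from x_i - P_i(B), and L \<delta> from the change of B. In squared coordinates
      this is k ((2 + L) \<delta>)^2 per matrix.\<close>
    define r where "r = sqrt (real m * real k) * ((2 + L) * \<delta>)"
    have r: "r > 0" using \<delta> k0 \<open>m \<ge> 1\<close> L(2) by (simp add: r_def)
    define ball where "ball c = {t \<in> space \<mu>. (\<Sum>p\<in>I. (t p - c p)\<^sup>2) \<le> r\<^sup>2}" for c
    define V where "V = (sqrt (2 * pi * exp 1) * r / sqrt (real (card I))) ^ card I"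
    have ball: "ball c \<in> sets \<mu>" "emeasure \<mu> (ball c) \<le> ennreal V" for c
      unfolding ball_def \<mu>_def V_def by (rule emeasure_l2_ball_le[OF fI r])+
    have cover: "S \<subseteq> (\<Union>s\<in>T. ball s)"
    proof
      fix t assume t: "t \<in> S"
      then obtain s where s: "s \<in> T" "\<And>p. p \<in> J \<Longrightarrow> \<bar>\<beta> t p - \<beta> s p\<bar> \<le> h" using T(4) by blast
      have sS: "s \<in> S" using s(1) T(1) by blast
      have BB: "n2 (B t j - B s j) \<le> \<delta>" if j: "j < n" for j
      proof (rule n2_corner_le_coord[OF k Bin[OF j] Bin[OF j]])
        show "\<bar>sa_coord (B t j) (a, c) - sa_coord (B s j) (a, c)\<bar> \<le> \<delta> / (2 * sqrt (real k))" if "a < k" "c < k" for a c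
          using s(2)[of "(j, a, c)"] that j by (simp add: \<beta>_def h_def J_def)
      qed (use S_prop[OF t] S_prop[OF sS] j \<delta> in auto)
      have XX: "n2 (X t i - X s i) \<le> (2 + L) * \<delta>" if i: "i < m" for i
      proof -
        let ?u = "nc_trunc N n (P i) (B t)" and ?v = "nc_trunc N n (P i) (B s)"
        have uv: "?u \<in> corner_algebra k" "?v \<in> corner_algebra k" using Bin by (auto intro: nc_trunc_in)
        have "n2 (?u - ?v) \<le> L * \<delta>"
          by (rule n2_trunc_diff[OF _ _ _ _ _ _ _ L(1)[OF i]])
             (use Bin S_prop[OF t] S_prop[OF sS] BB \<rho>0 \<delta> in auto)
        moreover have "n2 (X t i - ?u) \<le> \<delta>" using S_prop[OF t] i by blast
        moreover have "n2 (?v - X s i) \<le> \<delta>"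
          using S_prop[OF sS] i n2_diff_commute[OF uv(2) Xin(1)[OF i]] by simp
        moreover have "n2 (((X t i - ?u) + (?u - ?v)) + (?v - X s i)) \<le> (n2 (X t i - ?u) + n2 (?u - ?v)) + n2 (?v - X s i)"
          by (intro order_trans[OF n2_triangle] add_right_mono n2_triangle add_in diff_in uv Xin i)
        ultimately show ?thesis by (simp add: algebra_simps)
      qed
      have "(\<Sum>p\<in>I. (t p - s p)\<^sup>2) = (\<Sum>i<m. \<Sum>p\<in>{..<k} \<times> {..<k}. (t (i, p) - s (i, p))\<^sup>2)"
        unfolding I_def by (simp add: sum.cartesian_product)
      also have "\<dots> \<le> (\<Sum>i<m. real k * ((2 + L) * \<delta>)\<^sup>2)"
        using XX by (intro sum_mono coords_dist_le[OF k]) (simp add: X_def A)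
      also have "\<dots> = r\<^sup>2" by (simp add: r_def power_mult_distrib)
      finally show "t \<in> (\<Union>s\<in>T. ball s)" using s(1) t by (auto simp: ball_def S_def)
    qed
    have "sa_tuple_volume m k (microstates \<tau> m x R0 q k \<epsilon>) = emeasure \<mu> S"
      unfolding sa_tuple_volume_def Let_def S_def \<mu>_def I_def A_def ..
    also have "\<dots> \<le> emeasure \<mu> (\<Union>s\<in>T. ball s)"
      using ball(1) T(2) by (intro emeasure_mono cover sets.finite_UN) auto
    also have "\<dots> \<le> (\<Sum>s\<in>T. emeasure \<mu> (ball s))"
      using ball(1) T(2) by (intro emeasure_subadditive_finite) auto
    also have "\<dots> \<le> (\<Sum>s\<in>T. ennreal V)" by (intro sum_mono ball)
    also have "\<dots> = ennreal (real (card T) * V)" by (simp add: ennreal_mult' ennreal_of_nat_eq_real_of_nat)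
    also have "\<dots> \<le> ennreal ((exp 1 * (3 + 4 * \<rho>) / \<delta>) ^ (n * k\<^sup>2) *
      (sqrt (2 * pi * exp 1) * (2 + L) * \<delta> / sqrt (real k)) ^ (m * k\<^sup>2))"
    proof (rule ennreal_leI, rule mult_mono)
      \<comment> \<open>1 + 2 \<kappa> equals 3 + 4 \<rho> / \<delta>, and \<delta> \<le> 1 allows
        dividing the 3 as well.\<close>
      have "1 + 2 * \<kappa> \<le> (3 + 4 * \<rho>) / \<delta>" using \<delta> by (simp add: \<kappa>_def field_simps)
      then have "(exp 1 * (1 + 2 * \<kappa>)) ^ card J \<le> (exp 1 * ((3 + 4 * \<rho>) / \<delta>)) ^ card J"
        using \<kappa> by (intro power_mono mult_left_mono) auto
      then show "real (card T) \<le> (exp 1 * (3 + 4 * \<rho>) / \<delta>) ^ (n * k\<^sup>2)"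
        using T(3) by (simp add: cJ)
      have "r / sqrt (real (card I)) = (2 + L) * \<delta> / sqrt (real k)"
        using k0 \<open>m \<ge> 1\<close> by (simp add: r_def cI real_sqrt_mult power2_eq_square field_simps)
      then have "sqrt (2 * pi * exp 1) * (r / sqrt (real (card I))) = sqrt (2 * pi * exp 1) * ((2 + L) * \<delta> / sqrt (real k))"
        by (rule arg_cong)
      then show "V \<le> (sqrt (2 * pi * exp 1) * (2 + L) * \<delta> / sqrt (real k)) ^ (m * k\<^sup>2)"
        by (simp add: V_def cI mult.assoc)
      show "0 \<le> V" using r by (simp add: V_def)
      show "0 \<le> (exp 1 * (3 + 4 * \<rho>) / \<delta>) ^ (n * k\<^sup>2)" using \<rho>0 \<delta> by simp
    qed
    finally show ?thesis .
  qed
  then show ?thesis using \<open>\<epsilon> > 0\<close> by blast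
qed

lemma ln_ennreal_le:
  assumes "v \<le> ennreal w" "w > 0"
  shows "ln_ennreal v \<le> ereal (ln w)"
proof (cases "v = 0")
  case False
  have fin: "v < \<infinity>" using assms(1) by (rule le_less_trans) simp
  have "0 < enn2real v" using False fin by (simp add: enn2real_positive_iff zero_less_iff_neq_zero)
  moreover have "enn2real v \<le> w" using assms by (intro enn2real_leI) auto
  ultimately show ?thesis using False fin by (simp add: ln_ennreal_def)
qed (simp add: ln_ennreal_def)

text \<open>The factor 1 / sqrt k per dimension of the balls cancels the normalisation (m / 2) ln k
  exactly, so the same bound holds at every k \<ge> 1 and no limit has to be computed.\<close>

lemma microstate_limsup_le:
  assumes C: "C1 > 0" "C2 > 0" "\<delta> > 0"
    and vol: "\<And>k. k \<ge> 1 \<Longrightarrow> V k \<le> ennreal ((C1 / \<delta>) ^ (n * k\<^sup>2) * (C2 * \<delta> / sqrt (real k)) ^ (m * k\<^sup>2))"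
  shows "limsup (\<lambda>k. ereal (1 / (real k)\<^sup>2) * ln_ennreal (V k) + ereal (real m / 2 * ln (real k)))
    \<le> ereal (real n * ln C1 + real m * ln C2 + (real m - real n) * ln \<delta>)"
proof (rule Limsup_bounded, unfold eventually_sequentially, intro exI[of _ 1] allI impI)
  fix k :: nat assume k: "1 \<le> k"
  then have k0: "real k > 0" by simp
  define W where "W = (C1 / \<delta>) ^ (n * k\<^sup>2) * (C2 * \<delta> / sqrt (real k)) ^ (m * k\<^sup>2)"
  have W: "W > 0" using C k0 by (simp add: W_def)
  have "ln W = ln ((C1 / \<delta>) ^ (n * k\<^sup>2)) + ln ((C2 * \<delta> / sqrt (real k)) ^ (m * k\<^sup>2))"
    unfolding W_def using C k0 by (intro ln_mult_pos) auto
  also have "\<dots> = real (n * k\<^sup>2) * (ln C1 - ln \<delta>) + real (m * k\<^sup>2) * (ln C2 + ln \<delta> - ln (real k) / 2)"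
    using C k0 by (simp add: ln_realpow ln_div ln_mult ln_sqrt)
  finally have "1 / (real k)\<^sup>2 * ln W = real n * (ln C1 - ln \<delta>) + real m * (ln C2 + ln \<delta> - ln (real k) / 2)"
    using k0 by (simp add: field_simps)
  then have eq: "1 / (real k)\<^sup>2 * ln W + real m / 2 * ln (real k) = real n * ln C1 + real m * ln C2 + (real m - real n) * ln \<delta>"
    by (simp add: algebra_simps)
  have "ereal (1 / (real k)\<^sup>2) * ln_ennreal (V k) \<le> ereal (1 / (real k)\<^sup>2) * ereal (ln W)"
    using ln_ennreal_le[OF vol[OF k, folded W_def] W] by (intro ereal_mult_left_mono) auto
  then have "ereal (1 / (real k)\<^sup>2) * ln_ennreal (V k) + ereal (real m / 2 * ln (real k))
      \<le> ereal (1 / (real k)\<^sup>2) * ereal (ln W) + ereal (real m / 2 * ln (real k))"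
    by (rule add_right_mono)
  also have "\<dots> = ereal (real n * ln C1 + real m * ln C2 + (real m - real n) * ln \<delta>)"
    using eq by simp
  finally show "ereal (1 / (real k)\<^sup>2) * ln_ennreal (V k) + ereal (real m / 2 * ln (real k))
      \<le> ereal (real n * ln C1 + real m * ln C2 + (real m - real n) * ln \<delta>)" .
qed

theorem theorem2p3:
  fixes M :: "'h::complex_hilbert_space op set"
    and \<tau> :: "'h op \<Rightarrow> complex"
    and x y :: "nat \<Rightarrow> 'h op"
    and P :: "nat \<Rightarrow> nat list \<Rightarrow> complex"
    and m n :: nat
    and R b :: real
  assumes "type_II1_factor M"
    and "normalized_faithful_normal_trace M \<tau>"
    and "n \<ge> 1"
    and "\<And>i. i < m \<Longrightarrow> x i \<in> M \<and> self_adjoint (x i)"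
    and "\<And>j. j < n \<Longrightarrow> y j \<in> M \<and> self_adjoint (y j)"
    and "\<And>j. j < n \<Longrightarrow> y j \<in> commutant (commutant (x ` {..<m}))"
    and "free_entropy \<tau> m x > -\<infinity>"
    and "b = Max ((\<lambda>j. norm (y j)) ` {..<n})"
    and "R > b"
    and "\<And>i. i < m \<Longrightarrow> radius_of_convergence n (P i) R"
    and "\<And>i. i < m \<Longrightarrow> x i = nc_power_series_eval n (P i) y"
  shows "n \<ge> m"
proof (rule ccontr)
  assume "\<not> n \<ge> m"
  then have mn: "n < m" by simp
  have vN: "von_neumann_algebra M" using assms(1) by (simp add: type_II1_factor_def factor_def)
  have yb: "norm (y j) \<le> b" if "j < n" for j unfolding assms(8) using that by (intro Max_ge) auto
  \<comment> \<open>With n \<ge> 1 the maximum is over a nonempty set and \<open>y 0\<close> bounds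
    it from below by 0.\<close>
  have b0: "0 \<le> b" using yb[of 0] assms(3) norm_ge_zero[of "y 0"] by linarith
  \<comment> \<open>Two intermediate radii: b' makes the bound on the y_j strict and positive even
    if b = 0, and \<rho> leaves room on both sides for the cut-off and for the derivative
    series.\<close>
  define b' where "b' = b + (R - b) / 3"
  define \<rho> where "\<rho> = b + 2 * (R - b) / 3"
  have \<rho>: "0 < b'" "b' < \<rho>" "\<rho> < R" "b < b'" using assms(9) b0 by (simp_all add: b'_def \<rho>_def field_simps)
  have "\<exists>L\<ge>0. \<forall>N. (\<Sum>k<N. \<Sum>w\<in>words n k. cmod (P i w) * (real k * \<rho> ^ (k - 1))) \<le> L" if "i < m" for i
    by (rule derivative_series_bounded[OF assms(10)[OF that]]) (use \<rho> in auto)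
  then have "\<forall>i. \<exists>L. i < m \<longrightarrow> 0 \<le> L \<and> (\<forall>N. (\<Sum>k<N. \<Sum>w\<in>words n k. cmod (P i w) * (real k * \<rho> ^ (k - 1))) \<le> L)"
    by blast
  from choice[OF this] obtain l where
    "\<forall>i. i < m \<longrightarrow> 0 \<le> l i \<and> (\<forall>N. (\<Sum>k<N. \<Sum>w\<in>words n k. cmod (P i w) * (real k * \<rho> ^ (k - 1))) \<le> l i)" ..
  then have l: "\<And>i. i < m \<Longrightarrow> 0 \<le> l i"
    "\<And>i N. i < m \<Longrightarrow> (\<Sum>k<N. \<Sum>w\<in>words n k. cmod (P i w) * (real k * \<rho> ^ (k - 1))) \<le> l i"
    by simp_all
  define L where "L = (\<Sum>i<m. l i)"
  have L0: "0 \<le> L" unfolding L_def using l(1) by (intro sum_nonneg) auto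
  have L: "(\<Sum>k<N. \<Sum>w\<in>words n k. cmod (P i w) * (real k * \<rho> ^ (k - 1))) \<le> L" if "i < m" for i N
  proof -
    have "l i \<le> L" unfolding L_def using that l(1) by (intro member_le_sum) auto
    then show ?thesis using l(2)[OF that, of N] by linarith
  qed
  define C1 where "C1 = exp 1 * (3 + 4 * \<rho>)"
  define C2 where "C2 = sqrt (2 * pi * exp 1) * (2 + L)"
  have C: "C1 > 0" "C2 > 0" using \<rho> L0 by (simp_all add: C1_def C2_def)
  have inf: "(INF (q, \<epsilon>)\<in>UNIV \<times> {0<..}.
        limsup (\<lambda>k. ereal (1 / (real k)\<^sup>2) * ln_ennreal (sa_tuple_volume m k (microstates \<tau> m x R0 q k \<epsilon>))
                   + ereal (real m / 2 * ln (real k)))) \<le> ereal u" for R0 u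
  proof -
    define c where "c = real n * ln C1 + real m * ln C2"
    \<comment> \<open>The exponential solves c + (m - n) ln \<delta> = u; as m > n, capping it at 1
      only lowers the left-hand side.\<close>
    define \<delta> where "\<delta> = min 1 (exp ((u - c) / (real m - real n)))"
    have \<delta>: "\<delta> > 0" "\<delta> \<le> 1" by (simp_all add: \<delta>_def)
    have "ln \<delta> \<le> (u - c) / (real m - real n)"
    proof -
      have "ln \<delta> \<le> ln (exp ((u - c) / (real m - real n)))"
        using \<delta>(1) by (intro ln_mono) (auto simp: \<delta>_def)
      then show ?thesis by simp
    qed
    then have small: "c + (real m - real n) * ln \<delta> \<le> u" using mn by (simp add: field_simps)
    have "\<exists>q \<epsilon>. \<epsilon> > 0 \<and> (\<forall>k\<ge>1. sa_tuple_volume m k (microstates \<tau> m x R0 q k \<epsilon>) \<le>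
        ennreal ((C1 / \<delta>) ^ (n * k\<^sup>2) * (C2 * \<delta> / sqrt (real k)) ^ (m * k\<^sup>2)))"
      unfolding C1_def C2_def
    proof (rule microstate_volume_le[where y = y and b = b' and R = R and P = P, OF vN assms(2)])
      show "norm (y j) < b'" if "j < n" for j using yb[OF that] \<rho>(4) by linarith
    qed (use assms(4,5,6,10,11) \<rho> L L0 \<delta> mn in simp_all)
    then obtain q \<epsilon> where "\<epsilon> > 0" and vol: "\<And>k. k \<ge> 1 \<Longrightarrow> sa_tuple_volume m k (microstates \<tau> m x R0 q k \<epsilon>) \<le>
        ennreal ((C1 / \<delta>) ^ (n * k\<^sup>2) * (C2 * \<delta> / sqrt (real k)) ^ (m * k\<^sup>2))"
      by blast
    have "limsup (\<lambda>k. ereal (1 / (real k)\<^sup>2) * ln_ennreal (sa_tuple_volume m k (microstates \<tau> m x R0 q k \<epsilon>))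
        + ereal (real m / 2 * ln (real k))) \<le> ereal (c + (real m - real n) * ln \<delta>)"
      unfolding c_def by (rule microstate_limsup_le[OF C \<delta>(1) vol])
    also have "\<dots> \<le> ereal u" using small by simp
    finally show ?thesis using \<open>\<epsilon> > 0\<close> by (intro INF_lower2[of "(q, \<epsilon>)"]) auto
  qed
  \<comment> \<open>The bound u was arbitrary and did not depend on R0, so the supremum over R0 lies
    below every real number.\<close>
  have "free_entropy \<tau> m x \<le> ereal u" for u
    unfolding free_entropy_def by (intro SUP_least inf)
  then have "free_entropy \<tau> m x = -\<infinity>" by (rule ereal_bot)
  with assms(7) show False by simp
qed

end
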